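(* Let $\mathbb{X}=(\mathbb{P}^1,\mathbb{P}^1,\sigma_1,\sigma_2)$ be a correspondence over $k$ in which both $\sigma_1,\sigma_2:\mathbb{P}^1\to\mathbb{P}^1$ are tamely ramified. Suppose $(\sigma_1,\sigma_2)\sim(\sigma_1',\sigma_2')$ where $\sigma_1'$ and $\sigma_2'$ are completely ramified at a point. Further assume that $\deg\sigma_1\ge 14\deg\sigma_2$. If $\mathcal{G}_{\mathbb{X}}$ is non-trivial and $\omega$ is its primitive, then $\omega$ is flat.
   Context: The field $k$ is either an algebraically closed field of any characteristic or a number field. Tamely ramified means that all ramification indices are prime to the characteristic of $k$ (no condition in characteristic $0$). A morphism is completely ramified at a point if its ramification index there equals its degree. $(\sigma_1,\sigma_2)\sim(\sigma_1',\sigma_2')$ means the pairs are conjugate: there is an automorphism $\varphi$ of $\mathbb{P}^1$ with $\sigma_1'=\varphi\circ\sigma_1\circ\varphi^{-1}$ and $\sigma_2'=\varphi\circ\sigma_2\circ\varphi^{-1}$. For $\nu\in\mathbb{Z}$, a form of weight $\nu$ on a curve $Y$ is an element of $\Omega_{K(Y)}^{\otimes\nu}$, where $\Omega_{K(Y)}$ denotes the rational $1$-forms on $Y$. A nonzero form $\omega$ on $Y$ is semi-invariant for a correspondence $(Y,X,\sigma_1,\sigma_2)$ if $\sigma_1^*\omega=\lambda\sigma_2^*\omega$ for some $\lambda\in k^\times$. $\mathcal{G}_{\mathbb{X}}$ is the group (under multiplication of forms, weights adding) of semi-invariant forms modulo the relation $\omega\sim\omega'$ iff $\omega/\omega'$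 is a constant function. A nonzero form $\omega$ is primitive if its class $[\omega]$ belongs to $\mathcal{G}_{\mathbb{X}}$ and generates $\mathcal{G}_{\mathbb{X}}$. A form $\omega$ on $\mathbb{P}^1$ (with coordinate $t$) is flat if it is either $\omega=\frac{dt}{t-a}$ or $\omega=\frac{(dt)^2}{(t-a)(t-b)}$ for some $a$ and $b$ with $a\neq b$.
   Formalization: "ω is flat" is read as: up to a nonzero constant, ω or its inverse is flat in some coordinate of the projective line, with a, b and that coordinate taken over the algebraic closure of k; literally it fails, e.g. 2dt/t is also primitive for (t^14, t). *)

theory Defs
  imports "HOL-Algebra.Algebraic_Closure_Type" "HOL-Algebra.Generated_Groups"
begin

section \<open>Ground fields\<close>

definition alg_closed_field_type :: "'a::field itself \<Rightarrow> bool" where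
  "alg_closed_field_type _ \<longleftrightarrow>
     (\<forall>p :: 'a poly. Polynomial.degree p > 0 \<longrightarrow> (\<exists>x. poly p x = 0))"

text \<open>The rational scalar \<open>c b\<close> is embedded as a quotient of integers because the library
  embedding of the rationals needs the characteristic to be 0 on the level of type classes.\<close>

definition number_field_type :: "'a::field itself \<Rightarrow> bool" where
  "number_field_type _ \<longleftrightarrow>
     CHAR('a) = 0 \<and>
     (\<exists>B :: 'a set. finite B \<and>
        (\<forall>x. \<exists>c :: 'a \<Rightarrow> rat.
           x = (\<Sum>b\<in>B. of_int (fst (quotient_of (c b))) / of_int (snd (quotient_of (c b))) * b)))"


section \<open>The function field of the projective line\<close>

text \<open>The function field \<open>K(P\<^sup>1) = k(t)\<close> is the fraction field of the polynomial ring.\<close>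

type_synonym 'a ratfun = "'a poly fract"

definition rf_const :: "'a::field \<Rightarrow> 'a ratfun" where
  "rf_const c = to_fract [:c:]"

definition rf_X :: "'a::field ratfun" where
  "rf_X = to_fract [:0, 1:]"

text \<open>The representation as a quotient of coprime polynomials with monic denominator. The
  library's \<open>quot_of_fract\<close> is not used: it would need a gcd class on top of \<open>field\<close>.\<close>

definition reduced_rep :: "'a::field ratfun \<Rightarrow> 'a poly \<times> 'a poly" where
  "reduced_rep f = (THE (p, q). coprime p q \<and> lead_coeff q = 1 \<and> f = Fract p q)"

definition rf_num :: "'a::field ratfun \<Rightarrow> 'a poly" where
  "rf_num f = fst (reduced_rep f)"

definition rf_den :: "'a::field ratfun \<Rightarrow> 'a poly" where
  "rf_den f = snd (reduced_rep f)"

lemma coprime_poly_dvd_mult: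
  fixes p q s :: "'a::field poly"
  assumes "coprime p q" and "q dvd p * s"
  shows "q dvd s"
proof (cases "q = 0")
  case False
  define I where "I = {g. g \<noteq> 0 \<and> (\<exists>u v. g = u * p + v * q)}"
  have "q = 0 * p + 1 * q" by simp
  then have "q \<in> I" using False unfolding I_def by blast
  then obtain g where "g \<in> I"
    and min: "\<And>h. Polynomial.degree h < Polynomial.degree g \<Longrightarrow> h \<notin> I"
    using measure_induct_rule[of Polynomial.degree "\<lambda>r. r \<notin> I"] by blast
  then obtain u v where g: "g \<noteq> 0" "g = u * p + v * q" by (auto simp: I_def)
  have dvd: "g dvd x * p + y * q" for x y
  proof -
    let ?h = "x * p + y * q"
    have "?h mod g = ?h - g * (?h div g)" by (simp add: minus_mult_div_eq_mod)
    also have "\<dots> = (x - u * (?h div g)) * p + (y - v * (?h div g)) * q"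
      by (subst (1) g(2)) (simp add: algebra_simps)
    finally have "?h mod g \<noteq> 0 \<Longrightarrow> ?h mod g \<in> I" unfolding I_def by blast
    moreover have "?h mod g \<noteq> 0 \<Longrightarrow> Polynomial.degree (?h mod g) < Polynomial.degree g"
      using degree_mod_less'[OF g(1)] by blast
    ultimately show ?thesis using min by (auto simp: dvd_eq_mod_eq_0)
  qed
  have "g dvd p" using dvd[of 1 0] by simp
  moreover have "g dvd q" using dvd[of 0 1] by simp
  ultimately have "is_unit g" by (rule coprime_common_divisor[OF assms(1)])
  have "g * s = u * (p * s) + v * s * q" unfolding g(2) by (simp add: algebra_simps)
  moreover have "q dvd u * (p * s) + v * s * q"
    by (intro dvd_add dvd_mult assms(2)) simp
  ultimately have "q dvd g * s" by simp
  then show ?thesis using \<open>is_unit g\<close> by (simp add: dvd_mult_unit_iff')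
qed (use assms in auto)

lemma reduced_rep_ex1:
  fixes f :: "'a::field ratfun"
  shows "\<exists>!x. case x of (p, q) \<Rightarrow> coprime p q \<and> lead_coeff q = 1 \<and> f = Fract p q"
proof (rule ex_ex1I)
  let ?D = "{q. q \<noteq> 0 \<and> (\<exists>p. f = Fract p q)}"
  obtain p0 q0 where "f = Fract p0 q0" "q0 \<noteq> 0" by (cases f) auto
  then have "q0 \<in> ?D" by auto
  then obtain q where q: "q \<in> ?D"
    and min: "\<And>r. Polynomial.degree r < Polynomial.degree q \<Longrightarrow> r \<notin> ?D"
    using measure_induct_rule[of Polynomial.degree "\<lambda>r. r \<notin> ?D"] by blast
  then obtain p where p: "f = Fract p q" "q \<noteq> 0" by auto
  have "coprime p q"
  proof (rule coprimeI)
    fix d assume d: "d dvd p" "d dvd q"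
    then obtain u v where uv: "p = d * u" "q = d * v" by (auto elim!: dvdE)
    have nz: "d \<noteq> 0" "v \<noteq> 0" using uv p by auto
    then have "f = Fract u v" using p uv by (simp add: eq_fract)
    then have "v \<in> ?D" using nz by auto
    then have "\<not> Polynomial.degree v < Polynomial.degree q" using min by auto
    then have "Polynomial.degree d = 0" using uv nz by (simp add: degree_mult_eq)
    then show "is_unit d" using nz by (simp add: is_unit_iff_degree)
  qed
  define c where "c = inverse (lead_coeff q)"
  have c: "c \<noteq> 0" "c * lead_coeff q = 1" using p by (auto simp: c_def)
  have "coprime (smult c p) (smult c q)"
    using \<open>coprime p q\<close> c(1) by (simp add: coprime_def dvd_smult_iff)
  moreover have "lead_coeff (smult c q) = 1" using c by simp
  moreover have "f = Fract (smult c p) (smult c q)" using p c by (simp add: eq_fract)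
  ultimately show "\<exists>x. case x of (p, q) \<Rightarrow> coprime p q \<and> lead_coeff q = 1 \<and> f = Fract p q"
    by (intro exI[of _ "(smult c p, smult c q)"] case_prodI conjI)
next
  fix x y
  assume "case x of (p, q) \<Rightarrow> coprime p q \<and> lead_coeff q = 1 \<and> f = Fract p q"
    and "case y of (p, q) \<Rightarrow> coprime p q \<and> lead_coeff q = 1 \<and> f = Fract p q"
  then obtain p q r s where xy: "x = (p, q)" "y = (r, s)"
    and co: "coprime p q" "coprime r s" and lc: "lead_coeff q = 1" "lead_coeff s = 1"
    and eq: "Fract p q = Fract r s" by (auto split: prod.splits)
  have nz: "q \<noteq> 0" "s \<noteq> 0" using lc by auto
  have cross: "p * s = r * q" using eq nz by (simp add: eq_fract)
  have "q dvd p * s" unfolding cross by simp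
  then have "q dvd s" by (rule coprime_poly_dvd_mult[OF co(1)])
  have "s dvd r * q" unfolding cross[symmetric] by simp
  then have "s dvd q" by (rule coprime_poly_dvd_mult[OF co(2)])
  from \<open>q dvd s\<close> obtain k where k: "s = q * k" ..
  have "Polynomial.degree s \<le> Polynomial.degree q"
    using \<open>s dvd q\<close> nz(1) by (rule dvd_imp_degree_le)
  then have "Polynomial.degree k = 0" using k nz by (simp add: degree_mult_eq)
  moreover have "lead_coeff k = 1" using k lc by (simp add: lead_coeff_mult)
  ultimately have "k = 1" using degree_0_id[of k] by (simp add: one_pCons)
  then have "q = s" using k by simp
  then show "x = y" using xy cross nz by simp
qed

text \<open>Composition: \<open>rf_compose f g\<close> is \<open>f(g(t))\<close>, for nonconstant \<open>g\<close> (then \<open>g\<close> is transcendental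
  over the constants and the denominator below does not vanish). Read in \<open>f\<close>, it is the
  pullback of functions along \<open>g\<close>; for two morphisms it is their composition.\<close>

definition rf_compose :: "'a::field ratfun \<Rightarrow> 'a ratfun \<Rightarrow> 'a ratfun" where
  "rf_compose f g =
     poly (map_poly rf_const (rf_num f)) g / poly (map_poly rf_const (rf_den f)) g"

definition rf_deriv :: "'a::field ratfun \<Rightarrow> 'a ratfun" where
  "rf_deriv f = (let p = rf_num f; q = rf_den f in
     Fract (pderiv p * q - p * pderiv q) (q ^ 2))"

definition rf_base_change :: "'a::field ratfun \<Rightarrow> 'a alg_closure ratfun" where
  "rf_base_change f = Fract (map_poly to_ac (rf_num f)) (map_poly to_ac (rf_den f))"


section \<open>Points, orders, ramification\<close>

text \<open>The set \<open>P\<^sup>1(k)\<close>.\<close>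

datatype 'a pline = Finite 'a | Infinity

definition rf_ord :: "'a::field pline \<Rightarrow> 'a ratfun \<Rightarrow> int" where
  "rf_ord P f = (case P of
      Finite a \<Rightarrow> int (Polynomial.order a (rf_num f)) - int (Polynomial.order a (rf_den f))
    | Infinity \<Rightarrow> int (Polynomial.degree (rf_den f)) - int (Polynomial.degree (rf_num f)))"

definition uniformizer :: "'a::field pline \<Rightarrow> 'a ratfun" where
  "uniformizer P = (case P of
      Finite a \<Rightarrow> rf_X - rf_const a
    | Infinity \<Rightarrow> 1 / rf_X)"

text \<open>Nonconstant morphisms from the projective line to itself are identified with nonconstant
  rational functions.\<close>

definition pline_morphism :: "'a::field ratfun \<Rightarrow> bool" where
  "pline_morphism \<sigma> \<longleftrightarrow> \<sigma> \<notin> range rf_const"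

definition morphism_app :: "'a::field ratfun \<Rightarrow> 'a pline \<Rightarrow> 'a pline" where
  "morphism_app \<sigma> P = (let p = rf_num \<sigma>; q = rf_den \<sigma> in
     case P of
       Finite a \<Rightarrow> if poly q a = 0 then Infinity else Finite (poly p a / poly q a)
     | Infinity \<Rightarrow> if Polynomial.degree p > Polynomial.degree q then Infinity
                  else Finite (Polynomial.coeff p (Polynomial.degree q) / lead_coeff q))"

definition morphism_degree :: "'a::field ratfun \<Rightarrow> nat" where
  "morphism_degree \<sigma> = max (Polynomial.degree (rf_num \<sigma>)) (Polynomial.degree (rf_den \<sigma>))"

definition ram_index :: "'a::field ratfun \<Rightarrow> 'a pline \<Rightarrow> nat" where
  "ram_index \<sigma> P = nat (rf_ord P (rf_compose (uniformizer (morphism_app \<sigma> P)) \<sigma>))"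

text \<open>Points are geometric points, that is, points over the algebraic closure. For perfect \<open>k\<close>
  this agrees with closed points: the ramification index at a closed point is the one at any
  geometric point above it.\<close>

definition tamely_ramified :: "'a::field ratfun \<Rightarrow> bool" where
  "tamely_ramified \<sigma> \<longleftrightarrow>
     (CHAR('a) \<noteq> 0 \<longrightarrow>
       (\<forall>P :: 'a alg_closure pline. coprime (ram_index (rf_base_change \<sigma>) P) CHAR('a)))"

definition completely_ramified_at :: "'a::field ratfun \<Rightarrow> 'a alg_closure pline \<Rightarrow> bool" where
  "completely_ramified_at \<sigma> P \<longleftrightarrow> ram_index (rf_base_change \<sigma>) P = morphism_degree \<sigma>"

definition inverse_morphisms :: "'a::field ratfun \<Rightarrow> 'a ratfun \<Rightarrow> bool" where
  "inverse_morphisms \<phi> \<psi> \<longleftrightarrow>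
     pline_morphism \<phi> \<and> pline_morphism \<psi> \<and> rf_compose \<phi> \<psi> = rf_X \<and> rf_compose \<psi> \<phi> = rf_X"

definition pline_automorphism :: "'a::field ratfun \<Rightarrow> bool" where
  "pline_automorphism \<phi> \<longleftrightarrow> (\<exists>\<psi>. inverse_morphisms \<phi> \<psi>)"

definition conjugate_pairs :: "'a::field ratfun \<times> 'a ratfun \<Rightarrow> 'a ratfun \<times> 'a ratfun \<Rightarrow> bool" where
  "conjugate_pairs \<sigma> \<sigma>' \<longleftrightarrow> (\<exists>\<phi> \<psi>. inverse_morphisms \<phi> \<psi> \<and>
     fst \<sigma>' = rf_compose \<phi> (rf_compose (fst \<sigma>) \<psi>) \<and>
     snd \<sigma>' = rf_compose \<phi> (rf_compose (snd \<sigma>) \<psi>))"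


section \<open>Forms\<close>

text \<open>The pair \<open>(\<nu>, f)\<close> stands for the form \<open>f (dt)\<^sup>\<nu>\<close> of weight \<open>\<nu>\<close>; the differential \<open>dt\<close> is a
  basis of the rational 1-forms over \<open>k(t)\<close>.\<close>

type_synonym 'a form = "int \<times> 'a ratfun"

definition form_group :: "('a::field form) monoid" where
  "form_group = \<lparr>carrier = {\<omega>. snd \<omega> \<noteq> 0},
     monoid.mult = (\<lambda>\<omega> \<eta>. (fst \<omega> + fst \<eta>, snd \<omega> * snd \<eta>)), one = (0, 1)\<rparr>"

lemma comm_group_form_group: "comm_group (form_group :: ('a::field form) monoid)"
proof (rule comm_groupI)
  fix x :: "'a form" assume "x \<in> carrier form_group"
  then show "\<exists>y\<in>carrier form_group. y \<otimes>\<^bsub>form_group\<^esub> x = \<one>\<^bsub>form_group\<^esub>"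
    by (intro bexI[of _ "(- fst x, inverse (snd x))"]) (auto simp: form_group_def)
qed (auto simp: form_group_def)

text \<open>Pullback of forms, \<open>\<sigma>\<^sup>*(f (dt)\<^sup>\<nu>) = (f \<circ> \<sigma>) (\<sigma>')\<^sup>\<nu> (dt)\<^sup>\<nu>\<close>. For negative weight it makes sense
  only if \<open>\<sigma>\<close> is separable, which tame ramification implies.\<close>

definition form_pullback :: "'a::field ratfun \<Rightarrow> 'a form \<Rightarrow> 'a form" where
  "form_pullback \<sigma> \<omega> = (fst \<omega>, rf_compose (snd \<omega>) \<sigma> * rf_deriv \<sigma> powi fst \<omega>)"

definition form_smult :: "'a::field \<Rightarrow> 'a form \<Rightarrow> 'a form" where
  "form_smult c \<omega> = (fst \<omega>, rf_const c * snd \<omega>)"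

definition semi_invariant :: "'a::field ratfun \<Rightarrow> 'a ratfun \<Rightarrow> 'a form \<Rightarrow> bool" where
  "semi_invariant \<sigma>1 \<sigma>2 \<omega> \<longleftrightarrow> \<omega> \<in> carrier form_group \<and>
     (\<exists>c. c \<noteq> 0 \<and> form_pullback \<sigma>1 \<omega> = form_smult c (form_pullback \<sigma>2 \<omega>))"

definition const_forms :: "('a::field form) set" where
  "const_forms = {(0, rf_const c) | c. c \<noteq> 0}"

text \<open>The class of a form modulo nonzero constants.\<close>

definition form_class :: "'a::field form \<Rightarrow> 'a form set" where
  "form_class \<omega> = const_forms #>\<^bsub>form_group\<^esub> \<omega>"

definition semi_invariant_group ::
    "'a::field ratfun \<Rightarrow> 'a ratfun \<Rightarrow> ('a form set) monoid" where
  "semi_invariant_group \<sigma>1 \<sigma>2 =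
     form_group\<lparr>carrier := {\<omega>. semi_invariant \<sigma>1 \<sigma>2 \<omega>}\<rparr> Mod const_forms"

definition primitive_form :: "'a::field ratfun \<Rightarrow> 'a ratfun \<Rightarrow> 'a form \<Rightarrow> bool" where
  "primitive_form \<sigma>1 \<sigma>2 \<omega> \<longleftrightarrow> \<omega> \<in> carrier form_group \<and>
     form_class \<omega> \<in> carrier (semi_invariant_group \<sigma>1 \<sigma>2) \<and>
     generate (semi_invariant_group \<sigma>1 \<sigma>2) {form_class \<omega>} = carrier (semi_invariant_group \<sigma>1 \<sigma>2)"

definition form_base_change :: "'a::field form \<Rightarrow> 'a alg_closure form" where
  "form_base_change \<omega> = (fst \<omega>, rf_base_change (snd \<omega>))"

text \<open>A form is flat if it is \<open>ds/(s-a)\<close> or \<open>(ds)\<^sup>2/((s-a)(s-b))\<close>, \<open>a \<noteq> b\<close>, in some coordinate \<open>s\<close>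
  of the projective line; \<open>ds/(s-a)\<close> is the pullback of \<open>dt/(t-a)\<close> along the automorphism \<open>s\<close>.
  The coordinate cannot be fixed in advance: complete ramification and semi-invariance are
  unaffected by conjugation, whereas \<open>dt/(t-a)\<close> has a pole at infinity.\<close>

definition flat :: "'a::field form \<Rightarrow> bool" where
  "flat \<omega> \<longleftrightarrow> (\<exists>s. pline_automorphism s \<and>
     ((\<exists>a. \<omega> = form_pullback s (1, 1 / (rf_X - rf_const a))) \<or>
      (\<exists>a b. a \<noteq> b \<and>
         \<omega> = form_pullback s (2, 1 / ((rf_X - rf_const a) * (rf_X - rf_const b))))))"

end

theory Submission
  imports Defs
begin

text \<open>For a form \<open>\<omega>\<close> of weight \<open>\<nu> \<noteq> 0\<close> put \<open>\<mu>(P) = 1 + ord\<^sub>P \<omega> / \<nu>\<close>. Since the morphisms are tame,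
  semi-invariance means \<open>e\<^sub>1(Q) \<mu>(\<sigma>\<^sub>1 Q) = e\<^sub>2(Q) \<mu>(\<sigma>\<^sub>2 Q)\<close> for all \<open>Q\<close>, and the degree of the
  canonical divisor gives \<open>\<Sum>(1 - \<mu>) = 2\<close>. As \<open>d\<^sub>1\<close> is much larger than both \<open>d\<^sub>2\<close> and the total
  ramification of \<open>\<sigma>\<^sub>2\<close>, most points over \<open>\<mu> = c\<close> along \<open>\<sigma>\<^sub>1\<close> lie over \<open>\<mu> \<noteq> c\<close> along \<open>\<sigma>\<^sub>2\<close>; this
  forces \<open>0 \<le> \<mu> \<le> 1\<close> and excludes values of \<open>\<mu>\<close> in \<open>(1/2, 1)\<close> and in \<open>[3/7, 1/2)\<close>. At the point
  where \<open>\<sigma>\<^sub>1\<close> is totally ramified \<open>\<mu>\<close> is at most \<open>1/14\<close>, so the values of \<open>\<mu>\<close> other than \<open>1\<close> are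
  \<open>0, 0\<close> or \<open>1/2, 1/2, 0\<close>. These are the values for the two kinds of flat forms, hence \<open>\<omega>\<close> is a
  constant times a power \<open>\<eta>\<^sup>n\<close> of a flat form over the algebraic closure. Up to a constant \<open>\<eta>\<close> is
  defined over \<open>k\<close>, and it is semi-invariant, so primitivity of \<open>\<omega>\<close> gives \<open>n = 1\<close> or \<open>n = -1\<close>.\<close>

section \<open>Composition of rational functions\<close>

text \<open>If \<mu> took only values 1/m, the sum condition would say that the orbifold with
  multiplicities m is parabolic. Among the parabolic signatures only (infinity, infinity) and (2, 2,
  infinity), those of power maps and Chebyshev polynomials, have a multiplicity of at least 14. As
  \<mu> is not known to have this form, counting replaces the classification. The constant 14 serves
  twice. A value that unramified points preserve has a preimage of degree less than 13 times the
  degree of the second map per point: 1 from the unramified points, 12 from Hurwitz with weight 6.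
  And if three values differ from 1, the two outside the totally ramified image are at least 1 -
  1/14 - 1/2 = 3/7, where the excluded gap begins. Weight 0 needs its own argument because \<mu>
  divides by the weight: there unequal degrees leave only constants. The descent to k is an
  extraction of roots. It needs the exponent to be invertible in k, which characteristic 0 grants;
  in positive characteristic k is algebraically closed and nothing has to descend.\<close>

lemma reduced_rep:
  fixes f :: "'a::field ratfun"
  shows coprime_rf_num_den: "coprime (rf_num f) (rf_den f)"
    and lead_coeff_rf_den [simp]: "lead_coeff (rf_den f) = 1"
    and Fract_rf_num_den: "Fract (rf_num f) (rf_den f) = f"
  using theI'[OF reduced_rep_ex1[of f]]
  by (auto simp: rf_num_def rf_den_def reduced_rep_def split: prod.splits)

lemma rf_den_nonzero [simp]: "rf_den f \<noteq> 0"
  using lead_coeff_rf_den[of f] by fastforce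

lemma rf_num_den_Fract:
  fixes p q :: "'a::field poly"
  assumes "coprime p q" "lead_coeff q = 1"
  shows "rf_num (Fract p q) = p" "rf_den (Fract p q) = q"
proof -
  have "reduced_rep (Fract p q) = (p, q)"
    unfolding reduced_rep_def
    by (rule the1_equality[OF reduced_rep_ex1]) (use assms in simp)
  then show "rf_num (Fract p q) = p" "rf_den (Fract p q) = q"
    by (simp_all add: rf_num_def rf_den_def)
qed

lemma rf_num_eq_0_iff [simp]: "rf_num f = 0 \<longleftrightarrow> f = 0"
proof
  assume "rf_num f = 0"
  then show "f = 0" using Fract_rf_num_den[of f] by (simp add: fract_collapse)
next
  assume "f = 0"
  then have "f = Fract 0 1" by (simp add: Zero_fract_def)
  then show "rf_num f = 0" using rf_num_den_Fract(1)[of 0 1] by simp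
qed

text \<open>An element of least degree in the ideal of \<open>p\<close> and \<open>q\<close> leaves
  remainder 0 in every element of the ideal. It is thus a common divisor, hence a unit, and can be
  scaled to 1.\<close>

lemma coprime_poly_bezout:
  fixes p q :: "'a::field poly"
  assumes "coprime p q"
  shows "\<exists>u v. u * p + v * q = 1"
proof -
  define I where "I = {g. g \<noteq> 0 \<and> (\<exists>u v. g = u * p + v * q)}"
  have "p \<noteq> 0 \<or> q \<noteq> 0" using assms by auto
  moreover have "p = 1 * p + 0 * q" "q = 0 * p + 1 * q" by simp_all
  ultimately have "\<exists>g. g \<in> I" unfolding I_def by blast
  then obtain g where "g \<in> I"
    and min: "\<And>h. Polynomial.degree h < Polynomial.degree g \<Longrightarrow> h \<notin> I"
    using measure_induct_rule[of Polynomial.degree "\<lambda>r. r \<notin> I"] by blast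
  then obtain u v where g: "g \<noteq> 0" "g = u * p + v * q" by (auto simp: I_def)
  have dvd: "g dvd x * p + y * q" for x y
  proof -
    let ?h = "x * p + y * q"
    have "?h mod g = ?h - g * (?h div g)" by (simp add: minus_mult_div_eq_mod)
    also have "\<dots> = (x - u * (?h div g)) * p + (y - v * (?h div g)) * q"
      by (subst (1) g(2)) (simp add: algebra_simps)
    finally have "?h mod g \<noteq> 0 \<Longrightarrow> ?h mod g \<in> I" unfolding I_def by blast
    moreover have "?h mod g \<noteq> 0 \<Longrightarrow> Polynomial.degree (?h mod g) < Polynomial.degree g"
      using degree_mod_less'[OF g(1)] by blast
    ultimately show ?thesis using min by (auto simp: dvd_eq_mod_eq_0)
  qed
  have "g dvd p" using dvd[of 1 0] by simp
  moreover have "g dvd q" using dvd[of 0 1] by simp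
  ultimately have "is_unit g" by (rule coprime_common_divisor[OF assms])
  then obtain w where "1 = g * w" by (auto elim!: dvdE)
  then have "(w * u) * p + (w * v) * q = 1" unfolding g(2) by (simp add: algebra_simps)
  then show ?thesis by blast
qed

lemma coprime_polyI_bezout:
  fixes p q :: "'a::field poly"
  assumes "u * p + v * q = 1"
  shows "coprime p q"
proof (rule coprimeI)
  fix d assume "d dvd p" "d dvd q"
  then have "d dvd u * p + v * q" by simp
  then show "is_unit d" using assms by simp
qed

lemma rf_const_simps [simp]:
  "rf_const 0 = 0" "rf_const 1 = 1"
  "rf_const (a + b) = rf_const a + rf_const b"
  "rf_const (a * b) = rf_const a * rf_const b"
  "rf_const (- a) = - rf_const a"
  "rf_const (a - b) = rf_const a - rf_const b"
  "rf_const a = 0 \<longleftrightarrow> a = 0"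
  "rf_const a = rf_const b \<longleftrightarrow> a = b"
  by (auto simp: rf_const_def simp flip: to_fract_add to_fract_mult to_fract_uminus to_fract_diff)
    (auto simp: one_pCons[symmetric])

lemma rf_const_inverse [simp]: "rf_const (inverse a) = inverse (rf_const a)"
proof (cases "a = 0")
  case False
  then have "rf_const (inverse a) * rf_const a = 1" by (simp flip: rf_const_simps(4))
  then show ?thesis by (metis inverse_unique mult.commute)
qed simp

lemma rf_const_divide [simp]: "rf_const (a / b) = rf_const a / rf_const b"
  by (simp add: divide_inverse)

lemma rf_const_power [simp]: "rf_const (a ^ n) = rf_const a ^ n"
  by (induction n) auto

lemma rf_const_eq_Fract: "rf_const c = Fract [:c:] 1"
  by (simp add: rf_const_def to_fract_def)

lemma rf_X_eq_Fract: "rf_X = Fract [:0, 1:] 1"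
  by (simp add: rf_X_def to_fract_def)

section \<open>Evaluation of polynomials at a rational function, and composition\<close>

definition rf_eval :: "'a::field poly \<Rightarrow> 'a ratfun \<Rightarrow> 'a ratfun" where
  "rf_eval p g = poly (map_poly rf_const p) g"

lemma rf_eval_0 [simp]: "rf_eval 0 g = 0"
  by (simp add: rf_eval_def)

lemma rf_eval_pCons [simp]: "rf_eval (pCons a p) g = rf_const a + g * rf_eval p g"
  by (cases "a = 0 \<and> p = 0") (auto simp: rf_eval_def map_poly_pCons)

lemma rf_eval_1 [simp]: "rf_eval 1 g = 1"
  by (simp add: one_pCons)

lemma rf_eval_add [simp]: "rf_eval (p + q) g = rf_eval p g + rf_eval q g"
  by (induction p q rule: poly_induct2) (auto simp: algebra_simps)

lemma rf_eval_smult [simp]: "rf_eval (Polynomial.smult a p) g = rf_const a * rf_eval p g"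
  by (induction p) (auto simp: algebra_simps)

lemma rf_eval_mult [simp]: "rf_eval (p * q) g = rf_eval p g * rf_eval q g"
  by (induction p) (auto simp: algebra_simps)

lemma rf_eval_rf_X: "rf_eval p rf_X = to_fract p"
proof (induction p)
  case (pCons a p)
  have "pCons a p = [:a:] + [:0, 1:] * p" by simp
  then have "to_fract (pCons a p) = rf_const a + rf_X * to_fract p"
    by (metis rf_const_def rf_X_def to_fract_add to_fract_mult)
  then show ?case using pCons by simp
qed simp

lemma rf_compose_rf_eval: "rf_compose f g = rf_eval (rf_num f) g / rf_eval (rf_den f) g"
  by (simp add: rf_compose_def rf_eval_def)

lemma rf_compose_rf_X_right [simp]: "rf_compose f rf_X = f"
  by (simp add: rf_compose_rf_eval rf_eval_rf_X Fract_rf_num_den flip: Fract_conv_to_fract)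

lemma rf_compose_rf_X_left [simp]: "rf_compose rf_X g = g"
  using rf_num_den_Fract[of "[:0, 1::'a:]" 1]
  by (simp add: rf_compose_rf_eval rf_X_eq_Fract)

text \<open>Splitting off one root at a time reduces multiplicative statements to constants and
  linear factors. Non-vanishing of \<open>rf_eval\<close>, orders after pullback and the count of
  roots are all obtained this way.\<close>

lemma poly_induct_alg_closed [consumes 1, case_names const root]:
  fixes p :: "'a::alg_closed_field poly"
  assumes "p \<noteq> 0"
    and const: "\<And>c. c \<noteq> 0 \<Longrightarrow> P [:c:]"
    and root: "\<And>a q. q \<noteq> 0 \<Longrightarrow> P q \<Longrightarrow> P ([:- a, 1:] * q)"
  shows "P p"
  using assms(1)
proof (induction "Polynomial.degree p" arbitrary: p rule: less_induct)
  case (less p)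
  show ?case
  proof (cases "Polynomial.degree p = 0")
    case True
    then obtain c where "p = [:c:]" by (rule degree_eq_zeroE)
    then show ?thesis using const less.prems by auto
  next
    case False
    then obtain a where "poly p a = 0" using alg_closed_imp_poly_has_root by blast
    then obtain q where q: "p = [:- a, 1:] * q" by (auto simp: poly_eq_0_iff_dvd elim: dvdE)
    then have "q \<noteq> 0" using less.prems by auto
    then have "Polynomial.degree p = Suc (Polynomial.degree q)"
      unfolding q by (subst degree_mult_eq) auto
    then have "P q" using less.hyps \<open>q \<noteq> 0\<close> by simp
    then show ?thesis unfolding q using root \<open>q \<noteq> 0\<close> by blast
  qed
qed

lemma rf_eval_linear: "rf_eval [:- a, 1:] g = g - rf_const a"
  by simp

text \<open>Over an algebraically closed field a nonconstant \<open>g\<close> is transcendental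
  because \<open>p\<close> evaluated at \<open>g\<close> is a product of factors
  \<open>g - a\<close>.\<close>

lemma rf_eval_nonzero_alg_closed:
  fixes p :: "'a::alg_closed_field poly"
  assumes "p \<noteq> 0" "pline_morphism g"
  shows "rf_eval p g \<noteq> 0"
  using assms(1)
proof (induction p rule: poly_induct_alg_closed)
  case (root a q)
  have "g - rf_const a \<noteq> 0" using assms(2) by (auto simp: pline_morphism_def)
  then show ?case using root unfolding rf_eval_mult rf_eval_linear by simp
qed simp

text \<open>Evaluation preserves the cross-multiplied equation between two fractions, so composition
  can be computed from any fraction. Sums and products need this, since their obvious fractions are
  rarely reduced.\<close>

lemma rf_compose_Fract:
  fixes p q :: "'a::alg_closed_field poly"
  assumes "q \<noteq> 0" "pline_morphism g"
  shows "rf_compose (Fract p q) g = rf_eval p g / rf_eval q g"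
proof -
  let ?f = "Fract p q"
  have "Fract (rf_num ?f) (rf_den ?f) = Fract p q" by (rule Fract_rf_num_den)
  then have "rf_num ?f * q = p * rf_den ?f" using assms(1) by (simp add: eq_fract)
  then have "rf_eval (rf_num ?f) g * rf_eval q g = rf_eval p g * rf_eval (rf_den ?f) g"
    by (simp flip: rf_eval_mult)
  then show ?thesis
    using assms by (simp add: rf_compose_rf_eval frac_eq_eq rf_eval_nonzero_alg_closed)
qed

lemma rf_compose_simps:
  fixes f h g :: "'a::alg_closed_field ratfun"
  assumes g: "pline_morphism g"
  shows rf_compose_mult: "rf_compose (f * h) g = rf_compose f g * rf_compose h g"
    and rf_compose_add: "rf_compose (f + h) g = rf_compose f g + rf_compose h g"
    and rf_compose_uminus: "rf_compose (- f) g = - rf_compose f g"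
    and rf_compose_inverse: "rf_compose (inverse f) g = inverse (rf_compose f g)"
    and rf_compose_const: "rf_compose (rf_const c) g = rf_const c"
    and rf_compose_eq_0_iff: "rf_compose f g = 0 \<longleftrightarrow> f = 0"
proof -
  obtain p q where f: "f = Fract p q" "q \<noteq> 0" by (cases f) auto
  obtain r s where h: "h = Fract r s" "s \<noteq> 0" by (cases h) auto
  note nz = rf_eval_nonzero_alg_closed[OF _ g]
  show "rf_compose (f * h) g = rf_compose f g * rf_compose h g"
    using f h g by (simp add: rf_compose_Fract)
  show "rf_compose (f + h) g = rf_compose f g + rf_compose h g"
    using f h g nz by (simp add: rf_compose_Fract add_frac_eq)
  have "rf_eval (- p) g = - rf_eval p g"
    using rf_eval_smult[of "- 1" p g] by (simp del: rf_eval_smult)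
  then show "rf_compose (- f) g = - rf_compose f g"
    using f g by (simp add: rf_compose_Fract)
  show eq0: "rf_compose f g = 0 \<longleftrightarrow> f = 0"
  proof -
    have "f = 0 \<longleftrightarrow> p = 0"
      unfolding f(1) Zero_fract_def by (subst eq_fract) (simp_all add: f(2))
    moreover have "rf_compose f g = 0 \<longleftrightarrow> p = 0"
      using f g nz by (auto simp: rf_compose_Fract)
    ultimately show ?thesis by simp
  qed
  show "rf_compose (inverse f) g = inverse (rf_compose f g)"
  proof (cases "f = 0")
    case False
    then have "p \<noteq> 0" using f by (auto simp: fract_collapse)
    then show ?thesis using f g by (simp add: rf_compose_Fract)
  next
    case True
    then have "inverse f = f" by simp
    then show ?thesis using True eq0 by simp
  qed
  show "rf_compose (rf_const c) g = rf_const c"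
    using g by (simp add: rf_const_eq_Fract rf_compose_Fract)
qed

lemma rf_compose_divide:
  fixes f h g :: "'a::alg_closed_field ratfun"
  assumes "pline_morphism g"
  shows "rf_compose (f / h) g = rf_compose f g / rf_compose h g"
  using assms by (simp add: divide_inverse rf_compose_mult rf_compose_inverse)

lemma rf_compose_diff:
  fixes f h g :: "'a::alg_closed_field ratfun"
  assumes "pline_morphism g"
  shows "rf_compose (f - h) g = rf_compose f g - rf_compose h g"
  using assms rf_compose_add[of g f "- h"] by (simp add: rf_compose_uminus)

lemma rf_compose_1:
  fixes g :: "'a::alg_closed_field ratfun"
  assumes "pline_morphism g"
  shows "rf_compose 1 g = 1"
  using assms rf_compose_const[of g 1] by simp

lemma rf_compose_power:
  fixes f g :: "'a::alg_closed_field ratfun"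
  assumes "pline_morphism g"
  shows "rf_compose (f ^ n) g = rf_compose f g ^ n"
  by (induction n) (simp_all add: assms rf_compose_mult rf_compose_1)

lemma rf_compose_powi:
  fixes f g :: "'a::alg_closed_field ratfun"
  assumes "pline_morphism g"
  shows "rf_compose (f powi n) g = rf_compose f g powi n"
  by (simp add: power_int_def assms rf_compose_power rf_compose_inverse)

lemma rf_compose_rf_eval_left:
  fixes f g :: "'a::alg_closed_field ratfun"
  assumes "pline_morphism g"
  shows "rf_compose (rf_eval p f) g = rf_eval p (rf_compose f g)"
proof (induction p)
  case 0
  show ?case using assms rf_compose_const[of g 0] by simp
qed (simp add: assms rf_compose_add rf_compose_mult rf_compose_const)

lemma rf_compose_assoc:
  fixes f g h :: "'a::alg_closed_field ratfun"
  assumes "pline_morphism h"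
  shows "rf_compose (rf_compose f g) h = rf_compose f (rf_compose g h)"
  unfolding rf_compose_rf_eval[of f]
  by (simp add: rf_compose_divide assms rf_compose_rf_eval_left)

lemma pline_morphism_compose:
  fixes f g :: "'a::alg_closed_field ratfun"
  assumes "pline_morphism f" "pline_morphism g"
  shows "pline_morphism (rf_compose f g)"
  unfolding pline_morphism_def
proof
  assume "rf_compose f g \<in> range rf_const"
  then obtain c where "rf_compose f g = rf_const c" by auto
  then have "rf_compose (f - rf_const c) g = 0"
    using assms by (simp add: rf_compose_diff rf_compose_const)
  then have "f = rf_const c" using assms by (simp add: rf_compose_eq_0_iff)
  then show False using assms by (auto simp: pline_morphism_def)
qed

section \<open>Orders and ramification\<close>

definition poly_ord :: "'a::field pline \<Rightarrow> 'a poly \<Rightarrow> int" where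
  "poly_ord P p = (case P of Finite a \<Rightarrow> int (Polynomial.order a p)
    | Infinity \<Rightarrow> - int (Polynomial.degree p))"

lemma poly_ord_simps [simp]:
  "poly_ord (Finite a) p = int (Polynomial.order a p)"
  "poly_ord Infinity p = - int (Polynomial.degree p)"
  by (simp_all add: poly_ord_def)

lemma order_const: "c \<noteq> 0 \<Longrightarrow> Polynomial.order a [:c:] = 0"
  by (simp add: order_0I)

lemma poly_ord_mult: "p \<noteq> 0 \<Longrightarrow> q \<noteq> 0 \<Longrightarrow> poly_ord P (p * q) = poly_ord P p + poly_ord P q"
  by (cases P) (simp_all add: order_mult degree_mult_eq)

lemma rf_ord_eq_poly_ord: "rf_ord P f = poly_ord P (rf_num f) - poly_ord P (rf_den f)"
  by (cases P) (simp_all add: rf_ord_def)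

lemma rf_ord_Fract:
  assumes "p \<noteq> 0" "q \<noteq> 0"
  shows "rf_ord P (Fract p q) = poly_ord P p - poly_ord P q"
proof -
  let ?f = "Fract p q"
  have "Fract (rf_num ?f) (rf_den ?f) = Fract p q" by (rule Fract_rf_num_den)
  then have eq: "rf_num ?f * q = p * rf_den ?f" using assms by (simp add: eq_fract)
  moreover have "p * rf_den ?f \<noteq> 0" using assms(1) rf_den_nonzero[of ?f] by (rule no_zero_divisors)
  ultimately have "rf_num ?f \<noteq> 0" by (metis mult_zero_left)
  with eq have "poly_ord P (rf_num ?f) + poly_ord P q = poly_ord P p + poly_ord P (rf_den ?f)"
    using assms by (metis poly_ord_mult rf_den_nonzero)
  then show ?thesis by (simp add: rf_ord_eq_poly_ord)
qed

lemma rf_ord_mult: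
  assumes "f \<noteq> 0" "g \<noteq> 0"
  shows "rf_ord P (f * g) = rf_ord P f + rf_ord P g"
proof -
  have "f * g = Fract (rf_num f * rf_num g) (rf_den f * rf_den g)"
    by (simp add: Fract_rf_num_den flip: mult_fract)
  then have "rf_ord P (f * g) = poly_ord P (rf_num f * rf_num g) - poly_ord P (rf_den f * rf_den g)"
    using assms by (simp only: rf_ord_Fract rf_num_eq_0_iff rf_den_nonzero mult_eq_0_iff simp_thms)
  then show ?thesis using assms by (simp add: rf_ord_eq_poly_ord poly_ord_mult)
qed

lemma rf_ord_const [simp]: "c \<noteq> 0 \<Longrightarrow> rf_ord P (rf_const c) = 0"
  by (cases P) (simp_all add: rf_const_eq_Fract rf_ord_Fract order_const)

lemma rf_ord_1 [simp]: "rf_ord P 1 = 0"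
  using rf_ord_const[of 1 P] by simp

lemma rf_ord_inverse:
  assumes "f \<noteq> 0"
  shows "rf_ord P (inverse f) = - rf_ord P f"
  using rf_ord_mult[of f "inverse f" P] assms by simp

lemma rf_ord_divide:
  assumes "f \<noteq> 0" "g \<noteq> 0"
  shows "rf_ord P (f / g) = rf_ord P f - rf_ord P g"
  using assms by (simp add: divide_inverse rf_ord_mult rf_ord_inverse)

lemma rf_ord_power: "f \<noteq> 0 \<Longrightarrow> rf_ord P (f ^ n) = int n * rf_ord P f"
  by (induction n) (simp_all add: rf_ord_mult algebra_simps)

lemma rf_ord_powi: "f \<noteq> 0 \<Longrightarrow> rf_ord P (f powi n) = n * rf_ord P f"
  by (simp add: power_int_def rf_ord_power rf_ord_inverse)

lemma finite_rf_ord_nonzero: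
  fixes f :: "'a::field ratfun"
  assumes "f \<noteq> 0"
  shows "finite {P. rf_ord P f \<noteq> 0}"
proof -
  let ?R = "{a. poly (rf_num f) a = 0} \<union> {a. poly (rf_den f) a = 0}"
  have "{P. rf_ord P f \<noteq> 0} \<subseteq> insert Infinity (Finite ` ?R)"
  proof
    fix P assume P: "P \<in> {P. rf_ord P f \<noteq> 0}"
    show "P \<in> insert Infinity (Finite ` ?R)"
    proof (cases P)
      case (Finite a)
      have "a \<in> ?R"
      proof (rule ccontr)
        assume "a \<notin> ?R"
        then show False using P Finite by (simp add: rf_ord_eq_poly_ord order_0I)
      qed
      then show ?thesis using Finite by blast
    qed simp
  qed
  moreover have "finite ?R" using assms by (simp add: poly_roots_finite)
  ultimately show ?thesis using finite_subset by blast
qed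

lemma sum_order_alg_closed:
  fixes p :: "'a::alg_closed_field poly"
  assumes "p \<noteq> 0" "finite A" "{a. poly p a = 0} \<subseteq> A"
  shows "(\<Sum>a\<in>A. Polynomial.order a p) = Polynomial.degree p"
  using assms(1,3)
proof (induction p rule: poly_induct_alg_closed)
  case (const c)
  then show ?case by (simp add: order_const)
next
  case (root a q)
  have lin: "Polynomial.order b [:- a, 1:] = (if b = a then 1 else 0)" for b
    using order_power_n_n[of a 1] by (auto intro: order_0I)
  have nz: "[:- a, 1:] * q \<noteq> 0" using root.hyps by (intro no_zero_divisors) auto
  have "a \<in> A" using root.prems by auto
  have "(\<Sum>b\<in>A. Polynomial.order b ([:- a, 1:] * q)) =
      (\<Sum>b\<in>A. (if b = a then 1 else 0) + Polynomial.order b q)"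
    by (simp only: order_mult[OF nz] lin)
  also have "\<dots> = 1 + Polynomial.degree q"
    using root \<open>a \<in> A\<close> assms(2) by (auto simp: sum.distrib)
  also have "\<dots> = Polynomial.degree ([:- a, 1:] * q)"
    using root.hyps by (subst degree_mult_eq) auto
  finally show ?case .
qed

lemma degree_diff_eq_left:
  fixes p q :: "'a::ab_group_add poly"
  assumes "Polynomial.degree q < Polynomial.degree p"
  shows "Polynomial.degree (p - q) = Polynomial.degree p"
  using degree_add_eq_left[of "- q" p] assms by simp

section \<open>Images of points and ramification indices\<close>

lemma pline_morphism_nonzero: "pline_morphism \<sigma> \<Longrightarrow> \<sigma> \<noteq> 0"
  by (metis pline_morphism_def rangeI rf_const_simps(1))

lemma morphism_sub_const_nonzero: "pline_morphism \<sigma> \<Longrightarrow> \<sigma> - rf_const c \<noteq> 0"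
  by (auto simp: pline_morphism_def)

lemma sub_const_eq_Fract:
  "\<sigma> - rf_const c = Fract (rf_num \<sigma> - Polynomial.smult c (rf_den \<sigma>)) (rf_den \<sigma>)"
  by (subst (1) Fract_rf_num_den[symmetric]) (simp add: rf_const_eq_Fract)

lemma num_sub_den_nonzero:
  assumes "pline_morphism \<sigma>"
  shows "rf_num \<sigma> - Polynomial.smult c (rf_den \<sigma>) \<noteq> 0"
  using morphism_sub_const_nonzero[OF assms, of c]
  by (auto simp: sub_const_eq_Fract fract_collapse)

lemma rf_compose_uniformizer:
  fixes \<sigma> :: "'a::alg_closed_field ratfun"
  assumes "pline_morphism \<sigma>"
  shows "rf_compose (uniformizer (Finite b)) \<sigma> = \<sigma> - rf_const b"
    "rf_compose (uniformizer Infinity) \<sigma> = 1 / \<sigma>"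
  by (simp_all add: uniformizer_def assms rf_compose_diff rf_compose_divide rf_compose_const
      rf_compose_1)

text \<open>The bridge between \<open>morphism_app\<close>, which is read off from coefficients, and
  orders: zeros of \<open>\<sigma> - b\<close> lie over \<open>b\<close>, poles lie over infinity.
  The formulas for ramification indices rest on these four facts.\<close>

lemma rf_ord_sub_const:
  fixes \<sigma> :: "'a::field ratfun"
  assumes \<sigma>: "pline_morphism \<sigma>"
  shows "morphism_app \<sigma> Q = Finite b \<Longrightarrow> rf_ord Q (\<sigma> - rf_const b) > 0"
    and "morphism_app \<sigma> Q = Finite b \<Longrightarrow> c \<noteq> b \<Longrightarrow> rf_ord Q (\<sigma> - rf_const c) = 0"
    and "morphism_app \<sigma> Q = Infinity \<Longrightarrow> rf_ord Q \<sigma> < 0"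
    and "morphism_app \<sigma> Q = Infinity \<Longrightarrow> rf_ord Q (\<sigma> - rf_const c) = rf_ord Q \<sigma>"
proof -
  let ?p = "rf_num \<sigma>" and ?q = "rf_den \<sigma>"
  let ?n = "\<lambda>c. ?p - Polynomial.smult c ?q"
  note nz = num_sub_den_nonzero[OF \<sigma>]
  have ord: "rf_ord Q (\<sigma> - rf_const c) = poly_ord Q (?n c) - poly_ord Q ?q" for c
    unfolding sub_const_eq_Fract using nz by (rule rf_ord_Fract) simp
  have ord0: "rf_ord Q \<sigma> = poly_ord Q ?p - poly_ord Q ?q" by (rule rf_ord_eq_poly_ord)
  \<comment> \<open>The Bezout identity excludes a common zero of numerator and denominator.\<close>
  obtain u v where uv: "u * ?p + v * ?q = 1" using coprime_poly_bezout[OF coprime_rf_num_den] by blast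
  have deg_nonconst: "Polynomial.degree ?p > 0 \<or> Polynomial.degree ?q > 0"
  proof (rule ccontr)
    assume "\<not> ?thesis"
    then obtain a b where "?p = [:a:]" "?q = [:b:]" by (metis degree_eq_zeroE gr0I)
    then have "?n (a / b) = 0" using rf_den_nonzero[of \<sigma>] by auto
    then show False using nz by blast
  qed
  show "rf_ord Q (\<sigma> - rf_const b) > 0" if b: "morphism_app \<sigma> Q = Finite b" for b
  proof (cases Q)
    case (Finite a)
    then have "poly ?q a \<noteq> 0" "poly (?n b) a = 0"
      using b by (auto simp: morphism_app_def Let_def split: if_splits)
    moreover from this have "Polynomial.order a (?n b) > 0" using nz[of b] by (simp add: order_gt_0_iff)
    ultimately show ?thesis unfolding ord using Finite by (simp add: order_0I)
  next
    case Infinity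
    then have le: "Polynomial.degree ?p \<le> Polynomial.degree ?q"
      and b': "Polynomial.coeff ?p (Polynomial.degree ?q) = b"
      using b by (auto simp: morphism_app_def Let_def split: if_splits)
    \<comment> \<open>At infinity the choice of \<open>b\<close> cancels the coefficient at
      \<open>degree ?q\<close>. The drop is strict because \<open>?q\<close> is nonconstant here;
      the zero polynomial has degree 0.\<close>
    have "Polynomial.degree (?n b) < Polynomial.degree ?q"
    proof (rule degree_lessI)
      show "\<forall>k\<ge>Polynomial.degree ?q. Polynomial.coeff (?n b) k = 0"
      proof (intro allI impI)
        fix k assume "k \<ge> Polynomial.degree ?q"
        then show "Polynomial.coeff (?n b) k = 0"
          using le b' by (cases "k = Polynomial.degree ?q") (auto simp: coeff_eq_0)
      qed
    qed (use deg_nonconst le in auto)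
    then show ?thesis unfolding ord using Infinity by simp
  qed
  show "rf_ord Q (\<sigma> - rf_const c) = 0" if b: "morphism_app \<sigma> Q = Finite b" and c: "c \<noteq> b" for b c
  proof (cases Q)
    case (Finite a)
    then have "poly ?q a \<noteq> 0" "poly (?n c) a \<noteq> 0"
      using b c by (auto simp: morphism_app_def Let_def field_simps split: if_splits)
    then show ?thesis unfolding ord using Finite by (simp add: order_0I)
  next
    case Infinity
    then have le: "Polynomial.degree ?p \<le> Polynomial.degree ?q"
      and b': "Polynomial.coeff ?p (Polynomial.degree ?q) = b"
      using b by (auto simp: morphism_app_def Let_def split: if_splits)
    have "Polynomial.coeff (?n c) (Polynomial.degree ?q) \<noteq> 0" using b' c by simp
    then have "Polynomial.degree (?n c) \<ge> Polynomial.degree ?q" by (rule le_degree)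
    moreover have "Polynomial.degree (?n c) \<le> Polynomial.degree ?q"
      using le by (intro degree_diff_le) (auto intro: degree_smult_le order.trans)
    ultimately show ?thesis unfolding ord using Infinity by simp
  qed
  show "rf_ord Q \<sigma> < 0" if b: "morphism_app \<sigma> Q = Infinity"
  proof (cases Q)
    case (Finite a)
    then have q: "poly ?q a = 0"
      using b by (auto simp: morphism_app_def Let_def split: if_splits)
    then have "poly ?p a \<noteq> 0" using arg_cong[OF uv, of "\<lambda>p. poly p a"] by auto
    moreover have "Polynomial.order a ?q > 0" using q by (simp add: order_gt_0_iff)
    ultimately show ?thesis unfolding ord0 using Finite by (simp add: order_0I)
  next
    case Infinity
    then show ?thesis unfolding ord0 using b by (auto simp: morphism_app_def Let_def split: if_splits)
  qed
  show "rf_ord Q (\<sigma> - rf_const c) = rf_ord Q \<sigma>" if b: "morphism_app \<sigma> Q = Infinity" for c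
  proof (cases Q)
    case (Finite a)
    then have q: "poly ?q a = 0"
      using b by (auto simp: morphism_app_def Let_def split: if_splits)
    then have p: "poly ?p a \<noteq> 0" using arg_cong[OF uv, of "\<lambda>p. poly p a"] by auto
    have "poly (?n c) a \<noteq> 0" using p q by simp
    then show ?thesis unfolding ord ord0 using Finite p by (simp add: order_0I)
  next
    case Infinity
    then have "Polynomial.degree ?p > Polynomial.degree ?q"
      using b by (auto simp: morphism_app_def Let_def split: if_splits)
    then have "Polynomial.degree (Polynomial.smult c ?q) < Polynomial.degree ?p"
      using degree_smult_le le_less_trans by blast
    then have "Polynomial.degree (?p - Polynomial.smult c ?q) = Polynomial.degree ?p"
      by (rule degree_diff_eq_left)
    then show ?thesis unfolding ord ord0 using Infinity by simp
  qed
qed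

lemma ram_index_eq:
  fixes \<sigma> :: "'a::alg_closed_field ratfun"
  assumes "pline_morphism \<sigma>"
  shows "morphism_app \<sigma> Q = Finite b \<Longrightarrow> int (ram_index \<sigma> Q) = rf_ord Q (\<sigma> - rf_const b)"
    and "morphism_app \<sigma> Q = Infinity \<Longrightarrow> int (ram_index \<sigma> Q) = - rf_ord Q \<sigma>"
  using rf_ord_sub_const[OF assms, of Q] pline_morphism_nonzero[OF assms]
  by (auto simp: ram_index_def rf_compose_uniformizer assms divide_inverse rf_ord_inverse)

lemma ram_index_pos:
  fixes \<sigma> :: "'a::alg_closed_field ratfun"
  assumes "pline_morphism \<sigma>"
  shows "ram_index \<sigma> Q > 0"
  using ram_index_eq[OF assms, of Q] rf_ord_sub_const[OF assms, of Q]
  by (cases "morphism_app \<sigma> Q") force+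

lemma poly_ord_const [simp]: "c \<noteq> 0 \<Longrightarrow> poly_ord P [:c:] = 0"
  by (cases P) (simp_all add: order_const)

text \<open>Both sides are additive in \<open>p\<close>, so only linear factors count, and for these
  the formula is the definition of the ramification index: the order of the pulled back
  uniformizer.\<close>

lemma rf_ord_rf_eval:
  fixes \<sigma> :: "'a::alg_closed_field ratfun"
  assumes \<sigma>: "pline_morphism \<sigma>" and "p \<noteq> 0"
  shows "rf_ord Q (rf_eval p \<sigma>) = int (ram_index \<sigma> Q) * poly_ord (morphism_app \<sigma> Q) p"
  using assms(2)
proof (induction p rule: poly_induct_alg_closed)
  case (const c)
  then show ?case by simp
next
  case (root a q)
  have lin: "rf_ord Q (\<sigma> - rf_const a)
      = int (ram_index \<sigma> Q) * poly_ord (morphism_app \<sigma> Q) [:- a, 1:]"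
  proof (cases "morphism_app \<sigma> Q")
    case (Finite b)
    have "Polynomial.order b [:- a, 1:] = (if b = a then 1 else 0)"
      using order_power_n_n[of a 1] by (auto intro: order_0I)
    then show ?thesis
      using Finite rf_ord_sub_const(2)[OF \<sigma>, of Q b a] ram_index_eq(1)[OF \<sigma>, of Q b] by auto
  next
    case Infinity
    then show ?thesis
      using rf_ord_sub_const(4)[OF \<sigma>, of Q a] ram_index_eq(2)[OF \<sigma>, of Q] by simp
  qed
  have "rf_ord Q (rf_eval ([:- a, 1:] * q) \<sigma>) = rf_ord Q (\<sigma> - rf_const a) + rf_ord Q (rf_eval q \<sigma>)"
    unfolding rf_eval_mult rf_eval_linear
    using root.hyps \<sigma> by (intro rf_ord_mult rf_eval_nonzero_alg_closed morphism_sub_const_nonzero)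
  moreover have "poly_ord P ([:- a, 1:] * q) = poly_ord P [:- a, 1:] + poly_ord P q" for P
    using root.hyps by (intro poly_ord_mult) auto
  ultimately show ?case using lin root.IH by (simp only: distrib_left)
qed

theorem rf_ord_compose:
  fixes \<sigma> :: "'a::alg_closed_field ratfun"
  assumes \<sigma>: "pline_morphism \<sigma>" and "f \<noteq> 0"
  shows "rf_ord Q (rf_compose f \<sigma>) = int (ram_index \<sigma> Q) * rf_ord (morphism_app \<sigma> Q) f"
  using assms unfolding rf_compose_rf_eval
  by (subst rf_ord_divide)
    (simp_all add: rf_eval_nonzero_alg_closed rf_ord_rf_eval rf_ord_eq_poly_ord[of _ f] algebra_simps)

section \<open>Degrees of principal divisors and of fibres\<close>

lemma sum_pline:
  fixes h :: "'a pline \<Rightarrow> 'b::comm_monoid_add"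
  assumes "finite A"
  shows "(\<Sum>P\<in>insert Infinity (Finite ` A). h P) = h Infinity + (\<Sum>a\<in>A. h (Finite a))"
  using assms by (subst sum.insert) (auto simp: sum.reindex inj_on_def)

lemma pline_finite_subset:
  fixes F :: "'a pline set"
  assumes "finite F"
  obtains A where "finite A" "F \<subseteq> insert Infinity (Finite ` A)"
proof
  have inj: "inj (Finite :: 'a \<Rightarrow> _)" by (simp add: inj_on_def)
  show "finite (Finite -` F :: 'a set)" using assms inj by (intro finite_vimageI)
  show "F \<subseteq> insert Infinity (Finite ` (Finite -` F))"
  proof
    fix P assume "P \<in> F"
    then show "P \<in> insert Infinity (Finite ` (Finite -` F))" by (cases P) auto
  qed
qed

text \<open>The finite zeros and poles contribute the degrees of numerator and denominator, and
  infinity contributes the opposite of their difference. The set \<open>F\<close> is left free so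
  that several functions can be summed over one set.\<close>

theorem sum_rf_ord:
  fixes f :: "'a::alg_closed_field ratfun"
  assumes "f \<noteq> 0" "finite F" "{P. rf_ord P f \<noteq> 0} \<subseteq> F"
  shows "(\<Sum>P\<in>F. rf_ord P f) = 0"
proof -
  obtain A0 where A0: "finite A0" "F \<subseteq> insert Infinity (Finite ` A0)"
    using pline_finite_subset[OF assms(2)] .
  define A where "A = A0 \<union> {a. poly (rf_num f) a = 0} \<union> {a. poly (rf_den f) a = 0}"
  have fin: "finite A" using A0 assms(1) by (simp add: A_def poly_roots_finite)
  have "(\<Sum>P\<in>F. rf_ord P f) = (\<Sum>P\<in>insert Infinity (Finite ` A). rf_ord P f)"
    using A0 assms fin by (intro sum.mono_neutral_left) (auto simp: A_def)
  also have "\<dots> = rf_ord Infinity f + (\<Sum>a\<in>A. rf_ord (Finite a) f)"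
    by (rule sum_pline[OF fin])
  also have "(\<Sum>a\<in>A. rf_ord (Finite a) f) =
      int (\<Sum>a\<in>A. Polynomial.order a (rf_num f)) - int (\<Sum>a\<in>A. Polynomial.order a (rf_den f))"
    by (simp add: rf_ord_eq_poly_ord sum_subtractf)
  also have "\<dots> = int (Polynomial.degree (rf_num f)) - int (Polynomial.degree (rf_den f))"
    using fin assms(1) by (subst (1 2) sum_order_alg_closed) (auto simp: A_def)
  finally show ?thesis by (simp add: rf_ord_def)
qed

text \<open>Numerator and denominator have the same order at every finite point but no common root,
  so neither has a root and both are constant.\<close>

lemma rf_const_if_no_zeros_poles:
  fixes f :: "'a::alg_closed_field ratfun"
  assumes "f \<noteq> 0" "\<And>P. rf_ord P f = 0"
  obtains c where "c \<noteq> 0" "f = rf_const c"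
proof -
  let ?p = "rf_num f" and ?q = "rf_den f"
  obtain u v where uv: "u * ?p + v * ?q = 1" using coprime_poly_bezout[OF coprime_rf_num_den] by blast
  have ord: "Polynomial.order a ?p = Polynomial.order a ?q" for a
    using assms(2)[of "Finite a"] by (simp add: rf_ord_eq_poly_ord)
  have noroot: "poly ?p a \<noteq> 0 \<and> poly ?q a \<noteq> 0" for a
    using ord[of a] arg_cong[OF uv, of "\<lambda>p. poly p a"] assms(1)
    by (metis (no_types, lifting) add.right_neutral mult_zero_right order_root poly_1 poly_add
        poly_mult rf_den_nonzero rf_num_eq_0_iff zero_neq_one)
  have "Polynomial.degree ?p = 0" "Polynomial.degree ?q = 0"
    using noroot alg_closed_imp_poly_has_root by blast+
  then obtain a b where ab: "?p = [:a:]" "?q = [:b:]" by (metis degree_eq_zeroE)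
  then have "b = 1" using lead_coeff_rf_den[of f] by simp
  then have "f = rf_const a" using ab Fract_rf_num_den[of f] by (simp add: rf_const_eq_Fract one_pCons)
  then show ?thesis using that assms(1) by auto
qed

text \<open>Finite zeros account for \<open>degree p\<close>, and infinity for the excess of
  \<open>degree q\<close> over it. An arbitrary coprime fraction is allowed because inverting a
  reduced one destroys the monic denominator.\<close>

lemma sum_zeros:
  fixes f :: "'a::alg_closed_field ratfun"
  assumes f: "f = Fract p q" "coprime p q" and nz: "p \<noteq> 0" "q \<noteq> 0"
    and F: "finite F" "{P. rf_ord P f > 0} \<subseteq> F"
  shows "(\<Sum>P\<in>F. max 0 (rf_ord P f)) = int (max (Polynomial.degree p) (Polynomial.degree q))"
proof -
  obtain A0 where A0: "finite A0" "F \<subseteq> insert Infinity (Finite ` A0)"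
    using pline_finite_subset[OF F(1)] .
  define A where "A = A0 \<union> {a. poly p a = 0}"
  have fin: "finite A" using A0 nz by (simp add: A_def poly_roots_finite)
  obtain u v where uv: "u * p + v * q = 1" using coprime_poly_bezout[OF f(2)] by blast
  have ord: "rf_ord P f = poly_ord P p - poly_ord P q" for P
    unfolding f(1) by (rule rf_ord_Fract[OF nz])
  have max: "max 0 (rf_ord (Finite a) f) = int (Polynomial.order a p)" for a
  proof (cases "poly p a = 0")
    case True
    then have "poly q a \<noteq> 0" using arg_cong[OF uv, of "\<lambda>p. poly p a"] by auto
    then show ?thesis by (simp add: ord order_0I)
  qed (simp add: ord order_0I)
  have "(\<Sum>P\<in>F. max 0 (rf_ord P f)) = (\<Sum>P\<in>insert Infinity (Finite ` A). max 0 (rf_ord P f))"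
      proof (intro sum.mono_neutral_left ballI)
    fix P assume "P \<in> insert Infinity (Finite ` A) - F"
    then have "\<not> rf_ord P f > 0" using F by blast
    then show "max 0 (rf_ord P f) = 0" by simp
  qed (use A0 fin in \<open>auto simp: A_def\<close>)
  also have "\<dots> = max 0 (rf_ord Infinity f) + (\<Sum>a\<in>A. max 0 (rf_ord (Finite a) f))"
    by (rule sum_pline[OF fin])
  also have "(\<Sum>a\<in>A. max 0 (rf_ord (Finite a) f)) = int (\<Sum>a\<in>A. Polynomial.order a p)"
    by (simp add: max)
  also have "\<dots> = int (Polynomial.degree p)"
    using fin nz by (subst sum_order_alg_closed) (auto simp: A_def)
  finally show ?thesis by (simp add: ord)
qed

text \<open>A uniformizer at \<open>P\<close> has a single simple zero, at \<open>P\<close>, but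
  also a pole elsewhere on the line; \<open>max 0\<close> discards the points over that
  pole.\<close>

lemma rf_ord_pullback_uniformizer:
  fixes \<sigma> :: "'a::alg_closed_field ratfun"
  assumes "pline_morphism \<sigma>"
  shows "max 0 (rf_ord Q (rf_compose (uniformizer P) \<sigma>))
    = (if morphism_app \<sigma> Q = P then int (ram_index \<sigma> Q) else 0)"
proof -
  have unif: "uniformizer P \<noteq> 0"
    by (cases P) (auto simp: uniformizer_def rf_X_def rf_const_def simp flip: to_fract_diff)
  have X: "rf_X \<noteq> (0 :: 'a ratfun)" by (simp add: rf_X_def)
  have ordX: "rf_ord R (1 / rf_X :: 'a ratfun) = - rf_ord R rf_X" for R
    using X by (simp add: divide_inverse rf_ord_inverse)
  have lin: "rf_ord R (rf_X - rf_const a :: 'a ratfun) = poly_ord R [:- a, 1:]" for R a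
    unfolding rf_X_eq_Fract rf_const_eq_Fract by (cases R) (simp_all add: rf_ord_Fract)
  have linX: "rf_ord R (rf_X :: 'a ratfun) = poly_ord R [:0, 1:]" for R
    using lin[of R 0] by simp
  have ordlin: "Polynomial.order b [:- a, 1:] = (if b = a then 1 else 0)" for a b :: 'a
    using order_power_n_n[of a 1] by (auto intro: order_0I)
  have "max 0 (rf_ord R (uniformizer P)) = (if R = P then 1 else 0)" for R
    using ordlin[of _ 0]
    by (cases P; cases R) (simp_all add: uniformizer_def lin linX ordX ordlin)
  then show ?thesis
    by (simp add: rf_ord_compose[OF assms unif] max_def zero_le_mult_iff split: if_splits)
      (smt (verit) mult_cancel_left1 mult_nonneg_nonpos of_nat_0_le_iff)
qed

lemma morphism_degree_pos:
  fixes \<sigma> :: "'a::field ratfun"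
  assumes "pline_morphism \<sigma>"
  shows "morphism_degree \<sigma> > 0"
proof (rule ccontr)
  assume "\<not> ?thesis"
  then obtain a b where ab: "rf_num \<sigma> = [:a:]" "rf_den \<sigma> = [:b:]"
    unfolding morphism_degree_def by (metis degree_eq_zeroE max_less_iff_conj bot_nat_0.not_eq_extremum less_max_iff_disj)
  then have "b = 1" using lead_coeff_rf_den[of \<sigma>] by simp
  then have "\<sigma> = rf_const a" using ab Fract_rf_num_den[of \<sigma>] by (simp add: rf_const_eq_Fract one_pCons)
  then show False using assms by (simp add: pline_morphism_def)
qed

text \<open>The fibre over \<open>P\<close> is the zero divisor of the pullback of a uniformizer at
  \<open>P\<close>. That pullback is \<open>\<sigma> - b\<close> or \<open>1 / \<sigma>\<close>, a
  coprime fraction of the same degree as \<open>\<sigma>\<close>.\<close>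

theorem sum_ram_index:
  fixes \<sigma> :: "'a::alg_closed_field ratfun"
  assumes \<sigma>: "pline_morphism \<sigma>"
  shows "finite {Q. morphism_app \<sigma> Q = P}"
    and "(\<Sum>Q | morphism_app \<sigma> Q = P. ram_index \<sigma> Q) = morphism_degree \<sigma>"
proof -
  let ?u = "rf_compose (uniformizer P) \<sigma>"
  let ?p = "rf_num \<sigma>" and ?q = "rf_den \<sigma>"
  have p0: "?p \<noteq> 0" using pline_morphism_nonzero[OF \<sigma>] by simp
  obtain u v where uv: "u * ?p + v * ?q = 1" using coprime_poly_bezout[OF coprime_rf_num_den] by blast
  obtain p q where pq: "?u = Fract p q" "coprime p q" "p \<noteq> 0" "q \<noteq> 0"
    "max (Polynomial.degree p) (Polynomial.degree q) = morphism_degree \<sigma>"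
  proof (cases P)
    case (Finite b)
    let ?n = "?p - Polynomial.smult b ?q"
    have "u * ?n + (v + Polynomial.smult b u) * ?q = 1"
      using uv by (simp add: algebra_simps)
    then have "coprime ?n ?q" by (rule coprime_polyI_bezout)
    moreover have "max (Polynomial.degree ?n) (Polynomial.degree ?q) = morphism_degree \<sigma>"
    proof (cases "Polynomial.degree ?p > Polynomial.degree ?q")
      case True
      then have "Polynomial.degree (Polynomial.smult b ?q) < Polynomial.degree ?p"
        using degree_smult_le le_less_trans by blast
      then have "Polynomial.degree ?n = Polynomial.degree ?p" by (rule degree_diff_eq_left)
      then show ?thesis by (simp add: morphism_degree_def)
    next
      case False
      then have "Polynomial.degree ?n \<le> Polynomial.degree ?q"
        by (intro degree_diff_le) (auto intro: degree_smult_le order.trans)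
      then show ?thesis using False by (simp add: morphism_degree_def)
    qed
    ultimately show ?thesis
      using that[of ?n ?q] num_sub_den_nonzero[OF \<sigma>] Finite
      by (simp add: rf_compose_uniformizer \<sigma> sub_const_eq_Fract)
  next
    case Infinity
    have "?u = inverse \<sigma>" using Infinity by (simp add: rf_compose_uniformizer \<sigma> divide_inverse)
    also have "\<dots> = Fract ?q ?p" by (subst Fract_rf_num_den[of \<sigma>, symmetric]) (rule inverse_fract)
    finally show ?thesis
      using that[of ?q ?p] p0 coprime_rf_num_den[of \<sigma>]
      by (simp add: coprime_commute morphism_degree_def max.commute)
  qed
  have max: "max 0 (rf_ord Q ?u) = (if morphism_app \<sigma> Q = P then int (ram_index \<sigma> Q) else 0)" for Q
    by (rule rf_ord_pullback_uniformizer[OF \<sigma>])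
  have pos: "rf_ord Q ?u > 0 \<longleftrightarrow> morphism_app \<sigma> Q = P" for Q
    using max[of Q] ram_index_pos[OF \<sigma>, of Q] by (auto split: if_splits)
  have "?u \<noteq> 0" using pq by (metis eq_fract(1) Zero_fract_def mult_zero_left mult_1_right zero_neq_one)
  then have "finite {Q. rf_ord Q ?u > 0}"
    by (intro finite_subset[OF _ finite_rf_ord_nonzero]) auto
  then show fin: "finite {Q. morphism_app \<sigma> Q = P}" by (simp add: pos)
  have "int (\<Sum>Q | morphism_app \<sigma> Q = P. ram_index \<sigma> Q) =
      (\<Sum>Q | morphism_app \<sigma> Q = P. max 0 (rf_ord Q ?u))"
    unfolding of_nat_sum by (intro sum.cong) (auto simp: max)
  also have "\<dots> = int (morphism_degree \<sigma>)"
    using sum_zeros[OF pq(1-4) fin] by (simp add: pos pq(5))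
  finally show "(\<Sum>Q | morphism_app \<sigma> Q = P. ram_index \<sigma> Q) = morphism_degree \<sigma>"
    by (simp only: of_nat_eq_iff)
qed

section \<open>Log orders of forms\<close>

text \<open>This is 1 plus the order of \<open>dt\<close>, which is 0 at finite points and -2 at
  infinity.\<close>

definition log_weight :: "'a pline \<Rightarrow> int" where
  "log_weight P = (case P of Finite _ \<Rightarrow> 1 | Infinity \<Rightarrow> - 1)"

lemma log_weight_simps [simp]: "log_weight (Finite a) = 1" "log_weight Infinity = - 1"
  by (simp_all add: log_weight_def)

text \<open>The shift by the weight makes the order of a form multiplicative under pullback; the sign at
  infinity accounts for the double pole of \<open>dt\<close>.\<close>

definition log_ord :: "'a::field pline \<Rightarrow> 'a form \<Rightarrow> int" where
  "log_ord P \<omega> = rf_ord P (snd \<omega>) + fst \<omega> * log_weight P"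

section \<open>Orders of derivatives\<close>

definition wronskian :: "'a::idom poly \<Rightarrow> 'a poly \<Rightarrow> 'a poly" where
  "wronskian p q = pderiv p * q - p * pderiv q"

text \<open>With \<open>l = t - a\<close>, the operator \<open>l * pderiv\<close> multiplies
  \<open>l ^ i\<close> by \<open>i\<close>. Hence \<open>l\<close> times the Wronskian is
  \<open>l ^ (i + j) * T\<close> with \<open>T\<close> equal to \<open>(i - j) * r * s\<close> at
  \<open>a\<close>. Tameness enters here: \<open>i - j\<close> must not vanish in the field.\<close>

lemma poly_ord_wronskian_finite:
  fixes p q :: "'a::field poly"
  assumes nz: "p \<noteq> 0" "q \<noteq> 0"
    and ord: "of_int (poly_ord (Finite a) p - poly_ord (Finite a) q) \<noteq> (0 :: 'a)"
  shows "wronskian p q \<noteq> 0"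
    "poly_ord (Finite a) (wronskian p q) = poly_ord (Finite a) p + poly_ord (Finite a) q - 1"
proof -
  let ?l = "[:- a, 1:]"
  define i j where "i = Polynomial.order a p" and "j = Polynomial.order a q"
  obtain r where r: "p = ?l ^ i * r" "\<not> ?l dvd r" using order_decomp[OF nz(1)] i_def by blast
  obtain s where s: "q = ?l ^ j * s" "\<not> ?l dvd s" using order_decomp[OF nz(2)] j_def by blast
  have root: "poly r a \<noteq> 0" "poly s a \<noteq> 0"
    using r(2) s(2) by (simp_all add: poly_eq_0_iff_dvd)
  have "pderiv ?l = 1" by (simp add: pderiv_pCons)
  then have lin: "?l * pderiv (?l ^ n) = of_nat n * ?l ^ n" for n
    by (induction n)
      (simp_all only: power_0 power_Suc pderiv_mult pderiv_1 of_nat_Suc of_nat_0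
        mult_zero_left mult_zero_right algebra_simps)
  have D: "?l * pderiv (?l ^ n * u) = ?l ^ n * (of_nat n * u + ?l * pderiv u)" for n u
  proof -
    have "?l * pderiv (?l ^ n * u) = ?l ^ n * ?l * pderiv u + (?l * pderiv (?l ^ n)) * u"
      by (simp only: pderiv_mult algebra_simps)
    then show ?thesis unfolding lin by (simp only: algebra_simps)
  qed
  define T where "T = (of_nat i - of_nat j) * (r * s) + ?l * (pderiv r * s - r * pderiv s)"
  have "?l * wronskian p q = (?l * pderiv p) * q - p * (?l * pderiv q)"
    unfolding wronskian_def by (simp only: algebra_simps)
  also have "\<dots> = ?l ^ (i + j) * T"
    unfolding r(1) s(1) D T_def power_add by (simp only: algebra_simps)
  finally have W: "?l * wronskian p q = ?l ^ (i + j) * T" .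
  have "poly T a = (of_nat i - of_nat j) * (poly r a * poly s a)"
    by (simp add: T_def of_nat_poly)
  moreover have "of_nat i - of_nat j \<noteq> (0 :: 'a)" using ord by (simp add: i_def j_def)
  ultimately have T: "poly T a \<noteq> 0" using root by simp
  then have "T \<noteq> 0" by auto
  then have nzT: "?l ^ (i + j) * T \<noteq> 0" by (intro no_zero_divisors power_not_zero) auto
  then show nzW: "wronskian p q \<noteq> 0" using W by auto
  have nzlW: "?l * wronskian p q \<noteq> 0" using nzT W by simp
  have "1 + Polynomial.order a (wronskian p q) = Polynomial.order a (?l * wronskian p q)"
    using order_power_n_n[of a 1] by (simp only: order_mult[OF nzlW] power_one_right)
  also have "\<dots> = i + j"
    unfolding W order_mult[OF nzT] order_power_n_n using T by (simp add: order_0I)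
  finally show "poly_ord (Finite a) (wronskian p q) = poly_ord (Finite a) p + poly_ord (Finite a) q - 1"
    unfolding i_def j_def by simp
qed

text \<open>The same argument with leading terms: \<open>t * pderiv\<close> multiplies a leading
  term of degree \<open>m\<close> by \<open>m\<close>, so \<open>t\<close> times the Wronskian has
  \<open>m - n\<close> times the product of the leading coefficients at degree
  \<open>m + n\<close>.\<close>

lemma poly_ord_wronskian_infinity:
  fixes p q :: "'a::field poly"
  assumes nz: "p \<noteq> 0" "q \<noteq> 0"
    and ord: "of_int (poly_ord Infinity p - poly_ord Infinity q) \<noteq> (0 :: 'a)"
  shows "wronskian p q \<noteq> 0"
    "poly_ord Infinity (wronskian p q) = poly_ord Infinity p + poly_ord Infinity q + 1"
proof -
  let ?X = "[:0, 1:] :: 'a poly"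
  let ?m = "Polynomial.degree p" and ?n = "Polynomial.degree q"
  \<comment> \<open>\<open>r\<close> and \<open>s\<close> are the errors made by treating
    \<open>p\<close> and \<open>q\<close> as eigenvectors of \<open>t * pderiv\<close>; their
    coefficients at the top degree cancel.\<close>
  define r where "r = ?X * pderiv p - of_nat ?m * p"
  define s where "s = ?X * pderiv q - of_nat ?n * q"
  have X: "Polynomial.coeff (?X * pderiv u) k = of_nat k * Polynomial.coeff u k" for u :: "'a poly" and k
    by (cases k) (simp_all add: coeff_pderiv)
  have coeff: "Polynomial.coeff (?X * pderiv u - of_nat m * u) k
      = (of_nat k - of_nat m) * Polynomial.coeff u k" for u :: "'a poly" and m k
    by (simp only: coeff_diff X of_nat_poly) (simp add: algebra_simps)
  have r: "Polynomial.coeff r k = 0" if "k \<ge> ?m" for k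
    using that unfolding r_def coeff by (cases "k = ?m") (auto simp: coeff_eq_0)
  have s: "Polynomial.coeff s k = 0" if "k \<ge> ?n" for k
    using that unfolding s_def coeff by (cases "k = ?n") (auto simp: coeff_eq_0)
  \<comment> \<open>Phrased by coefficients and not by degrees: for a constant \<open>p\<close> the
    error \<open>r\<close> is 0, and no degree lies below \<open>?m = 0\<close>.\<close>
  have prod0: "Polynomial.coeff (u * v) k = 0"
    if "\<And>k. k \<ge> a \<Longrightarrow> Polynomial.coeff u k = 0" "k \<ge> a + Polynomial.degree v"
    for u v :: "'a poly" and a k
    unfolding coeff_mult
  proof (intro sum.neutral ballI)
    fix i assume "i \<in> {..k}"
    then show "Polynomial.coeff u i * Polynomial.coeff v (k - i) = 0"
      using that by (cases "i \<ge> a") (auto intro: coeff_eq_0)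
  qed
  have W: "?X * wronskian p q = of_nat ?m * (p * q) - of_nat ?n * (p * q) + (r * q - s * p)"
    unfolding wronskian_def r_def s_def by (simp only: algebra_simps)
  have coeffW: "Polynomial.coeff (?X * wronskian p q) k
      = (of_nat ?m - of_nat ?n) * Polynomial.coeff (p * q) k" if "k \<ge> ?m + ?n" for k
  proof -
    have "Polynomial.coeff (r * q) k = 0" "Polynomial.coeff (s * p) k = 0"
      using prod0[of ?m r q k] prod0[of ?n s p k] r s that by auto
    then show ?thesis
      unfolding W by (simp only: coeff_add coeff_diff of_nat_poly) (simp add: algebra_simps)
  qed
  have c: "of_nat ?m - of_nat ?n \<noteq> (0 :: 'a)" using ord by auto
  have "Polynomial.coeff (?X * wronskian p q) (?m + ?n) \<noteq> 0"
    using c nz by (subst coeffW) (auto simp: coeff_mult_degree_sum)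
  moreover have "Polynomial.degree (?X * wronskian p q) \<le> ?m + ?n"
    by (rule degree_le) (use coeffW nz in \<open>auto simp: coeff_eq_0 degree_mult_eq\<close>)
  ultimately have deg: "Polynomial.degree (?X * wronskian p q) = ?m + ?n" "?X * wronskian p q \<noteq> 0"
    using le_degree by (fastforce, force)
  then show nz': "wronskian p q \<noteq> 0" by auto
  have "Polynomial.degree (?X * wronskian p q) = 1 + Polynomial.degree (wronskian p q)"
    using nz' by (subst degree_mult_eq) auto
  then show "poly_ord Infinity (wronskian p q) = poly_ord Infinity p + poly_ord Infinity q + 1"
    using deg by simp
qed

lemma poly_ord_wronskian:
  fixes p q :: "'a::field poly"
  assumes nz: "p \<noteq> 0" "q \<noteq> 0" and ord: "of_int (poly_ord P p - poly_ord P q) \<noteq> (0 :: 'a)"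
  shows "wronskian p q \<noteq> 0"
    "poly_ord P (wronskian p q) = poly_ord P p + poly_ord P q - log_weight P"
  using poly_ord_wronskian_finite[OF nz] poly_ord_wronskian_infinity[OF nz] ord
  by (cases P; simp)+

lemma rf_deriv_eq_wronskian:
  "rf_deriv \<sigma> = Fract (wronskian (rf_num \<sigma>) (rf_den \<sigma>)) (rf_den \<sigma> ^ 2)"
  by (simp add: rf_deriv_def wronskian_def Let_def)

text \<open>Subtracting a finite value \<open>b\<close> moves the image of \<open>Q\<close> to 0 and
  does not change the Wronskian, since a multiple of the denominator is removed from the numerator.
  Then the orders of numerator and denominator differ by the ramification index, with a minus sign
  over infinity, and tameness makes this difference nonzero in the field.\<close>

theorem rf_ord_deriv:
  fixes \<sigma> :: "'a::alg_closed_field ratfun"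
  assumes \<sigma>: "pline_morphism \<sigma>" and tame: "of_nat (ram_index \<sigma> Q) \<noteq> (0 :: 'a)"
  shows "rf_deriv \<sigma> \<noteq> 0"
    and "rf_ord Q (rf_deriv \<sigma>) + log_weight Q
      = int (ram_index \<sigma> Q) * log_weight (morphism_app \<sigma> Q)"
proof -
  let ?p = "rf_num \<sigma>" and ?q = "rf_den \<sigma>"
  have p0: "?p \<noteq> 0" using pline_morphism_nonzero[OF \<sigma>] by simp
  have "wronskian ?p ?q \<noteq> 0 \<and> poly_ord Q (wronskian ?p ?q)
      = int (ram_index \<sigma> Q) * log_weight (morphism_app \<sigma> Q) + 2 * poly_ord Q ?q - log_weight Q"
  proof (cases "morphism_app \<sigma> Q")
    case (Finite b)
    let ?n = "?p - Polynomial.smult b ?q"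
    have n0: "?n \<noteq> 0" by (rule num_sub_den_nonzero[OF \<sigma>])
    have "int (ram_index \<sigma> Q) = rf_ord Q (Fract ?n ?q)"
      using ram_index_eq(1)[OF \<sigma> Finite] by (simp only: sub_const_eq_Fract)
    then have e: "int (ram_index \<sigma> Q) = poly_ord Q ?n - poly_ord Q ?q"
      using n0 by (simp add: rf_ord_Fract)
    have "wronskian ?n ?q = wronskian ?p ?q"
      by (simp add: wronskian_def pderiv_diff pderiv_smult algebra_simps)
    moreover have "of_int (poly_ord Q ?n - poly_ord Q ?q) \<noteq> (0 :: 'a)"
      unfolding e[symmetric] using tame by simp
    ultimately show ?thesis
      using poly_ord_wronskian[OF n0 rf_den_nonzero, of Q \<sigma>] Finite e
      by simp
  next
    case Infinity
    have e: "- int (ram_index \<sigma> Q) = poly_ord Q ?p - poly_ord Q ?q"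
      using ram_index_eq(2)[OF \<sigma> Infinity] by (simp add: rf_ord_eq_poly_ord)
    moreover have "of_int (poly_ord Q ?p - poly_ord Q ?q) \<noteq> (0 :: 'a)"
      unfolding e[symmetric] using tame by simp
    ultimately show ?thesis
      using poly_ord_wronskian[OF p0 rf_den_nonzero, of Q \<sigma>] Infinity
      by simp
  qed
  moreover have "poly_ord Q (?q ^ 2) = 2 * poly_ord Q ?q"
    by (simp add: power2_eq_square poly_ord_mult)
  moreover have "wronskian ?p ?q \<noteq> 0 \<Longrightarrow>
      rf_ord Q (rf_deriv \<sigma>) = poly_ord Q (wronskian ?p ?q) - poly_ord Q (?q ^ 2)"
    unfolding rf_deriv_eq_wronskian by (rule rf_ord_Fract) auto
  ultimately show "rf_ord Q (rf_deriv \<sigma>) + log_weight Q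
      = int (ram_index \<sigma> Q) * log_weight (morphism_app \<sigma> Q)"
    and "rf_deriv \<sigma> \<noteq> 0"
    by (auto simp: rf_deriv_eq_wronskian Zero_fract_def eq_fract)
qed

lemma log_ord_pullback:
  fixes \<sigma> :: "'a::alg_closed_field ratfun"
  assumes \<sigma>: "pline_morphism \<sigma>" and tame: "of_nat (ram_index \<sigma> Q) \<noteq> (0 :: 'a)"
    and \<omega>: "snd \<omega> \<noteq> 0"
  shows "log_ord Q (form_pullback \<sigma> \<omega>) = int (ram_index \<sigma> Q) * log_ord (morphism_app \<sigma> Q) \<omega>"
proof -
  note d = rf_ord_deriv[OF \<sigma> tame]
  have "rf_ord Q (rf_deriv \<sigma>)
      = int (ram_index \<sigma> Q) * log_weight (morphism_app \<sigma> Q) - log_weight Q"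
    using d(2) by simp
  then show ?thesis
    using d(1) \<omega> rf_compose_eq_0_iff[OF \<sigma>, of "snd \<omega>"]
    by (simp add: log_ord_def form_pullback_def rf_ord_mult rf_ord_powi rf_ord_compose \<sigma>)
      (simp add: algebra_simps)
qed

section \<open>Combinatorics of ramification\<close>

text \<open>Here \<open>\<mu>\<close> stands for the log order of a semi-invariant form divided by the weight.\<close>

locale correspondence =
  fixes s1 s2 :: "'p \<Rightarrow> 'p" and e1 e2 :: "'p \<Rightarrow> nat" and d1 d2 :: nat and \<mu> :: "'p \<Rightarrow> real"
  assumes fin1: "finite {Q. s1 Q = P}" and fin2: "finite {Q. s2 Q = P}"
    and fibre1: "(\<Sum>Q | s1 Q = P. e1 Q) = d1" and fibre2: "(\<Sum>Q | s2 Q = P. e2 Q) = d2"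
    and e1_pos: "e1 Q > 0" and e2_pos: "e2 Q > 0"
    and fin_ram: "finite {Q. e2 Q \<noteq> 1}"
    and hurwitz: "(\<Sum>Q | e2 Q \<noteq> 1. e2 Q - 1) + 2 \<le> 2 * d2"
    and mu_eq: "real (e1 Q) * \<mu> (s1 Q) = real (e2 Q) * \<mu> (s2 Q)"
    and fin_mu: "finite {P. \<mu> P \<noteq> 1}"
    and sum_mu: "(\<Sum>P | \<mu> P \<noteq> 1. 1 - \<mu> P) = 2"
    and deg: "d1 \<ge> 14 * d2"
begin

section \<open>Preimages of finite sets\<close>

lemma finite_preimage:
  assumes "finite E"
  shows "finite {Q. s1 Q \<in> E}" "finite {Q. s2 Q \<in> E}"
proof -
  have "{Q. s1 Q \<in> E} = (\<Union>P\<in>E. {Q. s1 Q = P})" "{Q. s2 Q \<in> E} = (\<Union>P\<in>E. {Q. s2 Q = P})" by auto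
  then show "finite {Q. s1 Q \<in> E}" "finite {Q. s2 Q \<in> E}" using assms fin1 fin2 by simp_all
qed

lemma sum_preimage:
  assumes "finite E"
  shows "(\<Sum>Q | s1 Q \<in> E. e1 Q) = d1 * card E" "(\<Sum>Q | s2 Q \<in> E. e2 Q) = d2 * card E"
proof -
  have "(\<Sum>P\<in>E. \<Sum>Q\<in>{Q\<in>{Q. s1 Q \<in> E}. s1 Q = P}. e1 Q) = (\<Sum>Q | s1 Q \<in> E. e1 Q)"
    by (rule sum.group) (use assms finite_preimage in auto)
  moreover have "P \<in> E \<Longrightarrow> {Q\<in>{Q. s1 Q \<in> E}. s1 Q = P} = {Q. s1 Q = P}" for P by auto
  ultimately show "(\<Sum>Q | s1 Q \<in> E. e1 Q) = d1 * card E" using fibre1 by (simp add: mult.commute)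
  have "(\<Sum>P\<in>E. \<Sum>Q\<in>{Q\<in>{Q. s2 Q \<in> E}. s2 Q = P}. e2 Q) = (\<Sum>Q | s2 Q \<in> E. e2 Q)"
    by (rule sum.group) (use assms finite_preimage in auto)
  moreover have "P \<in> E \<Longrightarrow> {Q\<in>{Q. s2 Q \<in> E}. s2 Q = P} = {Q. s2 Q = P}" for P by auto
  ultimately show "(\<Sum>Q | s2 Q \<in> E. e2 Q) = d2 * card E" using fibre2 by (simp add: mult.commute)
qed

text \<open>If unramified points of \<open>s2\<close> over \<open>\<mu> = c\<close> stay over \<open>\<mu> = c\<close>, then the preimage has degree
  at most \<open>d2\<close> per point of \<open>\<mu> = c\<close> plus the contribution of the ramification of \<open>s2\<close>.\<close>

lemma value_excluded:
  assumes c: "c \<noteq> 1"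
    and unram: "\<And>Q. \<mu> (s1 Q) = c \<Longrightarrow> e2 Q = 1 \<Longrightarrow> e1 Q = 1 \<and> \<mu> (s2 Q) = c"
    and ram: "\<And>Q. \<mu> (s1 Q) = c \<Longrightarrow> e1 Q \<le> 3 * e2 Q"
  shows "\<mu> P \<noteq> c"
proof
  assume P: "\<mu> P = c"
  define E where "E = {P. \<mu> P = c}"
  have "E \<subseteq> {P. \<mu> P \<noteq> 1}" using c by (auto simp: E_def)
  then have finE: "finite E" using fin_mu by (rule finite_subset)
  then have cardE: "card E \<ge> 1" using P by (auto simp: E_def Suc_le_eq card_gt_0_iff)
  let ?A = "{Q. s1 Q \<in> E}" and ?B = "{Q. s2 Q \<in> E}" and ?R = "{Q. e2 Q \<noteq> 1}"
  have "d1 * card E = (\<Sum>Q\<in>?A. e1 Q)" using sum_preimage[OF finE] by simp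
  also have "\<dots> = (\<Sum>Q\<in>?A - ?R. e1 Q) + (\<Sum>Q\<in>?A \<inter> ?R. e1 Q)"
    using finite_preimage[OF finE] by (simp add: sum.Int_Diff[of ?A _ ?R])
  also have "(\<Sum>Q\<in>?A - ?R. e1 Q) \<le> (\<Sum>Q\<in>?B. e2 Q)"
  proof -
    have "(\<Sum>Q\<in>?A - ?R. e1 Q) = (\<Sum>Q\<in>?A - ?R. e2 Q)"
      by (intro sum.cong) (use unram in \<open>auto simp: E_def\<close>)
    also have "\<dots> \<le> (\<Sum>Q\<in>?B. e2 Q)"
      using finite_preimage[OF finE] unram by (intro sum_mono2) (auto simp: E_def)
    finally show ?thesis .
  qed
  also have "(\<Sum>Q\<in>?B. e2 Q) = d2 * card E" using sum_preimage[OF finE] by simp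
  \<comment> \<open>On \<open>?R\<close> the index \<open>e2 Q\<close> is at least 2, so
    \<open>e2 Q\<close> is at most \<open>2 * (e2 Q - 1)\<close>; this turns the factor 3 into
    6.\<close>
  also have "(\<Sum>Q\<in>?A \<inter> ?R. e1 Q) \<le> (\<Sum>Q\<in>?A \<inter> ?R. 6 * (e2 Q - 1))"
  proof (rule sum_mono)
    fix Q assume "Q \<in> ?A \<inter> ?R"
    then have "e1 Q \<le> 3 * e2 Q" "e2 Q \<noteq> 1" using ram by (auto simp: E_def)
    then show "e1 Q \<le> 6 * (e2 Q - 1)" using e2_pos[of Q] by linarith
  qed
  also have "\<dots> \<le> (\<Sum>Q\<in>?R. 6 * (e2 Q - 1))"
    using fin_ram by (intro sum_mono2) auto
  also have "\<dots> = 6 * (\<Sum>Q\<in>?R. e2 Q - 1)" by (simp add: sum_distrib_left)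
  finally have "d1 * card E \<le> d2 * card E + 6 * (\<Sum>Q\<in>?R. e2 Q - 1)" by simp
  \<comment> \<open>Hurwitz bounds the ramification sum by \<open>2 * d2 - 2\<close>, and 6 times
    this is \<open>12 * d2 - 12\<close>.\<close>
  then have *: "d1 * card E + 12 \<le> d2 * card E + 12 * d2" using hurwitz by linarith
  have "14 * d2 * card E \<le> d1 * card E" using deg by simp
  moreover have "13 * d2 \<le> 13 * (d2 * card E)" using cardE by simp
  ultimately show False using * by linarith
qed

text \<open>Let \<open>c\<close> be the largest value. Over it,
  \<open>e1 * c = e2 * \<mu> (s2 Q)\<close> is at most \<open>e2 * c\<close>, so \<open>e1\<close>
  is at most \<open>e2\<close>. Where \<open>e2 = 1\<close> this forces \<open>e1 = 1\<close> and
  the value \<open>c\<close> persists, so \<open>value_excluded\<close> applies.\<close>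

lemma mu_le_1: "\<mu> P \<le> 1"
proof (rule ccontr)
  assume "\<not> \<mu> P \<le> 1"
  then have P: "\<mu> P > 1" by simp
  let ?S = "\<mu> ` {P. \<mu> P \<noteq> 1}"
  define c where "c = Max ?S"
  have fin: "finite ?S" using fin_mu by simp
  have "\<mu> P \<in> ?S" using P by auto
  then have c1: "c > 1" using Max_ge[OF fin] P unfolding c_def by fastforce
  have max: "\<mu> P' \<le> c" for P'
  proof (cases "\<mu> P' = 1")
    case False
    then show ?thesis unfolding c_def using fin by (intro Max_ge) auto
  qed (use c1 in simp)
  have le: "e1 Q \<le> e2 Q" if "\<mu> (s1 Q) = c" for Q
  proof -
    have "real (e1 Q) * c \<le> real (e2 Q) * c"
      using mu_eq[of Q] that max[of "s2 Q"] by (simp add: mult_left_mono)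
    then show ?thesis using c1 by simp
  qed
  have "e1 Q = 1 \<and> \<mu> (s2 Q) = c" if "\<mu> (s1 Q) = c" "e2 Q = 1" for Q
  proof -
    have "e1 Q = 1" using le[OF that(1)] e1_pos[of Q] that(2) by simp
    then show ?thesis using mu_eq[of Q] that by simp
  qed
  moreover have "e1 Q \<le> 3 * e2 Q" if "\<mu> (s1 Q) = c" for Q using le[OF that] by simp
  ultimately have "\<mu> P' \<noteq> c" for P' using c1 by (intro value_excluded) auto
  moreover have "c \<in> ?S" unfolding c_def using fin \<open>\<mu> P \<in> ?S\<close> by (intro Max_in) auto
  ultimately show False by auto
qed

text \<open>The mirror image of \<open>mu_le_1\<close> for the smallest value: cancelling the
  negative \<open>c\<close> reverses the inequality, so again \<open>e1\<close> is at most
  \<open>e2\<close>.\<close>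

lemma mu_nonneg: "\<mu> P \<ge> 0"
proof (rule ccontr)
  assume "\<not> \<mu> P \<ge> 0"
  then have P: "\<mu> P < 0" by simp
  let ?S = "\<mu> ` {P. \<mu> P \<noteq> 1}"
  define c where "c = Min ?S"
  have fin: "finite ?S" using fin_mu by simp
  have "\<mu> P \<in> ?S" using P by auto
  then have c1: "c < 0" using Min_le[OF fin] P unfolding c_def by fastforce
  have min: "\<mu> P' \<ge> c" for P'
  proof (cases "\<mu> P' = 1")
    case False
    then show ?thesis unfolding c_def using fin by (intro Min_le) auto
  qed (use c1 in simp)
  have le: "e1 Q \<le> e2 Q" if "\<mu> (s1 Q) = c" for Q
  proof -
    have "real (e1 Q) * c \<ge> real (e2 Q) * c"
      using mu_eq[of Q] that min[of "s2 Q"] by (simp add: mult_left_mono)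
    then show ?thesis using c1 by simp
  qed
  have "e1 Q = 1 \<and> \<mu> (s2 Q) = c" if "\<mu> (s1 Q) = c" "e2 Q = 1" for Q
  proof -
    have "e1 Q = 1" using le[OF that(1)] e1_pos[of Q] that(2) by simp
    then show ?thesis using mu_eq[of Q] that by simp
  qed
  moreover have "e1 Q \<le> 3 * e2 Q" if "\<mu> (s1 Q) = c" for Q using le[OF that] by simp
  ultimately have "\<mu> P' \<noteq> c" for P' using c1 by (intro value_excluded) auto
  moreover have "c \<in> ?S" unfolding c_def using fin \<open>\<mu> P \<in> ?S\<close> by (intro Min_in) auto
  ultimately show False by auto
qed

text \<open>Since \<open>e2 * \<mu> (s2 Q)\<close> is at most \<open>e2\<close>, a value above 1/3
  gives the factor 3 that \<open>value_excluded\<close> asks for. Where \<open>e2 = 1\<close>, only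
  the indices 1 and 2 remain for \<open>e1\<close>.\<close>

lemma e1_le:
  assumes "\<mu> (s1 Q) > 1 / 3"
  shows "e1 Q \<le> 3 * e2 Q" "e2 Q = 1 \<Longrightarrow> e1 Q \<le> 2"
proof -
  have "real (e1 Q) * (1 / 3) < real (e1 Q) * \<mu> (s1 Q)"
    using assms e1_pos[of Q] by (intro mult_strict_left_mono) auto
  also have "\<dots> \<le> real (e2 Q)"
    unfolding mu_eq using mu_le_1[of "s2 Q"] by (simp add: mult_left_le)
  finally have "real (e1 Q) < real (3 * e2 Q)" by simp
  then have "e1 Q < 3 * e2 Q" by (simp only: of_nat_less_iff)
  then show "e1 Q \<le> 3 * e2 Q" "e2 Q = 1 \<Longrightarrow> e1 Q \<le> 2" by simp_all
qed

text \<open>At a point with \<open>e2 = 1\<close>, an index \<open>e1\<close> of at least 2 would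
  double a value above 1/2 past the bound 1, so \<open>e1 = 1\<close> and the value is
  preserved.\<close>

lemma mu_le_half:
  assumes "\<mu> P \<noteq> 1"
  shows "\<mu> P \<le> 1 / 2"
proof (rule ccontr)
  assume P: "\<not> ?thesis"
  have "\<mu> P' \<noteq> \<mu> P" for P'
  proof (rule value_excluded[OF assms])
    fix Q assume Q: "\<mu> (s1 Q) = \<mu> P"
    then show "e1 Q \<le> 3 * e2 Q" using P by (intro e1_le) auto
    assume e2: "e2 Q = 1"
    have "e1 Q = 1"
    proof (rule ccontr)
      assume "e1 Q \<noteq> 1"
      then have "real (e1 Q) \<ge> 2" using e1_pos[of Q] by simp
      then have "2 * \<mu> P \<le> real (e1 Q) * \<mu> P" using P by (intro mult_right_mono) auto
      moreover have "real (e1 Q) * \<mu> P = \<mu> (s2 Q)" using mu_eq[of Q] e2 Q by simp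
      ultimately show False using mu_le_1[of "s2 Q"] P by linarith
    qed
    then show "e1 Q = 1 \<and> \<mu> (s2 Q) = \<mu> P" using mu_eq[of Q] e2 Q by simp
  qed
  then show False by blast
qed

text \<open>At a point with \<open>e2 = 1\<close>, the index \<open>e1 = 2\<close> would lead to a
  value between 6/7 and 1, which \<open>mu_le_half\<close> forbids; so the value is preserved once
  more.\<close>

lemma mu_gap:
  assumes "\<mu> P \<ge> 3 / 7" "\<mu> P < 1 / 2"
  shows False
proof -
  have "\<mu> P' \<noteq> \<mu> P" for P'
  proof (rule value_excluded)
    show "\<mu> P \<noteq> 1" using assms by simp
    fix Q assume Q: "\<mu> (s1 Q) = \<mu> P"
    then show "e1 Q \<le> 3 * e2 Q" using assms by (intro e1_le) auto
    assume e2: "e2 Q = 1"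
    have "e1 Q \<noteq> 2"
    proof
      assume "e1 Q = 2"
      then have "\<mu> (s2 Q) = 2 * \<mu> P" using mu_eq[of Q] e2 Q by simp
      then show False using mu_le_half[of "s2 Q"] assms by simp
    qed
    moreover have "e1 Q \<le> 2" using e1_le[of Q] e2 Q assms by simp
    ultimately have "e1 Q = 1" using e1_pos[of Q] by linarith
    then show "e1 Q = 1 \<and> \<mu> (s2 Q) = \<mu> P" using mu_eq[of Q] e2 Q by simp
  qed
  then show False by blast
qed

section \<open>The points where the value is not 1\<close>

lemma sum_mu_subset:
  assumes "finite A" "A \<subseteq> {P. \<mu> P \<noteq> 1}"
  shows "(\<Sum>P\<in>A. 1 - \<mu> P) \<le> 2"
  unfolding sum_mu[symmetric] using assms fin_mu mu_le_1 by (intro sum_mono2) auto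

lemma sum_mu_exhausted:
  assumes "finite A" "A \<subseteq> {P. \<mu> P \<noteq> 1}" "(\<Sum>P\<in>A. 1 - \<mu> P) = 2" "P \<notin> A"
  shows "\<mu> P = 1"
proof (rule ccontr)
  assume "\<mu> P \<noteq> 1"
  then have "(\<Sum>P\<in>insert P A. 1 - \<mu> P) \<le> 2" using assms by (intro sum_mu_subset) auto
  then show False using assms mu_le_1[of P] \<open>\<mu> P \<noteq> 1\<close> by simp
qed

lemma exists_further:
  assumes "finite A" "A \<subseteq> {P. \<mu> P \<noteq> 1}" "(\<Sum>P\<in>A. 1 - \<mu> P) < 2"
  obtains P where "P \<notin> A" "\<mu> P \<noteq> 1"
proof -
  have "A \<noteq> {P. \<mu> P \<noteq> 1}" using assms sum_mu by auto
  then show ?thesis using assms that by auto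
qed

text \<open>The index \<open>e2 Q\<close> is at most \<open>d2\<close>, so the relation between the
  values gives \<open>d1 * \<mu> (s1 Q)\<close> at most \<open>d2\<close>.\<close>

lemma total_ramification_value:
  assumes "e1 Q = d1" "d2 > 0"
  shows "\<mu> (s1 Q) \<le> 1 / 14"
proof -
  have "e2 Q \<le> (\<Sum>Q' | s2 Q' = s2 Q. e2 Q')" using fin2 by (intro member_le_sum) auto
  then have "e2 Q \<le> d2" using fibre2 by simp
  have "real d1 * \<mu> (s1 Q) \<le> real (e2 Q)"
    using mu_eq[of Q] mu_le_1[of "s2 Q"] assms by (simp add: mult_left_le)
  also have "\<dots> \<le> real d2" using \<open>e2 Q \<le> d2\<close> by simp
  finally have "real d1 * \<mu> (s1 Q) \<le> real d2" .
  moreover have "real (14 * d2) * \<mu> (s1 Q) \<le> real d1 * \<mu> (s1 Q)"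
    using deg mu_nonneg by (intro mult_right_mono of_nat_mono) auto
  ultimately have "real d2 * (14 * \<mu> (s1 Q)) \<le> real d2 * 1" by (simp add: algebra_simps)
  then show ?thesis using assms(2) by (subst (asm) mult_le_cancel_left_pos) auto
qed

theorem flat_values:
  assumes "e1 Q = d1" "d2 > 0"
  shows "(\<exists>a b. a \<noteq> b \<and> \<mu> a = 0 \<and> \<mu> b = 0 \<and> (\<forall>P. P \<notin> {a, b} \<longrightarrow> \<mu> P = 1)) \<or>
    (\<exists>a b c. distinct [a, b, c] \<and> \<mu> a = 1 / 2 \<and> \<mu> b = 1 / 2 \<and> \<mu> c = 0 \<and>
      (\<forall>P. P \<notin> {a, b, c} \<longrightarrow> \<mu> P = 1))"
proof -
  let ?c = "s1 Q"
  have c: "\<mu> ?c \<le> 1 / 14" by (rule total_ramification_value[OF assms])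
  have "(\<Sum>P\<in>{?c}. 1 - \<mu> P) < 2" using mu_nonneg[of ?c] by simp
  then obtain a where a: "a \<noteq> ?c" "\<mu> a \<noteq> 1"
    using exists_further[of "{?c}"] c by auto
  show ?thesis
  proof (cases "\<mu> ?c + \<mu> a = 0")
    case True
    then have z: "\<mu> ?c = 0" "\<mu> a = 0" using mu_nonneg[of ?c] mu_nonneg[of a] by linarith+
    then have "\<forall>P. P \<notin> {?c, a} \<longrightarrow> \<mu> P = 1" using a by (auto intro!: sum_mu_exhausted[of "{?c, a}"])
    then show ?thesis using z a by metis
  next
    case False
    then have "\<mu> ?c + \<mu> a > 0" using mu_nonneg[of ?c] mu_nonneg[of a] by linarith
    then have "(\<Sum>P\<in>{?c, a}. 1 - \<mu> P) < 2" using a by simp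
    then obtain b where b: "b \<notin> {?c, a}" "\<mu> b \<noteq> 1"
      using exists_further[of "{?c, a}"] c a by auto
    have half: "\<mu> a \<le> 1 / 2" "\<mu> b \<le> 1 / 2" using mu_le_half[OF a(2)] mu_le_half[OF b(2)] by blast+
    have sub: "{?c, a, b} \<subseteq> {P. \<mu> P \<noteq> 1}" using a b c by auto
    have sum: "(\<Sum>P\<in>{?c, a, b}. 1 - \<mu> P) = 3 - \<mu> ?c - \<mu> a - \<mu> b"
      using a b by auto
    \<comment> \<open>A fourth point would have a value of at most 1/2 like \<open>a\<close> and
      \<open>b\<close>, and the sum would reach 4 - 1/14 - 3/2, which exceeds 2.\<close>
    have rest: "\<mu> P = 1" if P: "P \<notin> {?c, a, b}" for P
    proof (rule ccontr)
      assume "\<mu> P \<noteq> 1"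
      then have "\<mu> P \<le> 1 / 2" by (rule mu_le_half)
      moreover have "(\<Sum>P\<in>{?c, a, b, P}. 1 - \<mu> P) \<le> 2"
        using sub \<open>\<mu> P \<noteq> 1\<close> by (intro sum_mu_subset) auto
      moreover have "(\<Sum>P\<in>{?c, a, b, P}. 1 - \<mu> P) = 4 - \<mu> ?c - \<mu> a - \<mu> b - \<mu> P"
        using P a b by auto
      ultimately show False using half c by linarith
    qed
    then have "{P. \<mu> P \<noteq> 1} = {?c, a, b}" using sub by blast
    then have eq: "\<mu> ?c + \<mu> a + \<mu> b = 1" using sum_mu sum by simp
    \<comment> \<open>Here 3/7 is 1 - 1/14 - 1/2, so \<open>mu_gap\<close> leaves only the value
      1/2.\<close>
    then have "\<mu> a \<ge> 3 / 7" "\<mu> b \<ge> 3 / 7" using half c by linarith+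
    then have "\<not> \<mu> a < 1 / 2" "\<not> \<mu> b < 1 / 2" using mu_gap by blast+
    then have "\<mu> a = 1 / 2" "\<mu> b = 1 / 2" using half by linarith+
    moreover from this have "\<mu> ?c = 0" using eq by simp
    moreover have "distinct [a, b, ?c]" using a b by auto
    ultimately show ?thesis using rest by (metis insert_commute)
  qed
qed

end

section \<open>Semi-invariant forms over an algebraically closed field\<close>

text \<open>Non-vanishing in the field treats all characteristics at once and is the form in which
  the orders of derivatives need tameness.\<close>

definition tame :: "'a::field ratfun \<Rightarrow> bool" where
  "tame \<sigma> \<longleftrightarrow> (\<forall>Q. of_nat (ram_index \<sigma> Q) \<noteq> (0 :: 'a))"

text \<open>Each summand is minus the order of \<open>dt\<close>, so the sum is minus the degree of
  the canonical divisor.\<close>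

lemma sum_log_weight:
  fixes F :: "'a pline set"
  assumes "finite F" "Infinity \<in> F"
  shows "(\<Sum>Q\<in>F. 1 - log_weight Q) = 2"
proof -
  have "(\<Sum>Q\<in>F. 1 - log_weight Q) = (\<Sum>Q\<in>{Infinity :: 'a pline}. 1 - log_weight Q)"
  proof (rule sum.mono_neutral_right)
    show "\<forall>Q\<in>F - {Infinity}. 1 - log_weight Q = 0"
    proof
      fix Q assume "Q \<in> F - {Infinity}"
      then show "1 - log_weight Q = 0" by (cases Q) auto
    qed
  qed (use assms in auto)
  then show ?thesis by simp
qed

text \<open>The orders of the function \<open>rf_deriv \<sigma>\<close> add up to 0. By
  \<open>rf_ord_deriv\<close> each is \<open>e - 1\<close>, plus \<open>1 - log_weight Q\<close>,
  minus \<open>2 * e\<close> if \<open>Q\<close> lies over infinity; these parts sum to the total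
  ramification, to 2 and to twice the degree.\<close>

theorem riemann_hurwitz:
  fixes \<sigma> :: "'a::alg_closed_field ratfun"
  assumes \<sigma>: "pline_morphism \<sigma>" "tame \<sigma>"
  shows "finite {Q. ram_index \<sigma> Q \<noteq> 1}"
    and "(\<Sum>Q | ram_index \<sigma> Q \<noteq> 1. ram_index \<sigma> Q - 1) + 2 = 2 * morphism_degree \<sigma>"
proof -
  let ?e = "ram_index \<sigma>" and ?f = "rf_deriv \<sigma>"
  note d = rf_ord_deriv[OF \<sigma>(1) \<sigma>(2)[unfolded tame_def, rule_format]]
  have e: "?e Q > 0" for Q by (rule ram_index_pos[OF \<sigma>(1)])
  \<comment> \<open>Outside \<open>F\<close> both \<open>Q\<close> and its image are finite and the
    derivative is a unit, which forces index 1.\<close>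
  define F where "F = insert Infinity ({Q. morphism_app \<sigma> Q = Infinity} \<union> {Q. rf_ord Q ?f \<noteq> 0})"
  have fin: "finite F"
    using sum_ram_index(1)[OF \<sigma>(1)] finite_rf_ord_nonzero[OF d(1)] by (simp add: F_def)
  have sub: "{Q. ?e Q \<noteq> 1} \<subseteq> F"
  proof
    fix Q assume Q: "Q \<in> {Q. ?e Q \<noteq> 1}"
    show "Q \<in> F"
    proof (rule ccontr)
      assume nF: "Q \<notin> F"
      then obtain a b where "Q = Finite a" "morphism_app \<sigma> Q = Finite b"
        by (cases Q; cases "morphism_app \<sigma> Q") (auto simp: F_def)
      then show False using d(2)[of Q] Q nF by (auto simp: F_def)
    qed
  qed
  then show finR: "finite {Q. ?e Q \<noteq> 1}" using fin by (rule finite_subset)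
  have lw: "int (?e Q) * log_weight (morphism_app \<sigma> Q)
      = int (?e Q) - 2 * (if morphism_app \<sigma> Q = Infinity then int (?e Q) else 0)" for Q
    by (cases "morphism_app \<sigma> Q") auto
  have "(\<Sum>Q\<in>F. if morphism_app \<sigma> Q = Infinity then int (?e Q) else 0)
      = (\<Sum>Q | morphism_app \<sigma> Q = Infinity. int (?e Q))"
    using fin by (subst sum.inter_filter[symmetric]) (auto simp: F_def intro!: sum.cong)
  then have inf: "(\<Sum>Q\<in>F. if morphism_app \<sigma> Q = Infinity then int (?e Q) else 0)
      = int (morphism_degree \<sigma>)"
    using sum_ram_index(2)[OF \<sigma>(1), of Infinity] by (simp flip: of_nat_sum)
  have "0 = (\<Sum>Q\<in>F. rf_ord Q ?f)"
    using sum_rf_ord[OF d(1) fin] by (auto simp: F_def)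
  also have "\<dots> = (\<Sum>Q\<in>F. (int (?e Q) - 1) + (1 - log_weight Q)
      - 2 * (if morphism_app \<sigma> Q = Infinity then int (?e Q) else 0))"
  proof (rule sum.cong[OF refl])
    fix Q
    show "rf_ord Q ?f = (int (?e Q) - 1) + (1 - log_weight Q)
        - 2 * (if morphism_app \<sigma> Q = Infinity then int (?e Q) else 0)"
      using d(2)[of Q] lw[of Q] by linarith
  qed
  also have "\<dots> = (\<Sum>Q\<in>F. int (?e Q) - 1) + (\<Sum>Q\<in>F. 1 - log_weight Q)
      - 2 * (\<Sum>Q\<in>F. if morphism_app \<sigma> Q = Infinity then int (?e Q) else 0)"
    by (simp only: sum_subtractf sum.distrib sum_distrib_left)
  also have "\<dots> = (\<Sum>Q\<in>F. int (?e Q) - 1) + 2 - 2 * int (morphism_degree \<sigma>)"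
    unfolding inf using sum_log_weight[OF fin] by (simp add: F_def)
  also have "(\<Sum>Q\<in>F. int (?e Q) - 1) = (\<Sum>Q | ?e Q \<noteq> 1. int (?e Q) - 1)"
    using fin sub by (intro sum.mono_neutral_right) auto
  also have "\<dots> = int (\<Sum>Q | ?e Q \<noteq> 1. ?e Q - 1)"
    unfolding of_nat_sum using e by (intro sum.cong) (auto simp: of_nat_diff Suc_le_eq)
  finally show "(\<Sum>Q | ?e Q \<noteq> 1. ?e Q - 1) + 2 = 2 * morphism_degree \<sigma>" by linarith
qed

text \<open>The difference \<open>1 - \<mu> P\<close> is minus the order of \<open>dt\<close> minus
  the order of the coefficient divided by the weight; the latter orders add up to 0.\<close>

lemma log_ord_sum:
  fixes \<omega> :: "'a::alg_closed_field form"
  assumes nz: "snd \<omega> \<noteq> 0" and \<nu>: "fst \<omega> \<noteq> 0"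
  defines "\<mu> \<equiv> \<lambda>P. real_of_int (log_ord P \<omega>) / real_of_int (fst \<omega>)"
  shows "finite {P. \<mu> P \<noteq> 1}" "(\<Sum>P | \<mu> P \<noteq> 1. 1 - \<mu> P) = 2"
proof -
  define F where "F = insert Infinity {P. rf_ord P (snd \<omega>) \<noteq> 0}"
  have fin: "finite F" using finite_rf_ord_nonzero[OF nz] by (simp add: F_def)
  have mu: "1 - \<mu> P = real_of_int (1 - log_weight P)
      - real_of_int (rf_ord P (snd \<omega>)) / real_of_int (fst \<omega>)" for P
    using \<nu> by (simp add: \<mu>_def log_ord_def add_divide_distrib)
  have sub: "{P. \<mu> P \<noteq> 1} \<subseteq> F"
  proof
    fix P assume "P \<in> {P. \<mu> P \<noteq> 1}"
    then show "P \<in> F" using mu[of P] by (cases P) (auto simp: F_def)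
  qed
  then show "finite {P. \<mu> P \<noteq> 1}" using fin by (rule finite_subset)
  have "(\<Sum>P | \<mu> P \<noteq> 1. 1 - \<mu> P) = (\<Sum>P\<in>F. 1 - \<mu> P)"
    using fin sub by (intro sum.mono_neutral_left) auto
  also have "\<dots> = real_of_int (\<Sum>P\<in>F. 1 - log_weight P)
      - real_of_int (\<Sum>P\<in>F. rf_ord P (snd \<omega>)) / real_of_int (fst \<omega>)"
    unfolding mu sum_subtractf[of "\<lambda>P. real_of_int (1 - log_weight P)"]
    by (simp only: sum_divide_distrib of_int_sum)
  also have "(\<Sum>P\<in>F. 1 - log_weight P) = 2" using sum_log_weight[OF fin] by (simp add: F_def)
  also have "(\<Sum>P\<in>F. rf_ord P (snd \<omega>)) = 0" by (rule sum_rf_ord[OF nz fin]) (auto simp: F_def)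
  finally show "(\<Sum>P | \<mu> P \<noteq> 1. 1 - \<mu> P) = 2" by simp
qed

section \<open>Flat forms with prescribed log orders\<close>

lemma pline_morphism_rf_X: "pline_morphism rf_X"
  by (auto simp: pline_morphism_def rf_X_def rf_const_def)

lemma rf_X_nonzero [simp]: "rf_X \<noteq> 0"
  by (simp add: rf_X_def)

lemma rf_X_neq_const [simp]: "rf_X \<noteq> rf_const a"
  using pline_morphism_rf_X by (metis pline_morphism_def rangeI)

text \<open>The standard flat forms have log order 0 at infinity. The coordinate
  \<open>1 / (t - \<beta>)\<close> moves any chosen point there.\<close>

lemma coordinate_with_pole:
  fixes b :: "'a::alg_closed_field pline"
  obtains s where "pline_automorphism s" "morphism_app s b = Infinity" "morphism_degree s = 1"
proof (cases b)
  case Infinity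
  have X: "rf_num rf_X = [:0, 1 :: 'a:]" "rf_den rf_X = (1 :: 'a poly)"
    using rf_num_den_Fract[of "[:0, 1::'a:]" 1] by (simp_all add: rf_X_eq_Fract)
  have "pline_automorphism (rf_X :: 'a ratfun)"
    by (auto simp: pline_automorphism_def inverse_morphisms_def pline_morphism_rf_X)
  then show ?thesis using that[of rf_X] Infinity X by (simp add: morphism_app_def morphism_degree_def)
next
  case (Finite \<beta>)
  define s where "s = 1 / (rf_X - rf_const \<beta>)"
  define t where "t = rf_const \<beta> + 1 / rf_X"
  have "s = Fract 1 [:- \<beta>, 1:]"
    by (simp add: s_def rf_X_eq_Fract rf_const_eq_Fract One_fract_def)
  moreover have "coprime 1 [:- \<beta>, 1:]" by simp
  ultimately have s: "rf_num s = 1" "rf_den s = [:- \<beta>, 1:]"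
    using rf_num_den_Fract[of 1 "[:- \<beta>, 1:]"] by simp_all
  have ms: "pline_morphism s"
    unfolding pline_morphism_def
  proof
    assume "s \<in> range rf_const"
    then obtain c where "s = rf_const c" by auto
    moreover have "rf_X - rf_const \<beta> = inverse s" by (simp add: s_def)
    ultimately have "rf_X = rf_const (inverse c + \<beta>)" by (simp add: diff_eq_eq)
    then show False using rf_X_neq_const by blast
  qed
  have mt: "pline_morphism t"
    unfolding pline_morphism_def
  proof
    assume "t \<in> range rf_const"
    then obtain c where "t = rf_const c" by auto
    then have "inverse rf_X = rf_const (c - \<beta>)" by (simp add: t_def divide_inverse algebra_simps)
    then have "rf_X = rf_const (inverse (c - \<beta>))" by (metis inverse_inverse_eq rf_const_inverse)
    then show False using rf_X_neq_const by blast
  qed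
  have "rf_compose s t = rf_X"
    by (simp add: s_def rf_compose_divide rf_compose_diff rf_compose_const rf_compose_1 mt)
      (simp add: t_def)
  moreover have "rf_compose t s = rf_X"
    by (simp add: t_def rf_compose_divide rf_compose_add rf_compose_const rf_compose_1 ms)
      (simp add: s_def)
  ultimately have "pline_automorphism s"
    using ms mt by (auto simp: pline_automorphism_def inverse_morphisms_def)
  then show ?thesis using that[of s] Finite s by (simp add: morphism_app_def morphism_degree_def)
qed

lemma degree_1_morphism:
  fixes s :: "'a::alg_closed_field ratfun"
  assumes s: "pline_morphism s" "morphism_degree s = 1"
  shows "ram_index s Q = 1" "inj (morphism_app s)" "tame s"
proof -
  have e: "ram_index s Q = 1" for Q
  proof -
    have "ram_index s Q \<le> (\<Sum>Q' | morphism_app s Q' = morphism_app s Q. ram_index s Q')"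
      using sum_ram_index(1)[OF s(1)] by (intro member_le_sum) auto
    then show ?thesis using sum_ram_index(2)[OF s(1)] s(2) ram_index_pos[OF s(1), of Q] by simp
  qed
  then show "ram_index s Q = 1" "tame s" by (simp_all add: tame_def)
  show "inj (morphism_app s)"
  proof (rule injI)
    fix P Q assume PQ: "morphism_app s P = morphism_app s Q"
    have "card {R. morphism_app s R = morphism_app s Q} = 1"
      using sum_ram_index(2)[OF s(1), of "morphism_app s Q"] s(2) by (simp add: e)
    then obtain R where "{R. morphism_app s R = morphism_app s Q} = {R}" by (auto simp: card_1_singleton_iff)
    then have "P \<in> {R}" "Q \<in> {R}" using PQ by auto
    then show "P = Q" by simp
  qed
qed

lemma log_ord_flat_1:
  "log_ord P (1, 1 / (rf_X - rf_const a)) = (if P \<in> {Finite a, Infinity} then 0 else 1)"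
proof -
  have ordlin: "Polynomial.order b [:- a, 1:] = (if b = a then 1 else 0)" for b
    using order_power_n_n[of a 1] by (auto intro: order_0I)
  have "(1, 1 / (rf_X - rf_const a)) = (1, Fract 1 [:- a, 1:])"
    by (simp add: rf_X_eq_Fract rf_const_eq_Fract One_fract_def)
  then show ?thesis by (cases P) (simp_all add: log_ord_def rf_ord_Fract ordlin)
qed

text \<open>Log orders add under products of forms, and this form is the product of two forms of
  weight 1.\<close>

lemma log_ord_flat_2:
  assumes "a \<noteq> b"
  shows "log_ord P (2, 1 / ((rf_X - rf_const a) * (rf_X - rf_const b)))
    = (if P = Infinity then 0 else if P \<in> {Finite a, Finite b} then 1 else 2)"
proof -
  have "log_ord P (2, 1 / ((rf_X - rf_const a) * (rf_X - rf_const b)))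
      = log_ord P (1, 1 / (rf_X - rf_const a)) + log_ord P (1, 1 / (rf_X - rf_const b))"
    by (simp add: log_ord_def divide_inverse rf_ord_mult)
  then show ?thesis using assms unfolding log_ord_flat_1 by (cases P) auto
qed

text \<open>A coordinate is unramified, so pulling back along it only relabels the points of the
  standard form. This realizes the values 0, 0 of \<open>flat_values\<close>.\<close>

lemma flat_with_log_ord_1:
  fixes a b :: "'a::alg_closed_field pline"
  assumes "a \<noteq> b"
  obtains \<eta> where "flat \<eta>" "fst \<eta> = 1" "snd \<eta> \<noteq> 0" "log_ord a \<eta> = 0" "log_ord b \<eta> = 0"
    "\<And>P. P \<notin> {a, b} \<Longrightarrow> log_ord P \<eta> = 1"
proof -
  obtain s where s: "pline_automorphism s" "morphism_app s b = Infinity" "morphism_degree s = 1"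
    using coordinate_with_pole .
  have ms: "pline_morphism s"
    using s(1) by (auto simp: pline_automorphism_def inverse_morphisms_def)
  note s1 = degree_1_morphism[OF ms s(3)]
  have app_eq: "morphism_app s P = morphism_app s Q \<longleftrightarrow> P = Q" for P Q using s1(2) by (auto dest: injD)
  then obtain a' where a': "morphism_app s a = Finite a'"
    using assms s(2) by (cases "morphism_app s a") metis+
  define \<eta> where "\<eta> = form_pullback s (1, 1 / (rf_X - rf_const a'))"
  have tame: "of_nat (ram_index s Q) \<noteq> (0 :: 'a)" for Q using s1(3) by (simp add: tame_def)
  have ord: "log_ord P \<eta> = log_ord (morphism_app s P) (1, 1 / (rf_X - rf_const a'))" for P
    using log_ord_pullback[OF ms tame, of "(1, 1 / (rf_X - rf_const a'))" P] s1(1)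
    by (simp add: \<eta>_def)
  have "flat \<eta>" using s(1) by (auto simp: flat_def \<eta>_def)
  moreover have "fst \<eta> = 1" "snd \<eta> \<noteq> 0"
    using rf_ord_deriv(1)[OF ms tame]
    by (simp_all add: \<eta>_def form_pullback_def rf_compose_eq_0_iff ms)
  moreover have "log_ord a \<eta> = 0" "log_ord b \<eta> = 0" by (simp_all add: ord log_ord_flat_1 a' s(2))
  moreover have "log_ord P \<eta> = 1" if "P \<notin> {a, b}" for P
    using that by (simp add: ord log_ord_flat_1 app_eq flip: a' s(2))
  ultimately show ?thesis by (rule that)
qed

text \<open>The model for the values 1/2, 1/2, 0: at weight 2 they become the log orders 1, 1,
  0.\<close>

lemma flat_with_log_ord_2:
  fixes a b c :: "'a::alg_closed_field pline"
  assumes "distinct [a, b, c]"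
  obtains \<eta> where "flat \<eta>" "fst \<eta> = 2" "snd \<eta> \<noteq> 0" "log_ord a \<eta> = 1" "log_ord b \<eta> = 1"
    "log_ord c \<eta> = 0" "\<And>P. P \<notin> {a, b, c} \<Longrightarrow> log_ord P \<eta> = 2"
proof -
  obtain s where s: "pline_automorphism s" "morphism_app s c = Infinity" "morphism_degree s = 1"
    using coordinate_with_pole .
  have ms: "pline_morphism s"
    using s(1) by (auto simp: pline_automorphism_def inverse_morphisms_def)
  note s1 = degree_1_morphism[OF ms s(3)]
  have app_eq: "morphism_app s P = morphism_app s Q \<longleftrightarrow> P = Q" for P Q using s1(2) by (auto dest: injD)
  then obtain a' where a': "morphism_app s a = Finite a'"
    using assms s(2) by (cases "morphism_app s a") (auto, metis)
  obtain b' where b': "morphism_app s b = Finite b'"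
    using assms s(2) app_eq by (cases "morphism_app s b") (auto, metis)
  have ab': "a' \<noteq> b'" using assms app_eq[of a b] a' b' by auto
  let ?\<eta> = "(2, 1 / ((rf_X - rf_const a') * (rf_X - rf_const b'))) :: 'a form"
  define \<eta> where "\<eta> = form_pullback s ?\<eta>"
  have tame: "of_nat (ram_index s Q) \<noteq> (0 :: 'a)" for Q using s1(3) by (simp add: tame_def)
  have ord: "log_ord P \<eta> = log_ord (morphism_app s P) ?\<eta>" for P
    using log_ord_pullback[OF ms tame, of ?\<eta> P] s1(1) by (simp add: \<eta>_def)
  have "flat \<eta>" using s(1) ab' by (auto simp: flat_def \<eta>_def)
  moreover have "fst \<eta> = 2" "snd \<eta> \<noteq> 0"
    using rf_ord_deriv(1)[OF ms tame]
    by (simp_all add: \<eta>_def form_pullback_def rf_compose_eq_0_iff ms)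
  moreover have "log_ord a \<eta> = 1" "log_ord b \<eta> = 1" "log_ord c \<eta> = 0"
    by (simp_all add: ord log_ord_flat_2[OF ab'] a' b' s(2))
  moreover have "log_ord P \<eta> = 2" if "P \<notin> {a, b, c}" for P
    using that by (simp add: ord log_ord_flat_2[OF ab'] app_eq flip: a' b' s(2))
  ultimately show ?thesis by (rule that)
qed

text \<open>Proportional weights and log orders mean that the quotient function has no zeros or
  poles, so it is constant.\<close>

lemma form_eq_power:
  fixes \<omega> \<eta> :: "'a::alg_closed_field form"
  assumes nz: "snd \<omega> \<noteq> 0" "snd \<eta> \<noteq> 0" and wt: "fst \<omega> = n * fst \<eta>"
    and ord: "\<And>P. log_ord P \<omega> = n * log_ord P \<eta>"
  obtains c where "c \<noteq> 0" "snd \<omega> = rf_const c * snd \<eta> powi n"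
proof -
  have nz': "snd \<eta> powi n \<noteq> 0" using nz by simp
  have "rf_ord P (snd \<omega> / snd \<eta> powi n) = 0" for P
    using ord[of P] wt nz nz'
    by (simp add: rf_ord_divide rf_ord_powi log_ord_def algebra_simps)
  moreover have "snd \<omega> / snd \<eta> powi n \<noteq> 0" using nz nz' by simp
  ultimately obtain c where "c \<noteq> 0" "snd \<omega> / snd \<eta> powi n = rf_const c"
    using rf_const_if_no_zeros_poles by metis
  then show ?thesis using that nz' by (simp add: field_simps)
qed

theorem semi_invariant_power_of_flat:
  fixes \<sigma>1 \<sigma>2 :: "'a::alg_closed_field ratfun" and \<omega> :: "'a form"
  assumes \<sigma>1: "pline_morphism \<sigma>1" "tame \<sigma>1" and \<sigma>2: "pline_morphism \<sigma>2" "tame \<sigma>2"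
    and total: "ram_index \<sigma>1 Q = morphism_degree \<sigma>1"
    and deg: "morphism_degree \<sigma>1 \<ge> 14 * morphism_degree \<sigma>2"
    and inv: "semi_invariant \<sigma>1 \<sigma>2 \<omega>" and \<nu>: "fst \<omega> \<noteq> 0"
  obtains \<eta> n c where "flat \<eta>" "snd \<eta> \<noteq> 0" "fst \<omega> = n * fst \<eta>" "c \<noteq> 0"
    "snd \<omega> = rf_const c * snd \<eta> powi n"
proof -
  define \<mu> where "\<mu> = (\<lambda>P. real_of_int (log_ord P \<omega>) / real_of_int (fst \<omega>))"
  have nz: "snd \<omega> \<noteq> 0" using inv by (simp add: semi_invariant_def form_group_def)
  obtain c where c: "c \<noteq> 0" "form_pullback \<sigma>1 \<omega> = form_smult c (form_pullback \<sigma>2 \<omega>)"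
    using inv by (auto simp: semi_invariant_def)
  have pb: "log_ord Q (form_pullback \<sigma> \<omega>) = int (ram_index \<sigma> Q) * log_ord (morphism_app \<sigma> Q) \<omega>"
    if "pline_morphism \<sigma>" "tame \<sigma>" for \<sigma> Q
    using that nz by (intro log_ord_pullback) (simp_all add: tame_def)
  have "snd (form_pullback \<sigma>2 \<omega>) \<noteq> 0"
    using rf_ord_deriv(1)[OF \<sigma>2(1)] \<sigma>2 nz by (simp add: form_pullback_def rf_compose_eq_0_iff tame_def)
  then have "log_ord Q (form_pullback \<sigma>1 \<omega>) = log_ord Q (form_pullback \<sigma>2 \<omega>)" for Q
    using c by (simp add: form_smult_def log_ord_def rf_ord_mult)
  then have "int (ram_index \<sigma>1 Q) * log_ord (morphism_app \<sigma>1 Q) \<omega>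
      = int (ram_index \<sigma>2 Q) * log_ord (morphism_app \<sigma>2 Q) \<omega>" for Q
    using pb \<sigma>1 \<sigma>2 by simp
  then have "real_of_int (int (ram_index \<sigma>1 Q) * log_ord (morphism_app \<sigma>1 Q) \<omega>)
      = real_of_int (int (ram_index \<sigma>2 Q) * log_ord (morphism_app \<sigma>2 Q) \<omega>)" for Q
    by (simp only:)
  then have mu: "real (ram_index \<sigma>1 Q) * \<mu> (morphism_app \<sigma>1 Q)
      = real (ram_index \<sigma>2 Q) * \<mu> (morphism_app \<sigma>2 Q)" for Q
    by (simp add: \<mu>_def)
  interpret correspondence "morphism_app \<sigma>1" "morphism_app \<sigma>2" "ram_index \<sigma>1" "ram_index \<sigma>2"
    "morphism_degree \<sigma>1" "morphism_degree \<sigma>2" \<mu>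
    using \<sigma>1 \<sigma>2 log_ord_sum[OF nz \<nu>] mu deg riemann_hurwitz[OF \<sigma>2]
    by unfold_locales (simp_all add: sum_ram_index ram_index_pos \<mu>_def)
  have ord: "log_ord P \<omega> = n * k" if "\<mu> P = real_of_int k / real_of_int w" "fst \<omega> = n * w" for P k n w
  proof -
    have "w \<noteq> 0" "n \<noteq> 0" using that(2) \<nu> by auto
    then have "real_of_int (log_ord P \<omega>) = real_of_int (n * k)"
      using that(1) by (simp add: \<mu>_def that(2) field_simps)
    then show ?thesis by (simp only: of_int_eq_iff)
  qed
  from flat_values[OF total morphism_degree_pos[OF \<sigma>2(1)]] show ?thesis
  proof (elim disjE exE conjE)
    fix a b assume ab: "a \<noteq> b" "\<mu> a = 0" "\<mu> b = 0" "\<forall>P. P \<notin> {a, b} \<longrightarrow> \<mu> P = 1"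
    obtain \<eta> where \<eta>: "flat \<eta>" "fst \<eta> = 1" "snd \<eta> \<noteq> 0" "log_ord a \<eta> = 0" "log_ord b \<eta> = 0"
      "\<And>P. P \<notin> {a, b} \<Longrightarrow> log_ord P \<eta> = 1"
      by (rule flat_with_log_ord_1[OF ab(1)]) blast
    have "\<mu> P = real_of_int (log_ord P \<eta>) / real_of_int 1" for P
      using ab \<eta> by (cases "P \<in> {a, b}") auto
    then have "log_ord P \<omega> = fst \<omega> * log_ord P \<eta>" for P by (rule ord) simp
    then show ?thesis
      using form_eq_power[OF nz \<eta>(3), of "fst \<omega>"] \<eta>(1-3) that by (metis mult.right_neutral)
  next
    fix a b c
    assume abc: "distinct [a, b, c]" "\<mu> a = 1 / 2" "\<mu> b = 1 / 2" "\<mu> c = 0"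
      "\<forall>P. P \<notin> {a, b, c} \<longrightarrow> \<mu> P = 1"
    obtain \<eta> where \<eta>: "flat \<eta>" "fst \<eta> = 2" "snd \<eta> \<noteq> 0" "log_ord a \<eta> = 1" "log_ord b \<eta> = 1"
      "log_ord c \<eta> = 0" "\<And>P. P \<notin> {a, b, c} \<Longrightarrow> log_ord P \<eta> = 2"
      by (rule flat_with_log_ord_2[OF abc(1)]) blast
    \<comment> \<open>As \<open>\<mu> a = 1 / 2\<close>, this log order is half the weight; in
      particular the weight of \<open>\<omega>\<close> is even.\<close>
    define n where "n = log_ord a \<omega>"
    have "2 * real_of_int n = real_of_int (fst \<omega>)" using abc(2) \<nu> by (simp add: \<mu>_def n_def field_simps)
    then have n: "fst \<omega> = n * 2" by linarith
    have "\<mu> P = real_of_int (log_ord P \<eta>) / real_of_int 2" for P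
      using abc \<eta> by (cases "P \<in> {a, b, c}") auto
    then have "log_ord P \<omega> = n * log_ord P \<eta>" for P using n by (rule ord)
    then show ?thesis
      using form_eq_power[OF nz \<eta>(3), of n] \<eta>(1-3) n that by metis
  qed
qed

section \<open>Base change to the algebraic closure\<close>

abbreviation poly_bc :: "'a::field poly \<Rightarrow> 'a alg_closure poly" where
  "poly_bc \<equiv> map_poly to_ac"

lemma coeff_poly_bc [simp]: "Polynomial.coeff (poly_bc p) n = to_ac (Polynomial.coeff p n)"
  by (simp add: coeff_map_poly)

lemma poly_bc_simps [simp]:
  "poly_bc (p + q) = poly_bc p + poly_bc q"
  "poly_bc (p - q) = poly_bc p - poly_bc q"
  "poly_bc (p * q) = poly_bc p * poly_bc q"
  "poly_bc (Polynomial.smult c p) = Polynomial.smult (to_ac c) (poly_bc p)"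
  "poly_bc (pderiv p) = pderiv (poly_bc p)"
  "poly_bc (pCons c p) = pCons (to_ac c) (poly_bc p)"
  "poly_bc p = poly_bc q \<longleftrightarrow> p = q"
  by (auto simp: poly_eq_iff coeff_mult to_ac_sum coeff_pderiv map_poly_pCons)

lemma poly_bc_eq_0_iff [simp]: "poly_bc p = 0 \<longleftrightarrow> p = 0"
  using poly_bc_simps(7)[of p 0] by simp

lemma poly_bc_eq_1_iff [simp]: "poly_bc p = 1 \<longleftrightarrow> p = 1"
  using poly_bc_simps(7)[of p 1] by simp

lemma degree_poly_bc [simp]: "Polynomial.degree (poly_bc p) = Polynomial.degree p"
  by (rule degree_map_poly) simp

lemma poly_bc_power [simp]: "poly_bc (p ^ n) = poly_bc p ^ n"
  by (induction n) auto

lemma coprime_poly_bc: "coprime p q \<Longrightarrow> coprime (poly_bc p) (poly_bc q)"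
proof -
  assume "coprime p q"
  then obtain u v where "u * p + v * q = 1" using coprime_poly_bezout by blast
  then have "poly_bc (u * p + v * q) = 1" by simp
  then show ?thesis by (intro coprime_polyI_bezout) simp
qed

lemma rf_base_change_Fract:
  assumes "q \<noteq> 0"
  shows "rf_base_change (Fract p q) = Fract (poly_bc p) (poly_bc q)"
proof -
  let ?f = "Fract p q"
  have "Fract (rf_num ?f) (rf_den ?f) = Fract p q" by (rule Fract_rf_num_den)
  then have "rf_num ?f * q = p * rf_den ?f" using assms by (simp add: eq_fract)
  then have "poly_bc (rf_num ?f * q) = poly_bc (p * rf_den ?f)" by simp
  then show ?thesis using assms by (simp add: rf_base_change_def eq_fract)
qed

text \<open>A Bezout identity and a leading coefficient 1 survive the field extension, so reduced
  fractions stay reduced. Degree, composition and derivative are read off from them and therefore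
  commute with base change.\<close>

lemma rf_num_den_base_change [simp]:
  "rf_num (rf_base_change f) = poly_bc (rf_num f)"
  "rf_den (rf_base_change f) = poly_bc (rf_den f)"
  using rf_num_den_Fract[OF coprime_poly_bc[OF coprime_rf_num_den[of f]]]
  by (simp_all add: rf_base_change_def)

lemma rf_base_change_simps [simp]:
  fixes f g :: "'a::field ratfun"
  shows "rf_base_change (f * g) = rf_base_change f * rf_base_change g"
    and "rf_base_change (f + g) = rf_base_change f + rf_base_change g"
    and "rf_base_change (inverse f) = inverse (rf_base_change f)"
    and "rf_base_change (rf_const c) = rf_const (to_ac c)"
    and "rf_base_change rf_X = rf_X"
    and rf_base_change_eq_iff: "rf_base_change f = rf_base_change g \<longleftrightarrow> f = g"
proof -
  obtain p q where f: "f = Fract p q" "q \<noteq> 0" by (cases f) auto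
  obtain r s where g: "g = Fract r s" "s \<noteq> 0" by (cases g) auto
  show "rf_base_change (f * g) = rf_base_change f * rf_base_change g"
    "rf_base_change (f + g) = rf_base_change f + rf_base_change g"
    using f g by (simp_all add: rf_base_change_Fract)
  show "rf_base_change f = rf_base_change g \<longleftrightarrow> f = g"
    using Fract_rf_num_den[of f] Fract_rf_num_den[of g]
    by (metis poly_bc_simps(7) rf_num_den_base_change)
  show "rf_base_change (rf_const c) = rf_const (to_ac c)" "rf_base_change rf_X = rf_X"
    by (simp_all add: rf_const_eq_Fract rf_X_eq_Fract rf_base_change_Fract)
  show "rf_base_change (inverse f) = inverse (rf_base_change f)"
  proof (cases "p = 0")
    case True
    then have "inverse f = f" using f by (simp add: fract_collapse)
    moreover have "rf_base_change f = 0"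
      unfolding f(1) rf_base_change_Fract[OF f(2)] by (simp add: True fract_collapse)
    ultimately show ?thesis by simp
  next
    case False
    then show ?thesis using f by (simp add: rf_base_change_Fract)
  qed
qed

lemma rf_base_change_0 [simp]: "rf_base_change 0 = 0"
  using rf_base_change_simps(4)[of 0] by simp

lemma rf_base_change_1 [simp]: "rf_base_change 1 = 1"
  using rf_base_change_simps(4)[of 1] by simp

lemma rf_base_change_eq_0_iff [simp]: "rf_base_change f = 0 \<longleftrightarrow> f = 0"
  using rf_base_change_eq_iff[of f 0] by simp

lemma rf_base_change_divide [simp]:
  "rf_base_change (f / g) = rf_base_change f / rf_base_change g"
  by (simp add: divide_inverse)

lemma rf_base_change_power [simp]: "rf_base_change (f ^ n) = rf_base_change f ^ n"
  by (induction n) auto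

lemma rf_base_change_powi [simp]: "rf_base_change (f powi n) = rf_base_change f powi n"
  by (simp add: power_int_def)

text \<open>The reduced numerator of \<open>f\<close> exhibits the constant as an element of k. This
  brings the multiplier of a semi-invariant form down to k.\<close>

lemma rf_base_change_eq_constE:
  assumes "rf_base_change f = rf_const c"
  obtains c0 where "f = rf_const c0" "c = to_ac c0"
proof -
  have c: "rf_num (rf_const c) = [:c:]" "rf_den (rf_const c) = 1"
    using rf_num_den_Fract[of "[:c:]" 1] by (simp_all add: rf_const_eq_Fract)
  have "poly_bc (rf_num f) = [:c:]" "poly_bc (rf_den f) = 1"
    using c by (simp_all flip: assms)
  moreover from this have "Polynomial.degree (rf_num f) = 0"
    by (metis degree_pCons_0 degree_poly_bc)
  then obtain c0 where "rf_num f = [:c0:]" by (rule degree_eq_zeroE)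
  ultimately show ?thesis
    using that[of c0] Fract_rf_num_den[of f] by (simp add: rf_const_eq_Fract)
qed

lemma pline_morphism_base_change [simp]:
  "pline_morphism (rf_base_change f) \<longleftrightarrow> pline_morphism f"
proof -
  have "rf_base_change f \<in> range rf_const \<longleftrightarrow> f \<in> range rf_const"
  proof
    assume "rf_base_change f \<in> range rf_const"
    then obtain c where "rf_base_change f = rf_const c" by auto
    then show "f \<in> range rf_const" by (rule rf_base_change_eq_constE) auto
  qed auto
  then show ?thesis by (simp add: pline_morphism_def)
qed

lemma morphism_degree_base_change [simp]:
  "morphism_degree (rf_base_change f) = morphism_degree f"
  by (simp add: morphism_degree_def)

lemma rf_base_change_eval: "rf_base_change (rf_eval p g) = rf_eval (poly_bc p) (rf_base_change g)"
  by (induction p) auto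

lemma rf_base_change_compose:
  "rf_base_change (rf_compose f g) = rf_compose (rf_base_change f) (rf_base_change g)"
  by (simp add: rf_compose_rf_eval rf_base_change_eval)

lemma rf_base_change_deriv: "rf_base_change (rf_deriv f) = rf_deriv (rf_base_change f)"
  by (simp add: rf_deriv_def Let_def rf_base_change_Fract)

lemma fst_form_base_change [simp]: "fst (form_base_change \<omega>) = fst \<omega>"
  by (simp add: form_base_change_def)

lemma snd_form_base_change [simp]: "snd (form_base_change \<omega>) = rf_base_change (snd \<omega>)"
  by (simp add: form_base_change_def)

lemma form_base_change_pullback:
  "form_base_change (form_pullback \<sigma> \<omega>) = form_pullback (rf_base_change \<sigma>) (form_base_change \<omega>)"
  by (simp add: form_base_change_def form_pullback_def rf_base_change_compose rf_base_change_deriv)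

lemma tame_base_change:
  fixes \<sigma> :: "'a::field ratfun"
  assumes "pline_morphism \<sigma>" "tamely_ramified \<sigma>"
  shows "tame (rf_base_change \<sigma>)"
  unfolding tame_def
proof
  fix Q
  let ?e = "ram_index (rf_base_change \<sigma>) Q"
  have "?e > 0" using assms(1) by (simp add: ram_index_pos)
  moreover have "CHAR('a) \<noteq> 0 \<Longrightarrow> \<not> CHAR('a) dvd ?e"
  proof
    assume c: "CHAR('a) \<noteq> 0" "CHAR('a) dvd ?e"
    have "coprime ?e CHAR('a)" using assms(2) c(1) by (simp add: tamely_ramified_def)
    then have "CHAR('a) = 1" using c(2) by (metis coprime_absorb_right nat_dvd_1_iff_1)
    then show False by (metis of_nat_CHAR of_nat_1 zero_neq_one)
  qed
  ultimately show "of_nat ?e \<noteq> (0 :: 'a alg_closure)"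
    by (cases "CHAR('a) = 0") (auto simp: of_nat_eq_0_iff_char_dvd)
qed

text \<open>The uniformizer at the final image is pulled back in two steps, each multiplying its
  order by an index. The positive order at \<open>Q\<close> also identifies the image of
  \<open>Q\<close> under the composition.\<close>

lemma ram_index_compose:
  fixes f g :: "'a::alg_closed_field ratfun"
  assumes f: "pline_morphism f" and g: "pline_morphism g"
  shows morphism_app_compose: "morphism_app (rf_compose f g) Q = morphism_app f (morphism_app g Q)"
    and "ram_index (rf_compose f g) Q = ram_index f (morphism_app g Q) * ram_index g Q"
proof -
  let ?P = "morphism_app f (morphism_app g Q)"
  let ?u = "rf_compose (uniformizer ?P) f"
  let ?e = "ram_index f (morphism_app g Q)"
  have u: "max 0 (rf_ord (morphism_app g Q) ?u) = int ?e"
    by (simp add: rf_ord_pullback_uniformizer[OF f])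
  then have u': "rf_ord (morphism_app g Q) ?u = int ?e"
    using ram_index_pos[OF f, of "morphism_app g Q"] by linarith
  have "uniformizer ?P \<noteq> 0" by (cases ?P) (auto simp: uniformizer_def)
  then have "?u \<noteq> 0" by (simp add: rf_compose_eq_0_iff f)
  then have "rf_ord Q (rf_compose ?u g) = int (?e * ram_index g Q)"
    by (simp add: rf_ord_compose[OF g] u')
  then have "rf_ord Q (rf_compose (uniformizer ?P) (rf_compose f g)) = int (?e * ram_index g Q)"
    by (simp add: rf_compose_assoc[OF g])
  then have "int (?e * ram_index g Q) = (if morphism_app (rf_compose f g) Q = ?P
      then int (ram_index (rf_compose f g) Q) else 0)"
    using rf_ord_pullback_uniformizer[OF pline_morphism_compose[OF f g], of Q ?P] by simp
  moreover have "?e * ram_index g Q > 0" using ram_index_pos[OF f] ram_index_pos[OF g] by simp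
  ultimately show "morphism_app (rf_compose f g) Q = ?P"
    and "ram_index (rf_compose f g) Q = ?e * ram_index g Q"
    by (auto split: if_splits simp flip: of_nat_mult)
qed

lemma morphism_app_rf_X: "morphism_app rf_X Q = Q"
proof -
  have X: "rf_num rf_X = [:0, 1 :: 'a:]" "rf_den rf_X = (1 :: 'a poly)"
    using rf_num_den_Fract[of "[:0, 1::'a:]" 1] by (simp_all add: rf_X_eq_Fract)
  show ?thesis by (cases Q) (simp_all add: morphism_app_def X)
qed

text \<open>Since the indices in a fibre add up to the degree, total ramification at
  \<open>Q\<close> means that \<open>Q\<close> is alone in its fibre. Bijections of the points
  preserve this, so no degrees need to be compared.\<close>

lemma total_ramification_conjugate:
  fixes \<sigma> \<phi> \<psi> :: "'a::alg_closed_field ratfun"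
  assumes \<sigma>: "pline_morphism \<sigma>" and inv: "inverse_morphisms \<phi> \<psi>"
  defines "\<sigma>' \<equiv> rf_compose \<phi> (rf_compose \<sigma> \<psi>)"
  assumes total: "ram_index \<sigma>' Q = morphism_degree \<sigma>'"
  shows "ram_index \<sigma> (morphism_app \<psi> Q) = morphism_degree \<sigma>"
proof -
  have m: "pline_morphism \<phi>" "pline_morphism \<psi>" and i: "rf_compose \<phi> \<psi> = rf_X" "rf_compose \<psi> \<phi> = rf_X"
    using inv by (auto simp: inverse_morphisms_def)
  have \<sigma>': "pline_morphism \<sigma>'" using m \<sigma> by (simp add: \<sigma>'_def pline_morphism_compose)
  have app: "morphism_app \<sigma>' R = morphism_app \<phi> (morphism_app \<sigma> (morphism_app \<psi> R))" for R
    using m \<sigma> by (simp add: \<sigma>'_def morphism_app_compose pline_morphism_compose)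
  have \<psi>\<phi>: "morphism_app \<psi> (morphism_app \<phi> R) = R" for R
    using morphism_app_compose[OF m(2,1), of R] by (simp add: i morphism_app_rf_X)
  have \<phi>\<psi>: "morphism_app \<phi> (morphism_app \<psi> R) = R" for R
    using morphism_app_compose[OF m, of R] by (simp add: i morphism_app_rf_X)
  let ?F = "{R. morphism_app \<sigma>' R = morphism_app \<sigma>' Q}"
  have single: "R = Q" if "R \<in> ?F" for R
  proof (rule ccontr)
    assume "R \<noteq> Q"
    then have "(\<Sum>R\<in>{Q, R}. ram_index \<sigma>' R) \<le> (\<Sum>R\<in>?F. ram_index \<sigma>' R)"
      using that sum_ram_index(1)[OF \<sigma>'] by (intro sum_mono2) auto
    then show False
      using \<open>R \<noteq> Q\<close> total sum_ram_index(2)[OF \<sigma>'] ram_index_pos[OF \<sigma>', of R] by simp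
  qed
  have "{R. morphism_app \<sigma> R = morphism_app \<sigma> (morphism_app \<psi> Q)} = {morphism_app \<psi> Q}"
  proof (intro equalityI subsetI)
    fix R assume "R \<in> {R. morphism_app \<sigma> R = morphism_app \<sigma> (morphism_app \<psi> Q)}"
    then have "morphism_app \<phi> R \<in> ?F" by (simp add: app \<psi>\<phi>)
    then have "morphism_app \<phi> R = Q" by (rule single)
    then show "R \<in> {morphism_app \<psi> Q}" using \<psi>\<phi>[of R] by simp
  qed auto
  then show ?thesis
    using sum_ram_index(2)[OF \<sigma>, of "morphism_app \<sigma> (morphism_app \<psi> Q)"] by simp
qed

section \<open>Descent of roots\<close>

lemma surj_to_ac:
  assumes "alg_closed_field_type TYPE('a::field)"
  shows "surj (to_ac :: 'a \<Rightarrow> 'a alg_closure)"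
proof (rule surjI[of _ of_ac], rule to_ac_of_ac)
  fix x :: "'a alg_closure"
  obtain p :: "'a poly" where "p \<noteq> 0" "poly (poly_bc p) x = 0" by (rule alg_closure_algebraic)
  then show "x \<in> range to_ac"
  proof (induction "Polynomial.degree p" arbitrary: p rule: less_induct)
    case (less p)
    have "Polynomial.degree p > 0"
    proof (rule ccontr)
      assume "\<not> ?thesis"
      then obtain c where "p = [:c:]" by (metis degree_eq_zeroE gr0I)
      then show False using less.prems by simp
    qed
    then obtain a where "poly p a = 0" using assms by (auto simp: alg_closed_field_type_def)
    then obtain q where q: "p = [:- a, 1:] * q" by (auto simp: poly_eq_0_iff_dvd elim: dvdE)
    then have "q \<noteq> 0" using less.prems by auto
    then have deg: "Polynomial.degree p = Suc (Polynomial.degree q)"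
      unfolding q by (subst degree_mult_eq) auto
    have "poly (poly_bc [:- a, 1:]) x * poly (poly_bc q) x = 0"
      using less.prems(2) unfolding q poly_bc_simps(3) by (simp only: poly_mult)
    then have "x = to_ac a \<or> poly (poly_bc q) x = 0" by simp
    then show ?case using less.hyps[of q] deg \<open>q \<noteq> 0\<close> by auto
  qed
qed

text \<open>The coefficients of \<open>r\<close> are determined from the top by those of \<open>r ^ n\<close>: if \<open>A\<close> agrees with
  \<open>r\<close> in the coefficients above the \<open>j\<close>-th, the leading coefficient of \<open>r ^ n - A ^ n\<close> is \<open>n\<close>
  times the \<open>j\<close>-th coefficient of \<open>r - A\<close>.\<close>

lemma root_poly_descends:
  fixes p :: "'a::field poly" and r :: "'a alg_closure poly"
  assumes rp: "r ^ n = poly_bc p" and monic: "lead_coeff r = 1" and n: "of_nat n \<noteq> (0 :: 'a)"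
  shows "r \<in> range poly_bc"
proof (rule ccontr)
  assume not: "r \<notin> range poly_bc"
  let ?d = "Polynomial.degree r"
  define S where "S = {A :: 'a poly. Polynomial.degree A = ?d \<and> lead_coeff A = 1}"
  have "monom 1 ?d \<in> S" by (simp add: S_def degree_monom_eq)
  then obtain A where A: "A \<in> S"
    and min: "\<And>A'. A' \<in> S \<Longrightarrow> Polynomial.degree (r - poly_bc A) \<le> Polynomial.degree (r - poly_bc A')"
    using ex_has_least_nat[of "\<lambda>A. A \<in> S" _ "\<lambda>A. Polynomial.degree (r - poly_bc A)"] by blast
  let ?A = "poly_bc A"
  define B where "B = r - ?A"
  define j where "j = Polynomial.degree B"
  have "lead_coeff ?A = to_ac (lead_coeff A)" by simp
  also have "lead_coeff A = 1" using A unfolding S_def by blast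
  finally have degA: "Polynomial.degree ?A = ?d" "lead_coeff ?A = 1" using A by (simp_all add: S_def)
  have B0: "B \<noteq> 0" using not by (auto simp: B_def)
  have j: "j < ?d"
  proof (rule ccontr)
    assume "\<not> j < ?d"
    moreover have "j \<le> ?d" unfolding j_def B_def using degA(1) by (intro degree_diff_le) simp_all
    ultimately have "j = ?d" by simp
    then have "lead_coeff B = 0" using degA monic by (simp add: j_def B_def)
    then show False using B0 by simp
  qed
  \<comment> \<open>The cofactor of \<open>r - ?A\<close> in \<open>r ^ n - ?A ^ n\<close>: its
    \<open>n\<close> summands are monic of the same degree, so its leading coefficient is
    \<open>n\<close>, which is nonzero in the field.\<close>
  define T where "T = (\<Sum>i<n. ?A ^ (n - Suc i) * r ^ i)"
  have fac: "r ^ n - ?A ^ n = B * T" unfolding B_def T_def by (rule power_diff_sumr2)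
  have nz: "r \<noteq> 0" "?A \<noteq> 0" using monic degA(2) by auto
  have summand: "Polynomial.degree (?A ^ (n - Suc i) * r ^ i) = (n - 1) * ?d"
    "lead_coeff (?A ^ (n - Suc i) * r ^ i) = 1" if "i < n" for i
  proof -
    have "Polynomial.degree (?A ^ (n - Suc i) * r ^ i) = (n - Suc i) * ?d + i * ?d"
      using nz degA by (simp add: degree_mult_eq degree_power_eq)
    also have "\<dots> = (n - 1) * ?d" using that by (simp flip: distrib_right)
    finally show "Polynomial.degree (?A ^ (n - Suc i) * r ^ i) = (n - 1) * ?d" .
    show "lead_coeff (?A ^ (n - Suc i) * r ^ i) = 1"
      unfolding lead_coeff_mult lead_coeff_power using degA(2) monic by simp
  qed
  have coeffT: "Polynomial.coeff T ((n - 1) * ?d) = of_nat n"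
  proof -
    have "Polynomial.coeff T ((n - 1) * ?d)
        = (\<Sum>i<n. Polynomial.coeff (?A ^ (n - Suc i) * r ^ i) ((n - 1) * ?d))"
      by (simp add: T_def coeff_sum)
    also have "\<dots> = (\<Sum>i<n. 1)" by (rule sum.cong[OF refl]) (metis summand lessThan_iff)
    finally show ?thesis by simp
  qed
  have "of_nat n \<noteq> (0 :: 'a alg_closure)" using n by (metis to_ac_eq_0_iff to_ac_of_nat)
  then have "Polynomial.degree T \<ge> (n - 1) * ?d" using coeffT by (intro le_degree) simp
  moreover have "Polynomial.degree T \<le> (n - 1) * ?d"
    unfolding T_def by (rule degree_sum_le) (use summand in auto)
  ultimately have degT: "Polynomial.degree T = (n - 1) * ?d" by simp
  have "Polynomial.coeff (B * T) (j + (n - 1) * ?d) = lead_coeff B * of_nat n"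
    using coeff_mult_degree_sum[of B T] coeffT by (simp add: j_def degT)
  moreover have "B * T = poly_bc (p - A ^ n)" using fac rp by simp
  ultimately have "lead_coeff B * of_nat n
      = to_ac (Polynomial.coeff (p - A ^ n) (j + (n - 1) * ?d))" by (metis coeff_poly_bc)
  then have "lead_coeff B = to_ac (Polynomial.coeff (p - A ^ n) (j + (n - 1) * ?d) / of_nat n)"
    using \<open>of_nat n \<noteq> (0 :: 'a alg_closure)\<close> by (simp add: field_simps)
  then obtain \<beta> where \<beta>: "lead_coeff B = to_ac \<beta>" by blast
  \<comment> \<open>Adding the recovered term to \<open>A\<close> cancels the leading term of
    \<open>B\<close>. By minimality the degree cannot drop, so nothing is left of
    \<open>B\<close>.\<close>
  define A' where "A' = A + monom \<beta> j"
  have degM: "Polynomial.degree (monom \<beta> j) < Polynomial.degree A"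
    using j A degree_monom_le[of \<beta> j] by (simp add: S_def)
  then have "Polynomial.degree A' = Polynomial.degree A"
    unfolding A'_def by (rule degree_add_eq_left)
  then have "A' \<in> S" using A j by (auto simp: S_def A'_def)
  have B': "r - poly_bc A' = B - monom (to_ac \<beta>) j"
    by (simp add: A'_def B_def map_poly_monom)
  have "Polynomial.degree B \<le> Polynomial.degree (B - monom (to_ac \<beta>) j)"
    using min[OF \<open>A' \<in> S\<close>] unfolding B' unfolding B_def .
  moreover have "Polynomial.coeff (B - monom (to_ac \<beta>) j) k = 0" if "k \<ge> j" for k
    using that \<beta> by (cases "k = j") (auto simp: j_def coeff_eq_0)
  ultimately have "B - monom (to_ac \<beta>) j = 0" by (metis j_def leading_coeff_0_iff)
  then have "r = poly_bc A'" using B' by simp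
  then show False using not by blast
qed

text \<open>Either \<open>n\<close> is invertible because the characteristic is 0, or the closure
  adds nothing to k.\<close>

lemma monic_root_descends:
  fixes p :: "'a::field poly" and r :: "'a alg_closure poly"
  assumes "surj (to_ac :: 'a \<Rightarrow> 'a alg_closure) \<or> CHAR('a) = 0"
    and rp: "r ^ n = poly_bc p" and monic: "lead_coeff r = 1" and n: "n > 0"
  shows "r \<in> range poly_bc"
  using assms(1)
proof
  assume "CHAR('a) = 0"
  then have "of_nat n \<noteq> (0 :: 'a)" using n by (simp add: of_nat_eq_0_iff_char_dvd)
  then show ?thesis using rp monic by (intro root_poly_descends)
next
  assume "surj (to_ac :: 'a \<Rightarrow> 'a alg_closure)"
  then have "to_ac (of_ac x :: 'a) = x" for x by (simp add: to_ac_of_ac)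
  then have "r = poly_bc (map_poly of_ac r)" by (simp add: poly_eq_iff coeff_map_poly)
  then show ?thesis by blast
qed

text \<open>Numerator and denominator descend separately as monic roots. The leading coefficient of
  the numerator only has its \<open>n\<close>-th power under control, up to \<open>c\<close>, and
  need not lie in k; it is split off as \<open>\<gamma>\<close>.\<close>

lemma root_ratfun_descends:
  fixes f :: "'a::field ratfun" and g :: "'a alg_closure ratfun"
  assumes k: "surj (to_ac :: 'a \<Rightarrow> 'a alg_closure) \<or> CHAR('a) = 0"
    and eq: "rf_base_change f = rf_const c * g ^ n" and nz: "c \<noteq> 0" "g \<noteq> 0" and n: "n > 0"
  obtains \<gamma> g0 where "\<gamma> \<noteq> 0" "g = rf_const \<gamma> * rf_base_change g0"
proof -
  let ?p = "rf_num g" and ?q = "rf_den g"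
  define \<gamma> where "\<gamma> = lead_coeff ?p"
  define h where "h = Polynomial.smult (inverse \<gamma>) ?p"
  have \<gamma>: "\<gamma> \<noteq> 0" using nz by (simp add: \<gamma>_def)
  then have h: "lead_coeff h = 1" "?p = Polynomial.smult \<gamma> h" by (simp_all add: h_def \<gamma>_def)
  have pow: "g ^ m = Fract (?p ^ m) (?q ^ m)" for m
  proof (induction m)
    case (Suc m)
    then show ?case by (metis Fract_rf_num_den mult_fract power_Suc)
  qed (simp add: One_fract_def)
  have eq': "rf_base_change f = Fract (Polynomial.smult c (?p ^ n)) (?q ^ n)"
    unfolding eq pow rf_const_eq_Fract by simp
  have "coprime (?p ^ n) (?q ^ n)" using coprime_rf_num_den[of g] by simp
  then have "coprime (Polynomial.smult c (?p ^ n)) (?q ^ n)"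
    using nz(1) by (simp add: coprime_def dvd_smult_iff)
  moreover have "lead_coeff (?q ^ n) = 1" by (simp add: lead_coeff_power)
  ultimately have num: "poly_bc (rf_num f) = Polynomial.smult c (?p ^ n)"
    and den: "poly_bc (rf_den f) = ?q ^ n"
    unfolding rf_num_den_base_change[symmetric] eq' by (simp_all only: rf_num_den_Fract)
  have "?q \<in> range poly_bc"
    using monic_root_descends[OF k den[symmetric] _ n] by simp
  then obtain q0 where q0: "?q = poly_bc q0" by blast
  have num': "poly_bc (rf_num f) = Polynomial.smult (c * \<gamma> ^ n) (h ^ n)"
    unfolding num h(2) by (simp add: smult_power)
  have lc: "to_ac (lead_coeff (rf_num f)) = c * \<gamma> ^ n"
  proof -
    have "lead_coeff (poly_bc (rf_num f)) = c * \<gamma> ^ n"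
      unfolding num' lead_coeff_smult lead_coeff_power h(1) by simp
    then show ?thesis by simp
  qed
  have "h ^ n = poly_bc (Polynomial.smult (inverse (lead_coeff (rf_num f))) (rf_num f))"
  proof -
    have "inverse (c * \<gamma> ^ n) * (c * \<gamma> ^ n) = 1" by (rule left_inverse) (use nz \<gamma> in simp)
    then show ?thesis
      unfolding poly_bc_simps to_ac_inverse lc num' smult_smult by (simp only: smult_1_left)
  qed
  then have "h \<in> range poly_bc" using monic_root_descends[OF k _ h(1) n] by blast
  then obtain p0 where p0: "h = poly_bc p0" by blast
  have "q0 \<noteq> 0" using q0 rf_den_nonzero[of g] by auto
  then have "rf_base_change (Fract p0 q0) = Fract h ?q" by (simp add: rf_base_change_Fract p0 q0)
  then have "g = rf_const \<gamma> * rf_base_change (Fract p0 q0)"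
    using Fract_rf_num_den[of g] h(2) by (simp add: rf_const_eq_Fract)
  then show ?thesis using that \<gamma> by blast
qed

section \<open>The group of semi-invariant forms\<close>

lemma carrier_form_group [simp]: "\<omega> \<in> carrier form_group \<longleftrightarrow> snd \<omega> \<noteq> 0"
  by (simp add: form_group_def)

lemma mult_form_group [simp]: "\<omega> \<otimes>\<^bsub>form_group\<^esub> \<eta> = (fst \<omega> + fst \<eta>, snd \<omega> * snd \<eta>)"
  by (simp add: form_group_def)

lemma one_form_group [simp]: "\<one>\<^bsub>form_group\<^esub> = (0, 1)"
  by (simp add: form_group_def)

lemma inv_form_group:
  fixes \<omega> :: "'a::field form"
  assumes "snd \<omega> \<noteq> 0"
  shows "inv\<^bsub>form_group\<^esub> \<omega> = (- fst \<omega>, inverse (snd \<omega>))"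
proof -
  interpret comm_group "form_group :: 'a form monoid" by (rule comm_group_form_group)
  show ?thesis by (rule inv_equality) (use assms in auto)
qed

lemma form_class_eq: "form_class \<omega> = {(fst \<omega>, rf_const c * snd \<omega>) | c. c \<noteq> 0}"
  by (auto simp: form_class_def const_forms_def r_coset_def)

lemma form_class_eqI:
  assumes "fst \<omega> = fst \<eta>" "snd \<omega> = rf_const c * snd \<eta>" "c \<noteq> 0"
  shows "form_class \<omega> = form_class \<eta>"
proof -
  have "\<exists>b. rf_const a * snd \<omega> = rf_const b * snd \<eta> \<and> b \<noteq> 0" if "a \<noteq> 0" for a
    using assms that by (intro exI[of _ "a * c"]) simp
  moreover have "\<exists>b. rf_const a * snd \<eta> = rf_const b * snd \<omega> \<and> b \<noteq> 0" if "a \<noteq> 0" for a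
    using assms that by (intro exI[of _ "a / c"]) simp
  ultimately show ?thesis using assms(1) by (auto simp: form_class_eq)
qed

lemma fst_form_pullback [simp]: "fst (form_pullback \<sigma> \<omega>) = fst \<omega>"
  by (simp add: form_pullback_def)

lemma semi_invariant_iff:
  "semi_invariant \<sigma>1 \<sigma>2 \<omega> \<longleftrightarrow> snd \<omega> \<noteq> 0 \<and>
    (\<exists>c. c \<noteq> 0 \<and> snd (form_pullback \<sigma>1 \<omega>) = rf_const c * snd (form_pullback \<sigma>2 \<omega>))"
  by (auto simp: semi_invariant_def form_smult_def prod_eq_iff)

lemma snd_form_pullback_nonzero:
  fixes \<sigma> :: "'a::alg_closed_field ratfun"
  assumes "pline_morphism \<sigma>" "tame \<sigma>" "snd \<omega> \<noteq> 0"
  shows "snd (form_pullback \<sigma> \<omega>) \<noteq> 0"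
  using assms rf_ord_deriv(1)[OF assms(1)]
  by (simp add: form_pullback_def rf_compose_eq_0_iff tame_def)

lemma snd_form_pullback_const_mult_powi:
  fixes \<sigma> :: "'a::alg_closed_field ratfun"
  assumes "pline_morphism \<sigma>" "fst \<omega> = n * fst \<eta>" "snd \<omega> = rf_const c * snd \<eta> powi n"
  shows "snd (form_pullback \<sigma> \<omega>) = rf_const c * snd (form_pullback \<sigma> \<eta>) powi n"
  using assms
  by (simp add: form_pullback_def rf_compose_mult rf_compose_const rf_compose_powi
      power_int_mult_distrib power_int_mult mult.commute[of n])

lemma powi_const_imp_const:
  fixes x :: "'a::alg_closed_field ratfun"
  assumes "x powi n = rf_const c" "c \<noteq> 0" "n \<noteq> 0"
  obtains d where "d \<noteq> 0" "x = rf_const d"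
proof -
  have "x \<noteq> 0" using assms by (auto simp: power_int_0_left_if)
  moreover have "rf_ord P x = 0" for P
    using rf_ord_powi[OF \<open>x \<noteq> 0\<close>, of P n] assms by simp
  ultimately show ?thesis using rf_const_if_no_zeros_poles that by metis
qed

text \<open>The quotient of the two pullbacks of \<open>\<eta>\<close> has a constant
  \<open>n\<close>-th power. It has no zeros or poles and is itself constant.\<close>

lemma semi_invariant_root:
  fixes \<sigma>1 \<sigma>2 :: "'a::alg_closed_field ratfun"
  assumes \<sigma>1: "pline_morphism \<sigma>1" "tame \<sigma>1" and \<sigma>2: "pline_morphism \<sigma>2" "tame \<sigma>2"
    and inv: "semi_invariant \<sigma>1 \<sigma>2 \<omega>" and \<eta>: "snd \<eta> \<noteq> 0"
    and eq: "fst \<omega> = n * fst \<eta>" "snd \<omega> = rf_const c * snd \<eta> powi n" and n: "n \<noteq> 0" "c \<noteq> 0"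
  shows "semi_invariant \<sigma>1 \<sigma>2 \<eta>"
proof -
  let ?x = "snd (form_pullback \<sigma>1 \<eta>)" and ?y = "snd (form_pullback \<sigma>2 \<eta>)"
  have y: "?y \<noteq> 0" by (rule snd_form_pullback_nonzero[OF \<sigma>2 \<eta>])
  obtain d where d: "d \<noteq> 0" "snd (form_pullback \<sigma>1 \<omega>) = rf_const d * snd (form_pullback \<sigma>2 \<omega>)"
    using inv by (auto simp: semi_invariant_iff)
  then have "rf_const c * ?x powi n = rf_const d * (rf_const c * ?y powi n)"
    by (simp only: snd_form_pullback_const_mult_powi[OF \<sigma>1(1) eq]
        snd_form_pullback_const_mult_powi[OF \<sigma>2(1) eq])
  then have "?x powi n = rf_const d * ?y powi n" using n by simp
  then have "(?x / ?y) powi n = rf_const d" using y by (simp add: power_int_divide_distrib)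
  then obtain e where "e \<noteq> 0" "?x / ?y = rf_const e" using powi_const_imp_const d(1) n(1) by metis
  then show ?thesis using y \<eta> by (auto simp: semi_invariant_iff field_simps)
qed

text \<open>A multiplier over the closure is the quotient of two functions over k, hence lies in k.
  Questions about semi-invariance can thus be settled over the closure, where composition respects
  the field operations.\<close>

lemma semi_invariant_base_change:
  fixes \<sigma>1 \<sigma>2 :: "'a::field ratfun"
  assumes \<sigma>1: "pline_morphism \<sigma>1" "tamely_ramified \<sigma>1"
    and \<sigma>2: "pline_morphism \<sigma>2" "tamely_ramified \<sigma>2"
  shows "semi_invariant (rf_base_change \<sigma>1) (rf_base_change \<sigma>2) (form_base_change \<omega>)
    \<longleftrightarrow> semi_invariant \<sigma>1 \<sigma>2 \<omega>"
proof (cases "snd \<omega> = 0")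
  case False
  let ?x = "snd (form_pullback \<sigma>1 \<omega>)" and ?y = "snd (form_pullback \<sigma>2 \<omega>)"
  have pb: "snd (form_pullback (rf_base_change \<sigma>) (form_base_change \<omega>))
      = rf_base_change (snd (form_pullback \<sigma> \<omega>))" for \<sigma>
    by (simp flip: form_base_change_pullback)
  have "rf_base_change ?y \<noteq> 0"
    unfolding pb[symmetric] using False \<sigma>2
    by (intro snd_form_pullback_nonzero) (simp_all add: tame_base_change)
  then have y: "?y \<noteq> 0" by simp
  have "(\<exists>c. c \<noteq> 0 \<and> rf_base_change ?x = rf_const c * rf_base_change ?y)
      \<longleftrightarrow> (\<exists>c. c \<noteq> 0 \<and> ?x = rf_const c * ?y)"
  proof
    assume "\<exists>c. c \<noteq> 0 \<and> rf_base_change ?x = rf_const c * rf_base_change ?y"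
    then obtain c where c: "c \<noteq> 0" "rf_base_change ?x = rf_const c * rf_base_change ?y" by blast
    then have "rf_base_change (?x / ?y) = rf_const c" using y by simp
    then obtain c0 where "?x / ?y = rf_const c0" "c = to_ac c0" by (rule rf_base_change_eq_constE)
    then show "\<exists>c. c \<noteq> 0 \<and> ?x = rf_const c * ?y"
      using c(1) y by (intro exI[of _ c0]) (auto simp: field_simps)
  next
    assume "\<exists>c. c \<noteq> 0 \<and> ?x = rf_const c * ?y"
    then obtain c where "c \<noteq> 0" "?x = rf_const c * ?y" by blast
    then show "\<exists>c. c \<noteq> 0 \<and> rf_base_change ?x = rf_const c * rf_base_change ?y"
      by (intro exI[of _ "to_ac c"]) simp
  qed
  then show ?thesis using False by (simp add: semi_invariant_iff pb)
qed (simp add: semi_invariant_iff)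

lemma semi_invariant_mult_inverse:
  fixes \<sigma>1 \<sigma>2 :: "'a::alg_closed_field ratfun"
  assumes \<sigma>1: "pline_morphism \<sigma>1" "tame \<sigma>1" and \<sigma>2: "pline_morphism \<sigma>2" "tame \<sigma>2"
    and \<omega>: "semi_invariant \<sigma>1 \<sigma>2 \<omega>" and \<eta>: "semi_invariant \<sigma>1 \<sigma>2 \<eta>"
  shows "semi_invariant \<sigma>1 \<sigma>2 (fst \<omega> + fst \<eta>, snd \<omega> * snd \<eta>)"
    and "semi_invariant \<sigma>1 \<sigma>2 (- fst \<omega>, inverse (snd \<omega>))"
proof -
  have mult: "snd (form_pullback \<sigma> (fst \<omega> + fst \<eta>, snd \<omega> * snd \<eta>))
      = snd (form_pullback \<sigma> \<omega>) * snd (form_pullback \<sigma> \<eta>)"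
    and inv: "snd (form_pullback \<sigma> (- fst \<omega>, inverse (snd \<omega>))) = inverse (snd (form_pullback \<sigma> \<omega>))"
    if "pline_morphism \<sigma>" "tame \<sigma>" for \<sigma>
    using that rf_ord_deriv(1)[OF that(1)]
    by (simp_all add: form_pullback_def rf_compose_mult rf_compose_inverse power_int_add tame_def
        power_int_minus)
  obtain c where c: "c \<noteq> 0" "snd (form_pullback \<sigma>1 \<omega>) = rf_const c * snd (form_pullback \<sigma>2 \<omega>)"
    using \<omega> by (auto simp: semi_invariant_iff)
  obtain d where d: "d \<noteq> 0" "snd (form_pullback \<sigma>1 \<eta>) = rf_const d * snd (form_pullback \<sigma>2 \<eta>)"
    using \<eta> by (auto simp: semi_invariant_iff)
  have nz: "snd \<omega> \<noteq> 0" "snd \<eta> \<noteq> 0" using \<omega> \<eta> by (simp_all add: semi_invariant_iff)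
  show "semi_invariant \<sigma>1 \<sigma>2 (fst \<omega> + fst \<eta>, snd \<omega> * snd \<eta>)"
    unfolding semi_invariant_iff mult[OF \<sigma>1] mult[OF \<sigma>2] using c d nz
    by (intro conjI exI[of _ "c * d"]) simp_all
  show "semi_invariant \<sigma>1 \<sigma>2 (- fst \<omega>, inverse (snd \<omega>))"
    unfolding semi_invariant_iff inv[OF \<sigma>1] inv[OF \<sigma>2] using c nz
    by (intro conjI exI[of _ "inverse c"]) simp_all
qed

text \<open>For a semi-invariant function the index times the absolute order at the image is the
  same for both maps. Summed over all points this gives the total absolute order multiplied by
  either degree; as the degrees differ, the total is 0.\<close>

lemma semi_invariant_weight_0:
  fixes \<sigma>1 \<sigma>2 :: "'a::alg_closed_field ratfun"
  assumes \<sigma>1: "pline_morphism \<sigma>1" "tame \<sigma>1" and \<sigma>2: "pline_morphism \<sigma>2" "tame \<sigma>2"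
    and deg: "morphism_degree \<sigma>1 \<noteq> morphism_degree \<sigma>2"
    and inv: "semi_invariant \<sigma>1 \<sigma>2 \<omega>" and wt: "fst \<omega> = 0"
  obtains c where "c \<noteq> 0" "snd \<omega> = rf_const c"
proof -
  let ?f = "snd \<omega>"
  \<comment> \<open>Absolute values are essential: the signed orders always add up to 0 and would
    carry no information.\<close>
  let ?m = "\<lambda>P. nat \<bar>rf_ord P ?f\<bar>"
  have nz: "?f \<noteq> 0" using inv by (simp add: semi_invariant_iff)
  obtain c where c: "c \<noteq> 0" "rf_compose ?f \<sigma>1 = rf_const c * rf_compose ?f \<sigma>2"
    using inv wt by (auto simp: semi_invariant_iff form_pullback_def)
  have eq: "int (ram_index \<sigma>1 Q) * rf_ord (morphism_app \<sigma>1 Q) ?f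
      = int (ram_index \<sigma>2 Q) * rf_ord (morphism_app \<sigma>2 Q) ?f" for Q
  proof -
    have "rf_ord Q (rf_compose ?f \<sigma>1) = rf_ord Q (rf_compose ?f \<sigma>2)"
      unfolding c(2) using c(1) nz by (simp add: rf_ord_mult rf_compose_eq_0_iff \<sigma>2)
    then show ?thesis by (simp add: rf_ord_compose \<sigma>1 \<sigma>2 nz)
  qed
  have m: "ram_index \<sigma>1 Q * ?m (morphism_app \<sigma>1 Q) = ram_index \<sigma>2 Q * ?m (morphism_app \<sigma>2 Q)" for Q
    using arg_cong[OF eq, of "\<lambda>x. nat \<bar>x\<bar>" Q] by (simp add: abs_mult nat_mult_distrib)
  define E where "E = {P. rf_ord P ?f \<noteq> 0}"
  have finE: "finite E" unfolding E_def by (rule finite_rf_ord_nonzero[OF nz])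
  have sum: "(\<Sum>Q | morphism_app \<sigma> Q \<in> E. ram_index \<sigma> Q * ?m (morphism_app \<sigma> Q))
      = morphism_degree \<sigma> * (\<Sum>P\<in>E. ?m P)" if \<sigma>: "pline_morphism \<sigma>" for \<sigma>
  proof -
    let ?A = "{Q. morphism_app \<sigma> Q \<in> E}"
    have "?A = (\<Union>P\<in>E. {Q. morphism_app \<sigma> Q = P})" by auto
    then have finA: "finite ?A" using finE sum_ram_index(1)[OF \<sigma>] by simp
    have "(\<Sum>Q\<in>?A. ram_index \<sigma> Q * ?m (morphism_app \<sigma> Q))
        = (\<Sum>P\<in>E. \<Sum>Q\<in>{Q\<in>?A. morphism_app \<sigma> Q = P}. ram_index \<sigma> Q * ?m (morphism_app \<sigma> Q))"
      by (rule sum.group[symmetric]) (use finA finE in auto)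
    also have "\<dots> = (\<Sum>P\<in>E. morphism_degree \<sigma> * ?m P)"
    proof (rule sum.cong[OF refl])
      fix P assume "P \<in> E"
      then have "{Q\<in>?A. morphism_app \<sigma> Q = P} = {Q. morphism_app \<sigma> Q = P}" by auto
      then show "(\<Sum>Q\<in>{Q\<in>?A. morphism_app \<sigma> Q = P}. ram_index \<sigma> Q * ?m (morphism_app \<sigma> Q))
          = morphism_degree \<sigma> * ?m P"
        by (simp add: sum_ram_index(2)[OF \<sigma>] flip: sum_distrib_right)
    qed
    finally show ?thesis by (simp add: sum_distrib_left)
  qed
  have "{Q. morphism_app \<sigma>1 Q \<in> E} = {Q. morphism_app \<sigma>2 Q \<in> E}"
    using eq ram_index_pos[OF \<sigma>1(1)] ram_index_pos[OF \<sigma>2(1)]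
    by (auto simp: E_def) (metis mult_eq_0_iff of_nat_eq_0_iff less_irrefl)+
  then have "morphism_degree \<sigma>1 * (\<Sum>P\<in>E. ?m P) = morphism_degree \<sigma>2 * (\<Sum>P\<in>E. ?m P)"
    unfolding sum[OF \<sigma>1(1), symmetric] sum[OF \<sigma>2(1), symmetric] by (simp only: m)
  then have "(\<Sum>P\<in>E. ?m P) = 0" using deg by simp
  then have "rf_ord P ?f = 0" for P using finE by (auto simp: E_def)
  then show ?thesis using rf_const_if_no_zeros_poles[OF nz] that by blast
qed

section \<open>Group structure and weights\<close>

lemma semi_invariant_subgroups:
  fixes \<sigma>1 \<sigma>2 :: "'a::field ratfun"
  assumes \<sigma>1: "pline_morphism \<sigma>1" "tamely_ramified \<sigma>1"
    and \<sigma>2: "pline_morphism \<sigma>2" "tamely_ramified \<sigma>2"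
  defines "H \<equiv> {\<omega>. semi_invariant \<sigma>1 \<sigma>2 \<omega>}"
  shows "subgroup H form_group" "subgroup const_forms (form_group :: 'a form monoid)"
    "const_forms \<subseteq> H"
proof -
  interpret F: comm_group "form_group :: 'a form monoid" by (rule comm_group_form_group)
  let ?K1 = "rf_base_change \<sigma>1" and ?K2 = "rf_base_change \<sigma>2"
  have K: "pline_morphism ?K1" "tame ?K1" "pline_morphism ?K2" "tame ?K2"
    using assms by (simp_all add: tame_base_change)
  note bc = semi_invariant_base_change[OF \<sigma>1 \<sigma>2]
  have const: "semi_invariant \<sigma>1 \<sigma>2 (0, rf_const c)" if "c \<noteq> 0" for c
  proof -
    have "form_base_change (0, rf_const c) = (0, rf_const (to_ac c))"
      by (simp add: form_base_change_def)
    moreover have "semi_invariant ?K1 ?K2 (0, rf_const (to_ac c))"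
      unfolding semi_invariant_iff
    proof (intro conjI exI[of _ 1])
      show "snd (form_pullback ?K1 (0, rf_const (to_ac c)))
          = rf_const 1 * snd (form_pullback ?K2 (0, rf_const (to_ac c)))"
        by (simp add: form_pullback_def rf_compose_const[OF K(1)] rf_compose_const[OF K(3)])
    qed (use that in simp_all)
    ultimately show ?thesis using bc[of "(0, rf_const c)"] by simp
  qed
  then show "const_forms \<subseteq> H" by (auto simp: const_forms_def H_def)
  show "subgroup H form_group"
  proof (rule F.subgroupI)
    show "H \<subseteq> carrier form_group" by (auto simp: H_def semi_invariant_iff)
    show "H \<noteq> {}" using const[of 1] by (auto simp: H_def)
    fix \<omega> assume \<omega>: "\<omega> \<in> H"
    then have \<omega>K: "semi_invariant ?K1 ?K2 (form_base_change \<omega>)" by (simp add: H_def bc)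
    have nz: "snd \<omega> \<noteq> 0" using \<omega> by (simp add: H_def semi_invariant_iff)
    have "form_base_change (inv\<^bsub>form_group\<^esub> \<omega>)
        = (- fst (form_base_change \<omega>), inverse (snd (form_base_change \<omega>)))"
      by (simp add: inv_form_group nz form_base_change_def)
    then have "semi_invariant ?K1 ?K2 (form_base_change (inv\<^bsub>form_group\<^esub> \<omega>))"
      using semi_invariant_mult_inverse(2)[OF K \<omega>K \<omega>K] by simp
    then show "inv\<^bsub>form_group\<^esub> \<omega> \<in> H" by (simp add: H_def bc)
    fix \<eta> assume "\<eta> \<in> H"
    then have \<eta>K: "semi_invariant ?K1 ?K2 (form_base_change \<eta>)" by (simp add: H_def bc)
    have "form_base_change (\<omega> \<otimes>\<^bsub>form_group\<^esub> \<eta>)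
        = (fst (form_base_change \<omega>) + fst (form_base_change \<eta>),
           snd (form_base_change \<omega>) * snd (form_base_change \<eta>))"
      by (simp add: form_base_change_def)
    then have "semi_invariant ?K1 ?K2 (form_base_change (\<omega> \<otimes>\<^bsub>form_group\<^esub> \<eta>))"
      using semi_invariant_mult_inverse(1)[OF K \<omega>K \<eta>K] by simp
    then show "\<omega> \<otimes>\<^bsub>form_group\<^esub> \<eta> \<in> H" by (simp only: H_def bc mem_Collect_eq)
  qed
  show "subgroup const_forms (form_group :: 'a form monoid)"
  proof (rule F.subgroupI)
    show "const_forms \<subseteq> carrier (form_group :: 'a form monoid)" by (auto simp: const_forms_def)
    show "const_forms \<noteq> {}" by (auto simp: const_forms_def intro: exI[of _ 1])
    fix \<omega> :: "'a form" assume "\<omega> \<in> const_forms"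
    then obtain c where c: "\<omega> = (0, rf_const c)" "c \<noteq> 0" by (auto simp: const_forms_def)
    have "inv\<^bsub>form_group\<^esub> \<omega> = (0, rf_const (inverse c))" using c by (simp add: inv_form_group)
    then show "inv\<^bsub>form_group\<^esub> \<omega> \<in> const_forms"
      using c(2) by (auto simp: const_forms_def simp del: rf_const_inverse)
    fix \<eta> :: "'a form" assume "\<eta> \<in> const_forms"
    then obtain d where d: "\<eta> = (0, rf_const d)" "d \<noteq> 0" by (auto simp: const_forms_def)
    have "\<omega> \<otimes>\<^bsub>form_group\<^esub> \<eta> = (0, rf_const (c * d))" using c d by simp
    then show "\<omega> \<otimes>\<^bsub>form_group\<^esub> \<eta> \<in> const_forms"
      using c d by (auto simp: const_forms_def simp del: rf_const_simps)
  qed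
qed

lemma group_semi_invariant_group:
  fixes \<sigma>1 \<sigma>2 :: "'a::field ratfun"
  assumes \<sigma>1: "pline_morphism \<sigma>1" "tamely_ramified \<sigma>1"
    and \<sigma>2: "pline_morphism \<sigma>2" "tamely_ramified \<sigma>2"
  shows "group (semi_invariant_group \<sigma>1 \<sigma>2)"
    and "carrier (semi_invariant_group \<sigma>1 \<sigma>2) = form_class ` {\<omega>. semi_invariant \<sigma>1 \<sigma>2 \<omega>}"
proof -
  interpret F: comm_group "form_group :: 'a form monoid" by (rule comm_group_form_group)
  let ?H = "{\<omega>. semi_invariant \<sigma>1 \<sigma>2 \<omega>}"
  let ?G = "form_group\<lparr>carrier := ?H\<rparr>"
  note sub = semi_invariant_subgroups[OF \<sigma>1 \<sigma>2]
  have "group ?G" by (rule subgroup.subgroup_is_group[OF sub(1) F.group_axioms])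
  then have "comm_group ?G"
    by (rule group.group_comm_groupI) (auto simp: form_group_def algebra_simps)
  moreover have "subgroup const_forms ?G" by (rule F.subgroup_incl[OF sub(2,1,3)])
  ultimately have "const_forms \<lhd> ?G" by (rule comm_group.subgroup_imp_normal)
  then show "group (semi_invariant_group \<sigma>1 \<sigma>2)"
    unfolding semi_invariant_group_def by (rule normal.factorgroup_is_group)
  show "carrier (semi_invariant_group \<sigma>1 \<sigma>2) = form_class ` ?H"
    unfolding semi_invariant_group_def carrier_FactGroup by (simp add: form_class_def r_coset_def)
qed

text \<open>Constants have weight 0, so the weight is well defined on classes and additive; on a
  cyclic group its values are multiples of that of the generator.\<close>

lemma weight_dvd_of_generated:
  fixes \<sigma>1 \<sigma>2 :: "'a::field ratfun"
  assumes \<sigma>1: "pline_morphism \<sigma>1" "tamely_ramified \<sigma>1"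
    and \<sigma>2: "pline_morphism \<sigma>2" "tamely_ramified \<sigma>2"
    and \<omega>: "form_class \<omega> \<in> carrier (semi_invariant_group \<sigma>1 \<sigma>2)"
    and C: "C \<in> generate (semi_invariant_group \<sigma>1 \<sigma>2) {form_class \<omega>}" and \<theta>: "\<theta> \<in> C"
  shows "fst \<omega> dvd fst \<theta>"
proof -
  let ?G = "semi_invariant_group \<sigma>1 \<sigma>2"
  interpret G: group ?G by (rule group_semi_invariant_group[OF \<sigma>1 \<sigma>2])
  have one: "\<one>\<^bsub>?G\<^esub> = const_forms" by (simp add: semi_invariant_group_def)
  have mult: "A \<otimes>\<^bsub>?G\<^esub> B = (\<Union>a\<in>A. \<Union>b\<in>B. {(fst a + fst b, snd a * snd b)})" for A B
    by (simp add: semi_invariant_group_def set_mult_def form_group_def)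
  from C have "\<forall>\<theta>\<in>C. fst \<omega> dvd fst \<theta>"
  proof (induction C rule: generate.induct)
    case one
    then show ?case by (auto simp: \<open>\<one>\<^bsub>?G\<^esub> = const_forms\<close> const_forms_def)
  next
    case (incl h)
    then show ?case by (auto simp: form_class_eq)
  next
    case (inv h)
    show ?case
    proof
      fix \<theta> assume \<theta>: "\<theta> \<in> inv\<^bsub>?G\<^esub> h"
      have "inv\<^bsub>?G\<^esub> h \<otimes>\<^bsub>?G\<^esub> h = const_forms" using inv \<omega> by (simp flip: one)
      moreover have "\<omega> \<in> h"
        using inv by (auto simp: form_class_eq prod_eq_iff intro!: exI[of _ 1])
      ultimately have "(fst \<theta> + fst \<omega>, snd \<theta> * snd \<omega>) \<in> const_forms" using \<theta> mult by blast
      then have "fst \<theta> = - fst \<omega>" by (auto simp: const_forms_def)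
      then show "fst \<omega> dvd fst \<theta>" by simp
    qed
  next
    case (eng h1 h2)
    then show ?case by (auto simp: mult)
  qed
  then show ?thesis using \<theta> by blast
qed

text \<open>A semi-invariant form of weight 0 is constant and would generate only the trivial
  group.\<close>

lemma primitive_weight_nonzero:
  fixes \<sigma>1 \<sigma>2 :: "'a::field ratfun"
  assumes \<sigma>1: "pline_morphism \<sigma>1" "tamely_ramified \<sigma>1"
    and \<sigma>2: "pline_morphism \<sigma>2" "tamely_ramified \<sigma>2"
    and deg: "morphism_degree \<sigma>1 \<noteq> morphism_degree \<sigma>2"
    and nontrivial: "carrier (semi_invariant_group \<sigma>1 \<sigma>2) \<noteq> {\<one>\<^bsub>semi_invariant_group \<sigma>1 \<sigma>2\<^esub>}"
    and gen: "generate (semi_invariant_group \<sigma>1 \<sigma>2) {form_class \<omega>}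
      = carrier (semi_invariant_group \<sigma>1 \<sigma>2)"
    and inv: "semi_invariant \<sigma>1 \<sigma>2 \<omega>"
  shows "fst \<omega> \<noteq> 0"
proof
  assume wt: "fst \<omega> = 0"
  let ?G = "semi_invariant_group \<sigma>1 \<sigma>2"
  interpret G: group ?G by (rule group_semi_invariant_group[OF \<sigma>1 \<sigma>2])
  have "semi_invariant (rf_base_change \<sigma>1) (rf_base_change \<sigma>2) (form_base_change \<omega>)"
    using inv by (simp add: semi_invariant_base_change \<sigma>1 \<sigma>2)
  then obtain c where c: "c \<noteq> 0" "snd (form_base_change \<omega>) = rf_const c"
    using semi_invariant_weight_0[of "rf_base_change \<sigma>1" "rf_base_change \<sigma>2" "form_base_change \<omega>"]
      \<sigma>1 \<sigma>2 deg wt by (auto simp: tame_base_change)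
  then obtain c0 where "snd \<omega> = rf_const c0" "c = to_ac c0"
    using rf_base_change_eq_constE[of "snd \<omega>" c] by auto
  then have "form_class \<omega> = form_class (0, 1)"
    using c(1) wt by (intro form_class_eqI[of _ _ c0]) auto
  also have "\<dots> = \<one>\<^bsub>?G\<^esub>"
    by (simp add: semi_invariant_group_def form_class_eq const_forms_def)
  finally have "generate ?G {form_class \<omega>} = {\<one>\<^bsub>?G\<^esub>}" by (simp add: G.generate_one)
  then show False using gen nontrivial by simp
qed

text \<open>The conclusion speaks of classes and allows an inverse because a generator of an
  infinite cyclic group of classes is determined only up to constants and sign. It speaks of the
  closure because the poles of the flat form may be conjugate over k, as for
  \<open>dt / (t^2 - 2)\<close> over the rationals.\<close>

theorem theorem1p2:
  fixes \<sigma>1 \<sigma>2 \<sigma>1' \<sigma>2' :: "'k::field ratfun" and \<omega> :: "'k form"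
  assumes "alg_closed_field_type TYPE('k) \<or> number_field_type TYPE('k)"
    and "pline_morphism \<sigma>1" and "pline_morphism \<sigma>2"
    and "tamely_ramified \<sigma>1" and "tamely_ramified \<sigma>2"
    and "conjugate_pairs (\<sigma>1, \<sigma>2) (\<sigma>1', \<sigma>2')"
    and "\<exists>P. completely_ramified_at \<sigma>1' P" and "\<exists>P. completely_ramified_at \<sigma>2' P"
    and "morphism_degree \<sigma>1 \<ge> 14 * morphism_degree \<sigma>2"
    and "carrier (semi_invariant_group \<sigma>1 \<sigma>2) \<noteq> {\<one>\<^bsub>semi_invariant_group \<sigma>1 \<sigma>2\<^esub>}"
    and "primitive_form \<sigma>1 \<sigma>2 \<omega>"
  shows "\<exists>\<eta> :: 'k alg_closure form. flat \<eta> \<and>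
     (form_class (form_base_change \<omega>) = form_class \<eta> \<or>
      form_class (form_base_change \<omega>) = form_class (inv\<^bsub>form_group\<^esub> \<eta>))"
proof -
  note \<sigma>1 = assms(2,4) and \<sigma>2 = assms(3,5)
  let ?G = "semi_invariant_group \<sigma>1 \<sigma>2"
  let ?K1 = "rf_base_change \<sigma>1" and ?K2 = "rf_base_change \<sigma>2" and ?\<omega> = "form_base_change \<omega>"
  have K: "pline_morphism ?K1" "tame ?K1" "pline_morphism ?K2" "tame ?K2"
    using assms by (simp_all add: tame_base_change)
  have descent: "surj (to_ac :: 'k \<Rightarrow> 'k alg_closure) \<or> CHAR('k) = 0"
    using assms(1) surj_to_ac by (auto simp: number_field_type_def)
  have cls: "form_class \<omega> \<in> carrier ?G" and gen: "generate ?G {form_class \<omega>} = carrier ?G"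
    and nz: "snd \<omega> \<noteq> 0"
    using assms(11) by (simp_all add: primitive_form_def)
  obtain \<theta> where \<theta>: "semi_invariant \<sigma>1 \<sigma>2 \<theta>" "form_class \<omega> = form_class \<theta>"
    using cls unfolding group_semi_invariant_group(2)[OF \<sigma>1 \<sigma>2] by auto
  have inv: "semi_invariant \<sigma>1 \<sigma>2 \<omega>"
  proof -
    note sub = semi_invariant_subgroups[OF \<sigma>1 \<sigma>2]
    have "\<omega> \<in> form_class \<theta>"
      unfolding \<theta>(2)[symmetric] by (auto simp: form_class_eq prod_eq_iff intro!: exI[of _ 1])
    then obtain \<kappa> where "\<kappa> \<in> const_forms" "\<omega> = \<kappa> \<otimes>\<^bsub>form_group\<^esub> \<theta>"
      by (auto simp: form_class_def r_coset_def)
    then show ?thesis using subgroup.m_closed[OF sub(1)] sub(3) \<theta>(1) by blast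
  qed
  have deg_ne: "morphism_degree \<sigma>1 \<noteq> morphism_degree \<sigma>2"
    using assms(9) morphism_degree_pos[OF assms(3)] by linarith
  have wt: "fst \<omega> \<noteq> 0"
    by (rule primitive_weight_nonzero[OF \<sigma>1 \<sigma>2 deg_ne assms(10) gen inv])
  obtain \<phi> \<psi> where conj: "inverse_morphisms \<phi> \<psi>" "\<sigma>1' = rf_compose \<phi> (rf_compose \<sigma>1 \<psi>)"
    using assms(6) by (auto simp: conjugate_pairs_def)
  let ?\<phi> = "rf_base_change \<phi>" and ?\<psi> = "rf_base_change \<psi>"
  have "inverse_morphisms ?\<phi> ?\<psi>"
    using conj(1) by (simp add: inverse_morphisms_def flip: rf_base_change_compose)
  moreover obtain Q where "ram_index (rf_base_change \<sigma>1') Q = morphism_degree (rf_base_change \<sigma>1')"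
    using assms(7) by (auto simp: completely_ramified_at_def)
  ultimately have total: "ram_index ?K1 (morphism_app ?\<psi> Q) = morphism_degree ?K1"
    using K(1) unfolding conj(2) rf_base_change_compose by (intro total_ramification_conjugate)
  have invK: "semi_invariant ?K1 ?K2 ?\<omega>" using inv by (simp add: semi_invariant_base_change \<sigma>1 \<sigma>2)
  obtain \<eta> n c where \<eta>: "flat \<eta>" "snd \<eta> \<noteq> 0" "fst ?\<omega> = n * fst \<eta>" "c \<noteq> 0"
    "snd ?\<omega> = rf_const c * snd \<eta> powi n"
    by (rule semi_invariant_power_of_flat[OF K total _ invK]) (use assms(9) wt in auto)
  have n: "n \<noteq> 0" using \<eta>(3) wt by auto
  \<comment> \<open>For negative \<open>n\<close> the root is extracted for the inverse of
    \<open>\<eta>\<close>, whose exponent \<open>- n\<close> is positive.\<close>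
  obtain \<gamma> g0 where g0: "\<gamma> \<noteq> 0" "snd \<eta> = rf_const \<gamma> * rf_base_change g0"
  proof (cases "n > 0")
    case True
    then have "rf_base_change (snd \<omega>) = rf_const c * snd \<eta> ^ nat n"
      using \<eta>(5) by (simp add: power_int_def)
    then show ?thesis
      by (rule root_ratfun_descends[OF descent _ \<eta>(4,2)]) (use True that in auto)
  next
    case False
    then have "rf_base_change (snd \<omega>) = rf_const c * inverse (snd \<eta>) ^ nat (- n)"
      using \<eta>(5) n by (simp add: power_int_def)
    then obtain \<gamma> g0 where "\<gamma> \<noteq> 0" "inverse (snd \<eta>) = rf_const \<gamma> * rf_base_change g0"
      by (rule root_ratfun_descends[OF descent _ \<eta>(4)]) (use \<eta>(2) n False in auto)
    moreover from this have "snd \<eta> = inverse (rf_const \<gamma> * rf_base_change g0)"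
      by (metis inverse_inverse_eq)
    ultimately show ?thesis using that[of "inverse \<gamma>" "inverse g0"] by simp
  qed
  \<comment> \<open>The flat form rescaled so as to be defined over k. Being a root of
    \<open>\<omega>\<close> up to a constant it is semi-invariant, so its class is generated by that
    of \<open>\<omega>\<close>; the two weights then divide each other.\<close>
  define \<eta>0 where "\<eta>0 = (fst \<eta>, g0)"
  have \<omega>\<eta>0: "snd ?\<omega> = rf_const (c * \<gamma> powi n) * snd (form_base_change \<eta>0) powi n"
  proof -
    have "rf_const (\<gamma> powi n) = rf_const \<gamma> powi n" by (simp add: power_int_def)
    then show ?thesis unfolding \<eta>(5) g0(2) by (simp add: \<eta>0_def power_int_mult_distrib)
  qed
  have "semi_invariant ?K1 ?K2 (form_base_change \<eta>0)"
    by (rule semi_invariant_root[OF K invK _ _ \<omega>\<eta>0 n])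
      (use \<eta>(2,3,4) g0 in \<open>auto simp: \<eta>0_def\<close>)
  then have "semi_invariant \<sigma>1 \<sigma>2 \<eta>0" by (simp add: semi_invariant_base_change \<sigma>1 \<sigma>2)
  then have "form_class \<eta>0 \<in> generate ?G {form_class \<omega>}"
    unfolding gen group_semi_invariant_group(2)[OF \<sigma>1 \<sigma>2] by blast
  moreover have "\<eta>0 \<in> form_class \<eta>0"
    by (auto simp: form_class_eq prod_eq_iff intro!: exI[of _ 1])
  ultimately have "fst \<omega> dvd fst \<eta>0" by (rule weight_dvd_of_generated[OF \<sigma>1 \<sigma>2 cls])
  then obtain k where "fst \<eta> = fst \<omega> * k" by (auto simp: \<eta>0_def)
  then have "fst \<omega> * 1 = fst \<omega> * (n * k)" using \<eta>(3) by (simp add: algebra_simps)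
  then have "n * k = 1" using wt by (simp only: mult_cancel_left) simp
  then have "n = 1 \<or> n = - 1" by (auto simp: zmult_eq_1_iff)
  then show ?thesis
  proof
    assume "n = 1"
    then have "form_class ?\<omega> = form_class \<eta>"
      using \<eta> by (intro form_class_eqI[of _ _ c]) auto
    then show ?thesis using \<eta>(1) by blast
  next
    assume "n = - 1"
    then have "form_class ?\<omega> = form_class (inv\<^bsub>form_group\<^esub> \<eta>)"
      using \<eta> by (intro form_class_eqI[of _ _ c]) (auto simp: inv_form_group power_int_minus)
    then show ?thesis using \<eta>(1) by blast
  qed
qed

end
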